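(* Let $N\ge1$, $0<\alpha<2$ and $\lambda\in\mathbb{C}\setminus\{0\}$. There exists an initial value $u_0\in C^\infty_c(\mathbb{R}^N)$ such that the corresponding maximal solution $u\in C([0,T_{\max}),C_0(\mathbb{R}^N))$ of $$u_t=\Delta u+\lambda|u|^\alpha u,\qquad u(0,\cdot)=u_0,$$ has the following property: if $1<p<\infty$ and $s>5+\frac1p$, then $u(t)\notin H^{s,p}(\mathbb{R}^N)$ for all sufficiently small $0<t<T_{\max}$ (that is, there is $t_0\in(0,T_{\max})$ such that $u(t)\notin H^{s,p}(\mathbb{R}^N)$ for all $0<t<t_0$).
   Context: All functions are complex-valued. $C_0(\mathbb{R}^N)$ is the space of continuous functions on $\mathbb{R}^N$ vanishing at infinity, with the sup norm. $C^\infty_c(\mathbb{R}^N)$ is the space of smooth compactly supported functions. For $s\ge0$ and $1<p<\infty$, $H^{s,p}(\mathbb{R}^N)$ is the usual Sobolev (Bessel potential) space with norm $\|u\|_{H^{s,p}}=\|\mathcal{F}^{-1}[(1+|\xi|^2)^{s/2}\widehat{u}]\|_{L^p}$. The Cauchy problem is locally well posed in $C_0(\mathbb{R}^N)$: for every $u_0\in C_0(\mathbb{R}^N)$ there exist a maximal existence time $T_{\max}=T_{\max}(u_0)\in(0,\infty]$ and a unique maximal solution $u\in C([0,T_{\max}),C_0(\mathbb{R}^N))$, i.e. a solution of $u(t)=e^{t\Delta}u_0+\lambda\int_0^t e^{(t-\sigma)\Delta}(|u(\sigma)|^\alpha u(\sigma))\,d\sigma$, where $(e^{t\Delta})_{t\ge0}$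 is the heat semigroup on $\mathbb{R}^N$. *)

theory Defs
  imports "HOL-Analysis.Analysis"
begin

section \<open>Smooth functions\<close>

definition partial_deriv :: "'n::finite \<Rightarrow> (real^'n \<Rightarrow> complex) \<Rightarrow> real^'n \<Rightarrow> complex" where
  "partial_deriv i f = (\<lambda>x. frechet_derivative f (at x) (axis i 1))"

text \<open>A list of indices plays the role of a multi-index; its length is the order of the derivative.\<close>

definition partial_derivs :: "'n::finite list \<Rightarrow> (real^'n \<Rightarrow> complex) \<Rightarrow> real^'n \<Rightarrow> complex" where
  "partial_derivs is f = foldr partial_deriv is f"

definition smooth :: "(real^'n::finite \<Rightarrow> complex) \<Rightarrow> bool" where
  "smooth f \<longleftrightarrow> (\<forall>is. partial_derivs is f differentiable_on UNIV)"

definition Cc_infty :: "(real^'n::finite \<Rightarrow> complex) set" where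
  "Cc_infty = {f. smooth f \<and> compact (closure {x. f x \<noteq> 0})}"


section \<open>Tempered distributions and the Fourier transform\<close>

definition schwartz :: "(real^'n::finite \<Rightarrow> complex) set" where
  "schwartz = {\<phi>. smooth \<phi> \<and>
     (\<forall>k is. bdd_above (range (\<lambda>x. (1 + norm x) ^ k * norm (partial_derivs is \<phi> x))))}"

definition schwartz_seminorm :: "nat \<Rightarrow> (real^'n::finite \<Rightarrow> complex) \<Rightarrow> real" where
  "schwartz_seminorm m \<phi> =
     (SUP is\<in>{is. length is \<le> m}. SUP x. (1 + norm x) ^ m * norm (partial_derivs is \<phi> x))"

text \<open>
  A distribution is represented by a functional on all functions \<open>real^'n \<Rightarrow> complex\<close>, of which
  only the values on \<open>schwartz\<close> are meaningful.
\<close>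

type_synonym 'n distribution = "(real^'n \<Rightarrow> complex) \<Rightarrow> complex"

definition tempered :: "'n::finite distribution \<Rightarrow> bool" where
  "tempered L \<longleftrightarrow>
     (\<forall>\<phi>\<in>schwartz. \<forall>\<psi>\<in>schwartz. L (\<lambda>x. \<phi> x + \<psi> x) = L \<phi> + L \<psi>) \<and>
     (\<forall>c. \<forall>\<phi>\<in>schwartz. L (\<lambda>x. c * \<phi> x) = c * L \<phi>) \<and>
     (\<exists>C m. \<forall>\<phi>\<in>schwartz. norm (L \<phi>) \<le> C * schwartz_seminorm m \<phi>)"

definition fourier :: "(real^'n::finite \<Rightarrow> complex) \<Rightarrow> real^'n \<Rightarrow> complex" where
  "fourier \<phi> \<xi> = (LINT x|lborel. exp (- \<i> * of_real (x \<bullet> \<xi>)) * \<phi> x)"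

definition inv_fourier :: "(real^'n::finite \<Rightarrow> complex) \<Rightarrow> real^'n \<Rightarrow> complex" where
  "inv_fourier \<phi> x =
     (LINT \<xi>|lborel. exp (\<i> * of_real (x \<bullet> \<xi>)) * \<phi> \<xi>) / of_real ((2 * pi) ^ CARD('n))"

definition fourier_dist :: "'n::finite distribution \<Rightarrow> 'n distribution" where
  "fourier_dist L = (\<lambda>\<phi>. L (fourier \<phi>))"

definition inv_fourier_dist :: "'n::finite distribution \<Rightarrow> 'n distribution" where
  "inv_fourier_dist L = (\<lambda>\<phi>. L (inv_fourier \<phi>))"

definition mult_dist :: "(real^'n::finite \<Rightarrow> complex) \<Rightarrow> 'n distribution \<Rightarrow> 'n distribution" where
  "mult_dist m L = (\<lambda>\<phi>. L (\<lambda>x. m x * \<phi> x))"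

definition dist_of_fun :: "(real^'n::finite \<Rightarrow> complex) \<Rightarrow> 'n distribution" where
  "dist_of_fun f = (\<lambda>\<phi>. LINT x|lborel. f x * \<phi> x)"


section \<open>Bessel potential spaces\<close>

definition Lp_fun :: "real \<Rightarrow> (real^'n::finite \<Rightarrow> complex) set" where
  "Lp_fun p = {g \<in> borel_measurable lborel. integrable lborel (\<lambda>x. norm (g x) powr p)}"

definition bessel_symbol :: "real \<Rightarrow> real^'n::finite \<Rightarrow> complex" where
  "bessel_symbol s \<xi> = of_real ((1 + (norm \<xi>)\<^sup>2) powr (s / 2))"

definition sobolev :: "real \<Rightarrow> real \<Rightarrow> 'n::finite distribution set" where
  "sobolev s p = {L. tempered L \<and>
     (\<exists>g\<in>Lp_fun p. \<forall>\<phi>\<in>schwartz.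
        inv_fourier_dist (mult_dist (bessel_symbol s) (fourier_dist L)) \<phi> = dist_of_fun g \<phi>)}"


section \<open>The nonlinear heat equation\<close>

text \<open>
  \<open>C_0\<close> is a closed subspace of the Banach space of bounded continuous functions with the
  sup norm.
\<close>

definition C0 :: "((real^'n::finite) \<Rightarrow>\<^sub>C complex) set" where
  "C0 = {f. (apply_bcontfun f \<longlongrightarrow> 0) at_infinity}"

definition heat_kernel :: "real \<Rightarrow> real^'n::finite \<Rightarrow> real" where
  "heat_kernel t x = (4 * pi * t) powr (- real CARD('n) / 2) * exp (- (norm x)\<^sup>2 / (4 * t))"

definition heat :: "real \<Rightarrow> (real^'n::finite \<Rightarrow> complex) \<Rightarrow> real^'n \<Rightarrow> complex" where
  "heat t f x = (if t = 0 then f x else LINT y|lborel. of_real (heat_kernel t (x - y)) * f y)"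

text \<open>
  Evaluation at a point is a bounded linear functional on \<open>C_0\<close>, so the \<open>C_0\<close>-valued
  integral in Duhamel's formula is written pointwise; the integrand is continuous in \<open>\<sigma>\<close>.
\<close>

definition solution ::
  "real \<Rightarrow> complex \<Rightarrow> (real^'n::finite \<Rightarrow> complex) \<Rightarrow> ereal \<Rightarrow> (real \<Rightarrow> (real^'n) \<Rightarrow>\<^sub>C complex) \<Rightarrow> bool"
where
  "solution \<alpha> lam u0 T u \<longleftrightarrow>
     continuous_on {t. 0 \<le> t \<and> ereal t < T} u \<and>
     (\<forall>t. 0 \<le> t \<and> ereal t < T \<longrightarrow>
        u t \<in> C0 \<and>
        (\<forall>x. apply_bcontfun (u t) x = heat t u0 x +
           lam * integral {0..t} (\<lambda>\<sigma>. heat (t - \<sigma>)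
             (\<lambda>y. of_real (norm (apply_bcontfun (u \<sigma>) y) powr \<alpha>) * apply_bcontfun (u \<sigma>) y) x)))"

text \<open>
  Maximality includes uniqueness: every solution on an interval \<open>[0,T')\<close> is a restriction
  of \<open>u\<close>.  The existence time \<open>T\<close> may be infinite.
\<close>

definition maximal_solution ::
  "real \<Rightarrow> complex \<Rightarrow> (real^'n::finite \<Rightarrow> complex) \<Rightarrow> ereal \<Rightarrow> (real \<Rightarrow> (real^'n) \<Rightarrow>\<^sub>C complex) \<Rightarrow> bool"
where
  "maximal_solution \<alpha> lam u0 T u \<longleftrightarrow>
     0 < T \<and> solution \<alpha> lam u0 T u \<and>
     (\<forall>T' v. solution \<alpha> lam u0 T' v \<longrightarrow>
        T' \<le> T \<and> (\<forall>t. 0 \<le> t \<and> ereal t < T' \<longrightarrow> v t = u t))"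

end

theory Submission
  imports Defs "HOL-Probability.Probability" "HOL-Real_Asymp.Real_Asymp"
begin

text \<open>
  The initial value \<open>datum k\<close> is odd in the coordinate \<open>x $ k\<close> and is \<open>x $ k\<close> times a product of even
  bumps. The solution stays odd and, because the heat semigroup gains one
  derivative with an integrable loss in time, it differs from the initial value by at most
  \<open>C * sqrt t * \<bar>x $ k\<bar>\<close>. Hence, near the hyperplane \<open>x $ k = 0\<close>, the nonlinear term is
  \<open>\<bar>x $ k\<bar> powr \<alpha> * x $ k\<close> times a positive smooth function, up to a small relative error, and \<open>\<alpha> < 2\<close> makes the fifth normal derivative of Duhamel's integral
  diverge there. The divergence is detected by \<open>probe k \<epsilon> 0\<close>, a multiple of the fifth derivative of the heat kernel at
  time \<open>\<epsilon>\<close> in the normal variable times a fixed Gaussian in the tangential ones: applied to the heat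
  flow of a function at time \<open>\<tau>\<close> it gives \<open>probe k \<epsilon> \<tau>\<close> applied to the function, so Duhamel's integral
  contributes a multiple of the integral of \<open>(\<epsilon> + \<tau>) powr (\<alpha> / 2 - 2)\<close>, of order \<open>\<epsilon> powr (\<alpha> / 2 - 1)\<close>.

  On the other hand, \<open>Gamma (s / 2) * (1 + \<bar>\<xi>\<bar>\<^sup>2) powr (- s / 2)\<close> is the integral of
  \<open>\<tau> powr (s / 2 - 1) * exp (- \<tau>) * exp (- \<tau> * \<bar>\<xi>\<bar>\<^sup>2)\<close> over \<open>\<tau> > 0\<close>, so the Bessel potential of order \<open>s\<close>
  of \<open>probe k \<epsilon> 0\<close> is a mixture of the functions \<open>probe k \<epsilon> \<tau>\<close>. Their norms in the dual exponent are of
  order \<open>(\<epsilon> + \<tau>) powr (- 5 / 2 - 1 / (2 * p))\<close>, and the mixture is bounded uniformly in \<open>\<epsilon>\<close> when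
  \<open>s > 5 + 1 / p\<close>. A solution in \<open>H^{s,p}\<close> at time \<open>t\<close> would therefore pair boundedly with \<open>probe k \<epsilon> 0\<close>
  as \<open>\<epsilon>\<close> tends to zero.
\<close>


section \<open>Products and Gaussians on the real line\<close>

text \<open>Order five: \<open>\<bar>r\<bar> powr \<alpha> * r\<close> has Hoelder order 1 +
  \<alpha> at 0 and Duhamel's integral gains two, leaving 3 + \<alpha> < 5. The order must be odd
  since everything is odd in the normal variable, and order three would only give the integrable
  rate \<open>\<tau> powr (\<alpha> / 2 - 1)\<close>. The 1 / p in the threshold is the cost of
  concentrating at a set of codimension one. The obstacle is that the solution is known only
  approximately, and an error small in the sup norm is useless against test functions whose mass
  blows up. Relative to \<open>\<bar>x $ k\<bar>\<close>, however, the error changes the nonlinear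
  term by a small multiple of \<open>\<bar>x $ k\<bar> powr (\<alpha> + 1)\<close>, which scales
  like the main term and is absorbed for small times. Solutions are complex-valued, so it is the
  real part of the pairing with \<open>pnl \<alpha> (u \<sigma>)\<close>, before the factor
  \<open>lam\<close>, that is estimated. Maximality includes uniqueness, so the maximal solution has
  to be constructed; a fixed point argument inside the odd functions also yields the symmetry and a
  bound on the solution.\<close>

lemma prod_Basis_vec:
  fixes f :: "'n::finite \<Rightarrow> 'a::comm_monoid_mult"
  shows "(\<Prod>b\<in>(Basis::(real^'n) set). f (SOME i. b = axis i 1)) = (\<Prod>i\<in>UNIV. f i)"
proof (rule prod.reindex_cong[where l="\<lambda>i. axis i 1"])
  show "inj (\<lambda>i::'n. axis i (1::real))"
    by (simp add: inj_on_def axis_eq_axis)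
  show "Basis = range (\<lambda>i::'n. axis i (1::real))"
    by (auto simp: Basis_vec_def)
  show "f (SOME j. axis i (1::real) = axis j 1) = f i" for i :: 'n
    by (simp add: axis_eq_axis)
qed

text \<open>The product measure behind \<open>lborel\<close> is indexed by basis vectors, so the
  factors are first relabelled along \<open>axis i 1\<close>; Fubini for finite products does the
  rest. The explicit integrals of heat kernels and probes are reduced to the line in this
  way.\<close>

lemma
  fixes f :: "'n::finite \<Rightarrow> real \<Rightarrow> 'b::{real_normed_field,banach,second_countable_topology}"
  assumes f: "\<And>i. integrable lborel (f i)"
  shows integrable_prod_vec: "integrable lborel (\<lambda>x::real^'n. \<Prod>i\<in>UNIV. f i (x$i))"
    and integral_prod_vec:
      "(LINT x|(lborel::(real^'n) measure). (\<Prod>i\<in>UNIV. f i (x$i))) = (\<Prod>i\<in>UNIV. LINT r|lborel. f i r)"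
proof -
  define g where "g = (\<lambda>b::real^'n. f (SOME i. b = axis i 1))"
  interpret product_sigma_finite "\<lambda>b::real^'n. lborel :: real measure"
    by standard
  have m[measurable]: "f i \<in> borel_measurable borel" for i
    using f[of i] by (simp add: integrable_iff_bounded)
  have gi: "integrable lborel (g b)" for b
    unfolding g_def by (rule f)
  have g': "(\<Prod>i\<in>UNIV. f i (x$i)) = (\<Prod>b\<in>Basis. g b (x \<bullet> b))" for x :: "real^'n"
  proof -
    have "(\<Prod>b\<in>Basis. g b (x \<bullet> b)) = (\<Prod>b\<in>(Basis::(real^'n) set). (\<lambda>i. f i (x $ i)) (SOME i. b = axis i 1))"
    proof (rule prod.cong[OF refl])
      fix b :: "real^'n" assume "b \<in> Basis"
      then obtain i where b: "b = axis i 1" by (auto simp: Basis_vec_def)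
      have "(SOME i. b = axis i 1) = i" unfolding b by (simp add: axis_eq_axis)
      then show "g b (x \<bullet> b) = (\<lambda>i. f i (x $ i)) (SOME i. b = axis i 1)"
        by (simp add: g_def) (simp add: b inner_axis)
    qed
    then show ?thesis using prod_Basis_vec[of "\<lambda>i. f i (x $ i)"] by simp
  qed
  let ?P = "\<lambda>z::(real^'n) \<Rightarrow> real. (\<Sum>b\<in>Basis. z b *\<^sub>R b)"
  have meas: "?P \<in> measurable (Pi\<^sub>M Basis (\<lambda>b. lborel)) borel"
    by measurable
  have mf[measurable]: "(\<lambda>x::real^'n. \<Prod>i\<in>UNIV. f i (x$i)) \<in> borel_measurable borel"
    by measurable
  have e: "(\<Prod>i\<in>UNIV. f i (?P z $ i)) = (\<Prod>b\<in>Basis. g b (z b))" for z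
    unfolding g' by (rule prod.cong) simp_all
  have eq: "(lborel :: (real^'n) measure) = distr (Pi\<^sub>M Basis (\<lambda>b. lborel)) borel ?P"
    by (rule lborel_eq)
  show "integrable lborel (\<lambda>x::real^'n. \<Prod>i\<in>UNIV. f i (x$i))"
    unfolding eq
    by (subst integrable_distr_eq[OF meas mf], unfold e, rule product_integrable_prod)
       (auto intro: gi)
  have "(LINT x|(lborel::(real^'n) measure). (\<Prod>i\<in>UNIV. f i (x$i))) = (\<Prod>b\<in>Basis. LINT r|lborel. g b r)"
    unfolding eq
    by (subst integral_distr[OF meas mf], unfold e, rule product_integral_prod)
       (auto intro: gi)
  also have "\<dots> = (\<Prod>i\<in>UNIV. LINT r|lborel. f i r)"
    unfolding g_def by (rule prod_Basis_vec[of "\<lambda>i. LINT r|lborel. f i r"])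
  finally show "(LINT x|(lborel::(real^'n) measure). (\<Prod>i\<in>UNIV. f i (x$i))) = (\<Prod>i\<in>UNIV. LINT r|lborel. f i r)" .
qed

text \<open>A single term of the exponential series dominates
  \<open>(b * (1 + r\<^sup>2)) ^ m\<close>. The dependence on \<open>b\<close> is kept explicit
  because \<open>gauss_family_bound\<close> takes \<open>b = 1 / (4 * (a + \<tau>))\<close> and
  needs polynomial growth in \<tau>.\<close>

lemma poly_gauss_bounded:
  fixes b :: real assumes "b > 0"
  shows "(1 + \<bar>r\<bar>) ^ m * exp (- b * r\<^sup>2) \<le> 2 ^ m * exp b * fact m / b ^ m"
proof -
  have "(b * (1 + r\<^sup>2)) ^ m / fact m \<le> exp (b * (1 + r\<^sup>2))"
  proof -
    have "(\<Sum>i\<in>{m}. (b * (1 + r\<^sup>2)) ^ i /\<^sub>R fact i) \<le> exp (b * (1 + r\<^sup>2))"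
      unfolding exp_def using assms
      by (intro sum_le_suminf summable_exp_generic) auto
    then show ?thesis by (simp add: field_simps)
  qed
  then have 1: "(1 + r\<^sup>2) ^ m * exp (- (b * (1 + r\<^sup>2))) \<le> fact m / b ^ m"
  proof -
    have "(b * (1 + r\<^sup>2)) ^ m \<le> fact m * exp (b * (1 + r\<^sup>2))"
      using \<open>(b * (1 + r\<^sup>2)) ^ m / fact m \<le> exp (b * (1 + r\<^sup>2))\<close> by (simp add: field_simps)
    then have "b ^ m * (1 + r\<^sup>2) ^ m * exp (- (b * (1 + r\<^sup>2)))
        \<le> fact m * exp (b * (1 + r\<^sup>2)) * exp (- (b * (1 + r\<^sup>2)))"
      by (intro mult_right_mono) (simp_all add: power_mult_distrib)
    then show ?thesis
      using assms by (simp add: field_simps flip: exp_add)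
  qed
  have "1 + \<bar>r\<bar> \<le> 2 * (1 + r\<^sup>2)"
    using zero_le_power2[of "\<bar>r\<bar> - 1/4"] by (simp add: power2_eq_square algebra_simps abs_if split: if_splits)
  then have "(1 + \<bar>r\<bar>) ^ m \<le> (2 * (1 + r\<^sup>2)) ^ m"
    by (intro power_mono) auto
  then have "(1 + \<bar>r\<bar>) ^ m * exp (- b * r\<^sup>2) \<le> (2 * (1 + r\<^sup>2)) ^ m * exp (- b * r\<^sup>2)"
    by (rule mult_right_mono) simp
  also have "\<dots> = 2 ^ m * exp b * ((1 + r\<^sup>2) ^ m * exp (- (b * (1 + r\<^sup>2))))"
  proof -
    have "exp (- b * r\<^sup>2) = exp b * exp (- (b * (1 + r\<^sup>2)))"
      by (simp add: algebra_simps flip: exp_add)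
    then show ?thesis unfolding power_mult_distrib by simp
  qed
  also have "\<dots> \<le> 2 ^ m * exp b * (fact m / b ^ m)"
    by (intro mult_left_mono 1) simp
  finally show ?thesis by simp
qed

text \<open>Half of the Gaussian absorbs the polynomial; the other half is a multiple of a normal
  density.\<close>

lemma integrable_poly_gauss:
  fixes b :: real assumes "b > 0"
  shows "integrable lborel (\<lambda>r. (1 + \<bar>r\<bar>) ^ m * exp (- b * r\<^sup>2))"
proof (rule Bochner_Integration.integrable_bound)
  define \<sigma> where "\<sigma> = sqrt (1 / b)"
  have s: "2 * \<sigma>\<^sup>2 = 2 / b" using assms by (simp add: \<sigma>_def)
  have "integrable lborel (\<lambda>r. sqrt (2 * pi * \<sigma>\<^sup>2) * normal_density 0 \<sigma> r)"
    using assms by (intro integrable_mult_right integrable_normal_density) (simp add: \<sigma>_def)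
  then have "integrable lborel (\<lambda>r. exp (- (b/2) * r\<^sup>2))"
    using assms by (simp add: normal_density_def s \<sigma>_def mult.commute)
  then show "integrable lborel (\<lambda>r. (2 ^ m * exp (b/2) * fact m / (b/2) ^ m) * exp (- (b/2) * r\<^sup>2))"
    by simp
  show "AE r in lborel. norm ((1 + \<bar>r\<bar>) ^ m * exp (- b * r\<^sup>2))
       \<le> norm ((2 ^ m * exp (b/2) * fact m / (b/2) ^ m) * exp (- (b/2) * r\<^sup>2))"
  proof (rule AE_I2)
    fix r :: real
    have "(1 + \<bar>r\<bar>) ^ m * exp (- b * r\<^sup>2) = ((1 + \<bar>r\<bar>) ^ m * exp (- (b/2) * r\<^sup>2)) * exp (- (b/2) * r\<^sup>2)"
      by (simp flip: exp_add)
    also have "\<dots> \<le> (2 ^ m * exp (b/2) * fact m / (b/2) ^ m) * exp (- (b/2) * r\<^sup>2)"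
      using assms by (intro mult_right_mono poly_gauss_bounded) auto
    finally show "norm ((1 + \<bar>r\<bar>) ^ m * exp (- b * r\<^sup>2))
       \<le> norm ((2 ^ m * exp (b/2) * fact m / (b/2) ^ m) * exp (- (b/2) * r\<^sup>2))"
      using assms by simp
  qed
qed measurable

lemma integrable_gauss_le:
  fixes f :: "real \<Rightarrow> 'b::{banach,second_countable_topology}" and b :: real
  assumes "b > 0" and [measurable]: "f \<in> borel_measurable borel"
    and "\<And>r. norm (f r) \<le> C * ((1 + \<bar>r\<bar>) ^ m * exp (- b * r\<^sup>2))"
  shows "integrable lborel f"
  by (rule Bochner_Integration.integrable_bound[OF integrable_mult_right[OF integrable_poly_gauss[OF assms(1)], of C m]])
     (auto intro!: order_trans[OF assms(3)])

section \<open>Oscillating moments of Gaussians\<close>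

lemma integral_real_line_derivative:
  fixes f F :: "real \<Rightarrow> 'a::euclidean_space"
  assumes "\<And>x. (F has_vector_derivative f x) (at x)" "continuous_on UNIV f" "integrable lborel f"
    and "(F \<longlongrightarrow> 0) at_top" "(F \<longlongrightarrow> 0) at_bot"
  shows "(LINT x|lborel. f x) = 0"
proof -
  have "(LBINT x=-\<infinity>..\<infinity>. f x) = 0 - 0"
  proof (rule interval_integral_FTC_integrable)
    show "set_integrable lborel (einterval (- \<infinity>) \<infinity>) f"
      using assms(3) by (simp add: einterval_def set_integrable_def)
    show "((F \<circ> real_of_ereal) \<longlongrightarrow> 0) (at_right (-\<infinity>))"
      by (simp add: ereal_tendsto_simps assms)
    show "((F \<circ> real_of_ereal) \<longlongrightarrow> 0) (at_left \<infinity>)"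
      by (simp add: ereal_tendsto_simps assms)
  qed (use assms(1,2) in \<open>auto simp: continuous_on_eq_continuous_at[OF open_UNIV]\<close>)
  then show ?thesis
    by (simp add: interval_lebesgue_integral_def einterval_def set_lebesgue_integral_def)
qed

lemma tendsto_0_poly_gauss:
  fixes F :: "real \<Rightarrow> 'a::real_normed_vector" and b :: real
  assumes "b > 0" "\<And>r. norm (F r) \<le> C * ((1 + \<bar>r\<bar>) ^ m * exp (- b * r\<^sup>2))"
  shows "(F \<longlongrightarrow> 0) at_top" "(F \<longlongrightarrow> 0) at_bot"
proof -
  define D where "D = \<bar>C\<bar> * (2 ^ Suc m * exp b * fact (Suc m) / b ^ Suc m)"
  have le: "norm (F r) \<le> D / (1 + \<bar>r\<bar>)" for r
  proof -
    have "norm (F r) * (1 + \<bar>r\<bar>) \<le> C * ((1 + \<bar>r\<bar>) ^ m * exp (- b * r\<^sup>2)) * (1 + \<bar>r\<bar>)"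
      by (intro mult_right_mono assms) auto
    also have "\<dots> \<le> \<bar>C\<bar> * ((1 + \<bar>r\<bar>) ^ m * exp (- b * r\<^sup>2)) * (1 + \<bar>r\<bar>)"
      by (intro mult_right_mono) auto
    also have "\<dots> = \<bar>C\<bar> * ((1 + \<bar>r\<bar>) ^ Suc m * exp (- b * r\<^sup>2))" by simp
    also have "\<dots> \<le> D"
      unfolding D_def by (intro mult_left_mono poly_gauss_bounded assms) simp
    finally show ?thesis by (simp add: field_simps)
  qed
  have 1: "((\<lambda>r. D / (1 + \<bar>r\<bar>)) \<longlongrightarrow> 0) at_top" "((\<lambda>r. D / (1 + \<bar>r\<bar>)) \<longlongrightarrow> 0) at_bot"
    by real_asymp+
  show "(F \<longlongrightarrow> 0) at_top" "(F \<longlongrightarrow> 0) at_bot"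
    by (rule Lim_null_comparison[OF _ 1(1)] Lim_null_comparison[OF _ 1(2)], simp add: le)+
qed

text \<open>The substitution x = sqrt (2 b) r turns the integral into the characteristic function of
  the standard normal distribution.\<close>

lemma gauss_char:
  fixes b \<xi> :: real assumes b: "b > 0"
  shows "(LINT r|lborel. of_real (exp (- b * r\<^sup>2)) * exp (\<i> * of_real (r * \<xi>)))
     = complex_of_real (sqrt (pi / b) * exp (- \<xi>\<^sup>2 / (4 * b)))"
proof -
  define t where "t = \<xi> / sqrt (2 * b)"
  have sq: "sqrt (2 * b) > 0" using b by simp
  have "complex_of_real (exp (- t\<^sup>2 / 2)) = char std_normal_distribution t"
    by (simp add: char_std_normal_distribution)
  also have "\<dots> = (LINT x|lborel. std_normal_density x *\<^sub>R exp (\<i> * of_real (t * x)))"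
    unfolding char_def by (subst integral_density) auto
  also have "\<dots> = \<bar>sqrt (2 * b)\<bar> *\<^sub>R (LINT r|lborel. std_normal_density (0 + sqrt (2 * b) * r) *\<^sub>R
      exp (\<i> * of_real (t * (0 + sqrt (2 * b) * r))))"
    using sq by (intro lborel_integral_real_affine) auto
  also have "\<dots> = sqrt (2 * b) *\<^sub>R (LINT r|lborel. (1 / sqrt (2 * pi)) *\<^sub>R
      (of_real (exp (- b * r\<^sup>2)) * exp (\<i> * of_real (r * \<xi>))))"
  proof -
    have "std_normal_density (0 + sqrt (2 * b) * r) *\<^sub>R exp (\<i> * of_real (t * (0 + sqrt (2 * b) * r)))
      = (1 / sqrt (2 * pi)) *\<^sub>R (of_real (exp (- b * r\<^sup>2)) * exp (\<i> * of_real (r * \<xi>)))" for r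
    proof -
      have 1: "t * (0 + sqrt (2 * b) * r) = r * \<xi>" using sq by (simp add: t_def)
      have 2: "- (0 + sqrt (2 * b) * r)\<^sup>2 / 2 = - b * r\<^sup>2"
        using b by (simp add: power_mult_distrib)
      show ?thesis
        unfolding 1 std_normal_density_def 2 by (simp add: scaleR_conv_of_real)
    qed
    then show ?thesis using sq by simp
  qed
  also have "\<dots> = (sqrt (2 * b) / sqrt (2 * pi)) *\<^sub>R
      (LINT r|lborel. of_real (exp (- b * r\<^sup>2)) * exp (\<i> * of_real (r * \<xi>)))"
    by simp
  finally have "complex_of_real (exp (- t\<^sup>2 / 2)) = \<dots>" .
  moreover have "t\<^sup>2 / 2 = \<xi>\<^sup>2 / (4 * b)"
    using b by (simp add: t_def power_divide)
  moreover have "sqrt (2 * b) / sqrt (2 * pi) = 1 / sqrt (pi / b)"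
    using b by (simp add: real_sqrt_divide real_sqrt_mult)
  ultimately have e: "complex_of_real (exp (- (\<xi>\<^sup>2 / (4 * b)))) = (1 / sqrt (pi / b)) *\<^sub>R
      (LINT r|lborel. of_real (exp (- b * r\<^sup>2)) * exp (\<i> * of_real (r * \<xi>)))"
    by simp
  have "sqrt (pi / b) > 0" using b by simp
  then have "(LINT r|lborel. of_real (exp (- b * r\<^sup>2)) * exp (\<i> * of_real (r * \<xi>)))
      = sqrt (pi / b) *\<^sub>R complex_of_real (exp (- (\<xi>\<^sup>2 / (4 * b))))"
    unfolding e using b by simp
  then show ?thesis by (simp add: scaleR_conv_of_real)
qed

definition gmom :: "nat \<Rightarrow> real \<Rightarrow> real \<Rightarrow> complex" where
  "gmom k b \<xi> = (LINT r|lborel. of_real (r ^ k * exp (- b * r\<^sup>2)) * exp (\<i> * of_real (r * \<xi>)))"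

lemma norm_gmom_integrand:
  "norm (complex_of_real (r ^ k * exp (- b * r\<^sup>2)) * exp (\<i> * of_real (r * \<xi>)))
     \<le> 1 * ((1 + \<bar>r\<bar>) ^ k * exp (- b * r\<^sup>2))"
proof -
  have "\<bar>r\<bar> ^ k \<le> (1 + \<bar>r\<bar>) ^ k" by (intro power_mono) auto
  then show ?thesis by (simp add: norm_mult norm_power power_abs)
qed

lemma integrable_gmom:
  assumes "b > 0"
  shows "integrable lborel (\<lambda>r. complex_of_real (r ^ k * exp (- b * r\<^sup>2)) * exp (\<i> * of_real (r * \<xi>)))"
  by (rule integrable_gauss_le[OF assms _ norm_gmom_integrand]) measurable

text \<open>Integration by parts: the derivative of r^k exp (- b r^2) exp (i r \<xi>) has integral
  zero, and the identity is solved for the moment of highest order. For \<open>k = 0\<close> the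
  truncated index \<open>k - 1\<close> is harmless, since its term carries the factor 0.\<close>

lemma gmom_Suc:
  assumes b: "b > 0"
  shows "gmom (Suc k) b \<xi> = (of_nat k * gmom (k - 1) b \<xi> + \<i> * of_real \<xi> * gmom k b \<xi>) / of_real (2 * b)"
proof -
  define F where "F = (\<lambda>k r. complex_of_real (r ^ k * exp (- b * r\<^sup>2)) * exp (\<i> * of_real (r * \<xi>)))"
  define f where "f = (\<lambda>r. of_nat k * F (k - 1) r + \<i> * of_real \<xi> * F k r - of_real (2 * b) * F (Suc k) r)"
  have int: "integrable lborel (F k)" for k
    unfolding F_def by (rule integrable_gmom[OF b])
  have "(LINT r|lborel. f r) = 0"
  proof (rule integral_real_line_derivative)
    show "(F k has_vector_derivative f x) (at x)" for x
    proof -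
      have "((\<lambda>r. r ^ k * exp (- b * r\<^sup>2)) has_real_derivative
          (real k * x ^ (k - 1) * exp (- b * x\<^sup>2) - 2 * b * (x ^ Suc k * exp (- b * x\<^sup>2)))) (at x)"
        by (auto intro!: derivative_eq_intros simp: algebra_simps)
      then have 1: "((\<lambda>r. complex_of_real (r ^ k * exp (- b * r\<^sup>2))) has_vector_derivative
          complex_of_real (real k * x ^ (k - 1) * exp (- b * x\<^sup>2) - 2 * b * (x ^ Suc k * exp (- b * x\<^sup>2)))) (at x)"
        by (intro has_vector_derivative_of_real) (simp add: has_real_derivative_iff_has_vector_derivative)
      have 2: "((\<lambda>r. exp (\<i> * complex_of_real (r * \<xi>))) has_vector_derivative
          (\<i> * of_real \<xi> * exp (\<i> * of_real (x * \<xi>)))) (at x)"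
      proof -
        have "((\<lambda>z. exp (\<i> * (z * of_real \<xi>))) has_field_derivative
            (\<i> * of_real \<xi> * exp (\<i> * (of_real x * of_real \<xi>)))) (at (complex_of_real x))"
          by (auto intro!: derivative_eq_intros)
        then show ?thesis
          using has_vector_derivative_real_field by fastforce
      qed
      show ?thesis
        unfolding F_def f_def
        by (rule has_vector_derivative_eq_rhs[OF has_vector_derivative_mult[OF 1 2]])
           (simp add: algebra_simps)
    qed
    show "continuous_on UNIV f"
      unfolding f_def F_def by (intro continuous_intros)
    show "integrable lborel f"
      unfolding f_def
      by (intro Bochner_Integration.integrable_diff Bochner_Integration.integrable_add integrable_mult_right int)
    show "(F k \<longlongrightarrow> 0) at_top" "(F k \<longlongrightarrow> 0) at_bot"
      unfolding F_def by (rule tendsto_0_poly_gauss[OF b norm_gmom_integrand])+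
  qed
  moreover have "(LINT r|lborel. f r) = of_nat k * gmom (k - 1) b \<xi> + \<i> * of_real \<xi> * gmom k b \<xi>
      - of_real (2 * b) * gmom (Suc k) b \<xi>"
  proof -
    have "gmom j b \<xi> = (LINT r|lborel. F j r)" for j by (simp only: gmom_def F_def)
    then show ?thesis unfolding f_def by (simp add: int)
  qed
  ultimately show ?thesis using b by (simp add: field_simps)
qed

text \<open>Completing the square gives a Gaussian of total mass \<open>A\<close>, variance
  \<open>c\<close> and imaginary mean \<open>y\<close>; the polynomials are its raw moments. The
  even orders 2 and 4 occur only as intermediate steps of the recurrence.\<close>

lemma gmom_values:
  fixes b \<xi> :: real
  assumes b: "b > 0"
  defines "A \<equiv> complex_of_real (sqrt (pi / b) * exp (- \<xi>\<^sup>2 / (4 * b)))"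
    and "c \<equiv> complex_of_real (1 / (2 * b))" and "y \<equiv> \<i> * complex_of_real (\<xi> / (2 * b))"
  shows "gmom 0 b \<xi> = A" "gmom 1 b \<xi> = y * A" "gmom 3 b \<xi> = (3 * c * y + y ^ 3) * A"
    "gmom 5 b \<xi> = (15 * c\<^sup>2 * y + 10 * c * y ^ 3 + y ^ 5) * A"
proof -
  have rec: "gmom (Suc k) b \<xi> = of_nat k * c * gmom (k - 1) b \<xi> + y * gmom k b \<xi>" for k
    unfolding gmom_Suc[OF b] c_def y_def by (simp add: add_divide_distrib)
  show 0: "gmom 0 b \<xi> = A"
    using gauss_char[OF b, of \<xi>] by (simp add: gmom_def A_def)
  show 1: "gmom 1 b \<xi> = y * A" using rec[of 0] 0 by simp
  have 2: "gmom 2 b \<xi> = (c + y\<^sup>2) * A"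
    using rec[of 1] 0 1 by (simp add: numeral_2_eq_2 algebra_simps)
  show 3: "gmom 3 b \<xi> = (3 * c * y + y ^ 3) * A"
    using rec[of 2] 1 2 by (simp add: eval_nat_numeral algebra_simps)
  have 4: "gmom 4 b \<xi> = (3 * c\<^sup>2 + 6 * c * y\<^sup>2 + y ^ 4) * A"
    using rec[of 3] 3 2 by (simp add: eval_nat_numeral algebra_simps)
  show "gmom 5 b \<xi> = (15 * c\<^sup>2 * y + 10 * c * y ^ 3 + y ^ 5) * A"
    using rec[of 4] 3 4 by (simp add: eval_nat_numeral algebra_simps)
qed

section \<open>The heat kernel on the line and its fifth derivative, with their Fourier
  transforms\<close>

definition gauss1 :: "real \<Rightarrow> real \<Rightarrow> real" where
  "gauss1 a r = exp (- r\<^sup>2 / (4 * a)) / sqrt (4 * pi * a)"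

text \<open>\<open>quint1 a\<close> is \<open>- 4 * sqrt pi\<close> times the fifth derivative of \<open>gauss1 a\<close>.\<close>

definition quint1 :: "real \<Rightarrow> real \<Rightarrow> real" where
  "quint1 a r = r / (a ^ 3 * sqrt a) * (15 / 4 - 5 / 4 * (r\<^sup>2 / a) + 1 / 16 * (r\<^sup>2 / a)\<^sup>2) * exp (- r\<^sup>2 / (4 * a))"

lemma gauss1_fourier:
  assumes "a > 0"
  shows "(LINT r|lborel. of_real (gauss1 a r) * exp (\<i> * of_real (r * \<xi>))) = complex_of_real (exp (- a * \<xi>\<^sup>2))"
proof -
  have p: "1 / (4 * a) > 0" using assms by simp
  have "(LINT r|lborel. of_real (gauss1 a r) * exp (\<i> * of_real (r * \<xi>)))
    = (LINT r|lborel. of_real (1 / sqrt (4 * pi * a)) * (of_real (exp (- (1 / (4 * a)) * r\<^sup>2)) * exp (\<i> * of_real (r * \<xi>))))"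
    by (rule Bochner_Integration.integral_cong) (auto simp: gauss1_def)
  also have "\<dots> = of_real (1 / sqrt (4 * pi * a)) * of_real (sqrt (pi / (1 / (4 * a))) * exp (- \<xi>\<^sup>2 / (4 * (1 / (4 * a)))))"
    by (subst integral_mult_right_zero, subst gauss_char[OF p]) simp
  also have "\<dots> = complex_of_real (exp (- a * \<xi>\<^sup>2))"
    using assms by (simp add: field_simps flip: of_real_mult)
  finally show ?thesis .
qed

lemma gauss1_inv_fourier:
  assumes "a > 0"
  shows "(LINT \<xi>|lborel. of_real (exp (- a * \<xi>\<^sup>2)) * exp (- \<i> * of_real (r * \<xi>))) = complex_of_real (2 * pi * gauss1 a r)"
proof -
  have "(LINT \<xi>|lborel. of_real (exp (- a * \<xi>\<^sup>2)) * exp (- \<i> * of_real (r * \<xi>)))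
     = (LINT \<xi>|lborel. of_real (exp (- a * \<xi>\<^sup>2)) * exp (\<i> * of_real (\<xi> * (- r))))"
    by (rule Bochner_Integration.integral_cong) (auto simp: mult_ac)
  also have "\<dots> = complex_of_real (sqrt (pi / a) * exp (- (- r)\<^sup>2 / (4 * a)))"
    by (rule gauss_char[OF assms])
  also have "sqrt (pi / a) * exp (- (- r)\<^sup>2 / (4 * a)) = 2 * pi * gauss1 a r"
  proof -
    have "sqrt (4 * pi * a) * sqrt (pi / a) = 2 * pi"
      using assms by (simp add: real_sqrt_mult real_sqrt_divide)
    then show ?thesis using assms by (simp add: gauss1_def field_simps)
  qed
  finally show ?thesis .
qed

lemma quint1_inv_fourier:
  assumes a: "a > 0"
  shows "(LINT \<xi>|lborel. of_real (\<xi> ^ 5 * exp (- a * \<xi>\<^sup>2)) * exp (- \<i> * of_real (r * \<xi>)))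
    = - (\<i> * of_real (sqrt pi / 2)) * complex_of_real (quint1 a r)"
proof -
  have "(LINT \<xi>|lborel. of_real (\<xi> ^ 5 * exp (- a * \<xi>\<^sup>2)) * exp (- \<i> * of_real (r * \<xi>))) = gmom 5 a (- r)"
    unfolding gmom_def by (rule Bochner_Integration.integral_cong) (auto simp: mult_ac)
  also have "\<dots> = - (\<i> * of_real (sqrt pi / 2)) * complex_of_real (quint1 a r)"
  proof -
    have s: "sqrt (pi / a) = sqrt pi / sqrt a" by (simp add: real_sqrt_divide)
    have "complex_of_real (r / (a ^ 3 * sqrt a)) = complex_of_real r / (of_real a ^ 3 * of_real (sqrt a))" by simp
    have i5: "\<i> ^ 5 = \<i>" "\<i> ^ 3 = - \<i>" by (simp_all add: eval_nat_numeral)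
    show ?thesis
      unfolding gmom_values(4)[OF a] quint1_def s using a
      by (simp add: power_mult_distrib i5) (simp add: field_simps eval_nat_numeral)
  qed
  finally show ?thesis .
qed

text \<open>This direction is computed from the moments as well, so that both transforms of the
  probes are explicit and no inversion theorem has to be invoked.\<close>

lemma quint1_fourier:
  assumes a: "a > 0"
  shows "(LINT r|lborel. of_real (quint1 a r) * exp (\<i> * of_real (r * \<xi>)))
    = 4 * \<i> * of_real (sqrt pi) * complex_of_real (\<xi> ^ 5 * exp (- a * \<xi>\<^sup>2))"
proof -
  define b where "b = 1 / (4 * a)"
  have b: "b > 0" using a by (simp add: b_def)
  define K where "K = 1 / (a ^ 3 * sqrt a)"
  let ?F = "\<lambda>k r. complex_of_real (r ^ k * exp (- b * r\<^sup>2)) * exp (\<i> * of_real (r * \<xi>))"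
  have "of_real (quint1 a r) * exp (\<i> * of_real (r * \<xi>)) =
      of_real (K * 15 / 4) * ?F 1 r - of_real (K * 5 / (4 * a)) * ?F 3 r + of_real (K / (16 * a\<^sup>2)) * ?F 5 r" for r
  proof -
    have eq: "quint1 a r = (K * 15 / 4) * (r ^ 1 * exp (- b * r\<^sup>2)) - (K * 5 / (4 * a)) * (r ^ 3 * exp (- b * r\<^sup>2))
       + (K / (16 * a\<^sup>2)) * (r ^ 5 * exp (- b * r\<^sup>2))"
      using a by (simp add: quint1_def K_def b_def field_simps eval_nat_numeral)
    show ?thesis unfolding eq by (simp add: algebra_simps)
  qed
  then have "(LINT r|lborel. of_real (quint1 a r) * exp (\<i> * of_real (r * \<xi>))) =
     of_real (K * 15 / 4) * gmom 1 b \<xi> - of_real (K * 5 / (4 * a)) * gmom 3 b \<xi> + of_real (K / (16 * a\<^sup>2)) * gmom 5 b \<xi>"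
    by (simp only: Bochner_Integration.integral_add Bochner_Integration.integral_diff integral_mult_right_zero
        integrable_gmom[OF b] integrable_mult_right Bochner_Integration.integrable_diff gmom_def)
  also have "\<dots> = 4 * \<i> * of_real (sqrt pi) * complex_of_real (\<xi> ^ 5 * exp (- a * \<xi>\<^sup>2))"
  proof -
    define E where "E = exp (- a * \<xi>\<^sup>2)"
    define y where "y = \<i> * complex_of_real (2 * a * \<xi>)"
    have A: "sqrt (pi / b) * exp (- \<xi>\<^sup>2 / (4 * b)) = 2 * sqrt pi * sqrt a * E"
      using a by (simp add: b_def E_def real_sqrt_mult)
    have y: "\<i> * complex_of_real (\<xi> / (2 * b)) = y" by (simp add: b_def y_def)
    have c: "complex_of_real (1 / (2 * b)) = 2 * of_real a" by (simp add: b_def)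
    have a0: "complex_of_real a \<noteq> 0" "complex_of_real (sqrt a) \<noteq> 0" using a by auto
    have K: "complex_of_real K = 1 / (of_real a ^ 3 * of_real (sqrt a))" by (simp add: K_def)
    \<comment> \<open>The polynomial in \<open>quint1\<close> is the Hermite polynomial of degree
      five at the matching scale, so the coefficients of \<open>y\<close> and \<open>y ^ 3\<close>
      cancel and only \<open>y ^ 5\<close> survives.\<close>
    have "of_real (K * 15 / 4) * gmom 1 b \<xi> - of_real (K * 5 / (4 * a)) * gmom 3 b \<xi> + of_real (K / (16 * a\<^sup>2)) * gmom 5 b \<xi>
      = complex_of_real K / (16 * of_real a ^ 2) * y ^ 5 * (2 * of_real (sqrt pi) * of_real (sqrt a) * of_real E)"
      unfolding gmom_values(2-4)[OF b] A y c
      using a0 by (simp add: field_simps eval_nat_numeral)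
    also have "\<dots> = y ^ 5 / (8 * of_real a ^ 5) * of_real (sqrt pi) * of_real E"
      unfolding K using a0 by (simp add: field_simps eval_nat_numeral)
    also have "y ^ 5 / (8 * of_real a ^ 5) = 4 * \<i> * of_real \<xi> ^ 5"
      unfolding y_def using a0 by (simp add: field_simps eval_nat_numeral)
    finally show ?thesis by (simp add: E_def mult_ac)
  qed
  finally show ?thesis .
qed

section \<open>The heat semigroup on \<open>C0\<close>\<close>

lemma gauss1_nonneg: "gauss1 a r \<ge> 0" if "a \<ge> 0"
  using that by (simp add: gauss1_def)

lemma gauss1_measurable [measurable]: "gauss1 a \<in> borel_measurable borel"
  unfolding gauss1_def[abs_def] by measurable

lemma integrable_gauss1_power: "integrable lborel (\<lambda>r. \<bar>r\<bar> ^ m * gauss1 a r)" if "a > 0"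
proof (rule integrable_gauss_le[of "1 / (4 * a)" _ "1 / sqrt (4 * pi * a)" m])
  fix r :: real
  have "\<bar>r\<bar> ^ m \<le> (1 + \<bar>r\<bar>) ^ m" by (intro power_mono) auto
  then have "\<bar>r\<bar> ^ m * gauss1 a r \<le> (1 + \<bar>r\<bar>) ^ m * gauss1 a r"
    using gauss1_nonneg[of a r] that by (intro mult_right_mono) auto
  then show "norm (\<bar>r\<bar> ^ m * gauss1 a r) \<le> 1 / sqrt (4 * pi * a) * ((1 + \<bar>r\<bar>) ^ m * exp (- (1 / (4 * a)) * r\<^sup>2))"
    using gauss1_nonneg[of a r] that by (simp add: gauss1_def abs_mult)
qed (use that in auto)

lemma integrable_gauss1: "integrable lborel (gauss1 a)" if "a > 0"
  using integrable_gauss1_power[OF that, of 0] by simp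

lemma integral_gauss1: "(LINT r|lborel. gauss1 a r) = 1" if "a > 0"
proof -
  have "complex_of_real (LINT r|lborel. gauss1 a r) = 1"
    using gauss1_fourier[OF that, of 0] by (simp flip: integral_complex_of_real)
  then show ?thesis by (simp only: of_real_eq_1_iff)
qed

lemma norm_vec_power2: "(norm (x::real^'n::finite))\<^sup>2 = (\<Sum>i\<in>UNIV. (x $ i)\<^sup>2)"
  by (simp add: norm_vec_def L2_set_def sum_nonneg)

lemma heat_kernel_prod:
  fixes x :: "real^'n::finite"
  assumes "t > 0"
  shows "heat_kernel t x = (\<Prod>i\<in>UNIV. gauss1 t (x $ i))"
proof -
  have "(4 * pi * t) powr (- real CARD('n) / 2) = (1 / sqrt (4 * pi * t)) ^ CARD('n)"
    using assms by (simp add: powr_minus powr_half_sqrt[symmetric] powr_powr inverse_eq_divide power_divide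
        flip: powr_realpow)
  moreover have "exp (- (norm x)\<^sup>2 / (4 * t)) = (\<Prod>i\<in>UNIV. exp (- (x $ i)\<^sup>2 / (4 * t)))"
    by (simp add: norm_vec_power2 exp_sum[symmetric] sum_negf[symmetric] sum_divide_distrib)
  ultimately show ?thesis
    by (simp add: heat_kernel_def gauss1_def prod_dividef power_divide)
qed

lemma heat_kernel_nonneg: "heat_kernel t x \<ge> 0"
  by (simp add: heat_kernel_def)

lemma heat_kernel_measurable [measurable]: "heat_kernel t \<in> borel_measurable borel"
  unfolding heat_kernel_def[abs_def] by measurable

lemma
  assumes "t > 0"
  shows integrable_heat_kernel: "integrable lborel (heat_kernel t :: real^'n::finite \<Rightarrow> real)"
    and integral_heat_kernel: "(LINT x|(lborel :: (real^'n) measure). heat_kernel t x) = 1"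
proof -
  have eq: "heat_kernel t = (\<lambda>x::real^'n. \<Prod>i\<in>UNIV. gauss1 t (x $ i))"
    using heat_kernel_prod[OF assms] by blast
  show "integrable lborel (heat_kernel t :: real^'n::finite \<Rightarrow> real)"
    unfolding eq by (rule integrable_prod_vec) (rule integrable_gauss1[OF assms])
  show "(LINT x|(lborel :: (real^'n) measure). heat_kernel t x) = 1"
    unfolding eq by (subst integral_prod_vec) (simp_all add: integrable_gauss1 integral_gauss1 assms)
qed

text \<open>The norm is at most the sum of the \<open>\<bar>x $ i\<bar>\<close>, and each of them
  times the kernel is again a product of functions of one variable.\<close>

lemma integrable_norm_heat_kernel:
  "integrable lborel (\<lambda>x::real^'n::finite. norm x * heat_kernel 1 x)"
proof (rule Bochner_Integration.integrable_bound)
  show "integrable lborel (\<lambda>x::real^'n. \<Sum>i\<in>UNIV. \<Prod>j\<in>UNIV. (if j = i then \<bar>x $ j\<bar> else 1) * gauss1 1 (x $ j))"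
  proof (rule Bochner_Integration.integrable_sum)
    fix i :: 'n
    have "integrable lborel (\<lambda>r. (if j = i then \<bar>r\<bar> else 1) * gauss1 1 r)" for j
      using integrable_gauss1_power[of 1 1] integrable_gauss1[of 1] by (cases "j = i") simp_all
    from integrable_prod_vec[OF this]
    show "integrable lborel (\<lambda>x::real^'n. \<Prod>j\<in>UNIV. (if j = i then \<bar>x $ j\<bar> else 1) * gauss1 1 (x $ j))" .
  qed
  show "AE x::real^'n in lborel. norm (norm x * heat_kernel 1 x)
      \<le> norm (\<Sum>i\<in>UNIV. \<Prod>j\<in>UNIV. (if j = i then \<bar>x $ j\<bar> else 1) * gauss1 1 (x $ j))"
  proof (rule AE_I2)
    fix x :: "real^'n"
    have "norm x * heat_kernel 1 x \<le> (\<Sum>i\<in>UNIV. \<bar>x $ i\<bar>) * heat_kernel 1 x"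
      by (intro mult_right_mono norm_le_l1_cart heat_kernel_nonneg)
    also have "\<dots> = (\<Sum>i\<in>UNIV. \<Prod>j\<in>UNIV. (if j = i then \<bar>x $ j\<bar> else 1) * gauss1 1 (x $ j))"
      by (simp add: heat_kernel_prod sum_distrib_right prod.distrib prod.delta)
    finally show "norm (norm x * heat_kernel 1 x)
      \<le> norm (\<Sum>i\<in>UNIV. \<Prod>j\<in>UNIV. (if j = i then \<bar>x $ j\<bar> else 1) * gauss1 1 (x $ j))"
      using heat_kernel_nonneg[of 1 x] by simp
  qed
qed measurable

text \<open>After the substitution y = x - sqrt t z, time appears only in the argument of
  \<open>f\<close> and the averaging density is fixed. The formula includes t = 0, which is why the
  estimates below hold uniformly down to the initial time.\<close>

lemma heat_eq_integral_kernel1: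
  fixes f :: "real^'n::finite \<Rightarrow> complex"
  assumes "t \<ge> 0" and [measurable]: "f \<in> borel_measurable borel"
  shows "heat t f x = (LINT z|lborel. of_real (heat_kernel 1 z) * f (x - sqrt t *\<^sub>R z))"
proof (cases "t = 0")
  case True
  then show ?thesis
    by (simp add: heat_def integral_heat_kernel)
next
  case False
  then have t: "t > 0" using assms by simp
  have "heat t f x = (LINT y|lborel. of_real (heat_kernel t (x - y)) * f y)"
    using False by (simp add: heat_def)
  also have "\<dots> = (LINT y|density (distr lborel borel (\<lambda>z. x + (- sqrt t) *\<^sub>R z)) (\<lambda>_. \<bar>- sqrt t\<bar> ^ DIM(real^'n)).
       of_real (heat_kernel t (x - y)) * f y)"
    using t by (subst lborel_affine[of "- sqrt t" x]) simp_all
  also have "\<dots> = (LINT z|lborel. (sqrt t ^ CARD('n)) *\<^sub>R (of_real (heat_kernel t (sqrt t *\<^sub>R z)) * f (x - sqrt t *\<^sub>R z)))"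
    using t by (simp add: integral_density integral_distr)
  also have "\<dots> = (LINT z|lborel. of_real (heat_kernel 1 z) * f (x - sqrt t *\<^sub>R z))"
  proof (rule Bochner_Integration.integral_cong[OF refl])
    fix z :: "real^'n"
    have "sqrt t ^ CARD('n) * heat_kernel t (sqrt t *\<^sub>R z) = heat_kernel 1 z"
    proof -
      have "sqrt t ^ CARD('n) * (4 * pi * t) powr (- real CARD('n) / 2) = (4 * pi) powr (- real CARD('n) / 2)"
        using t by (simp add: powr_mult powr_minus powr_half_sqrt[symmetric] powr_powr field_simps
            flip: powr_realpow)
      then show ?thesis
        using t by (simp add: heat_kernel_def power_mult_distrib)
    qed
    then show "(sqrt t ^ CARD('n)) *\<^sub>R (of_real (heat_kernel t (sqrt t *\<^sub>R z)) * f (x - sqrt t *\<^sub>R z))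
      = of_real (heat_kernel 1 z) * f (x - sqrt t *\<^sub>R z)"
      by (metis (no_types) mult_scaleR_left of_real_mult scaleR_conv_of_real)
  qed
  finally show ?thesis .
qed

lemma bcontfun_measurable [measurable]:
  "apply_bcontfun (h :: (real^'n::finite) \<Rightarrow>\<^sub>C complex) \<in> borel_measurable borel"
  by (intro borel_measurable_continuous_onI continuous_on_apply_bcontfun)

lemma integrable_bounded_times:
  fixes g :: "'a \<Rightarrow> real" and f :: "'a \<Rightarrow> complex"
  assumes "integrable M g" "f \<in> borel_measurable M" "\<And>x. norm (f x) \<le> B"
  shows "integrable M (\<lambda>x. of_real (g x) * f x)"
proof (rule Bochner_Integration.integrable_bound)
  show "integrable M (\<lambda>x. \<bar>g x\<bar> * B)"
    using assms(1) by simp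
  have "B \<ge> 0" if "space M \<noteq> {}" using order_trans[OF norm_ge_zero assms(3)] by blast
  then show "AE x in M. norm (of_real (g x) * f x) \<le> norm (\<bar>g x\<bar> * B)"
    using assms(3) by (auto simp: norm_mult abs_mult intro!: mult_left_mono order_trans[OF assms(3)] AE_I2)
qed (use assms in measurable)

lemma integrable_heat_integrand:
  fixes f :: "real^'n::finite \<Rightarrow> complex"
  assumes [measurable]: "f \<in> borel_measurable borel" and "\<And>x. norm (f x) \<le> B"
  shows "integrable lborel (\<lambda>z. of_real (heat_kernel 1 z) * f (x - c *\<^sub>R z))"
  by (rule integrable_bounded_times[OF integrable_heat_kernel]) (use assms in auto)

text \<open>Both flows average with the same probability density, so a comparison of the integrands
  that is affine in \<open>norm z\<close> integrates to the same affine expression in the first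
  moment. Points, times and functions may all differ: continuity, decay at infinity and the
  expansion of the initial value are all obtained from this one estimate.\<close>

lemma norm_heat_diff_le:
  fixes f g :: "real^'n::finite \<Rightarrow> complex"
  assumes [measurable]: "f \<in> borel_measurable borel" "g \<in> borel_measurable borel"
    and bd: "\<And>x. norm (f x) \<le> B" "\<And>x. norm (g x) \<le> B"
    and t: "t \<ge> 0" "s \<ge> 0" and K: "K \<ge> 0"
    and le: "\<And>z. norm (f (x - sqrt t *\<^sub>R z) - g (y - sqrt s *\<^sub>R z)) \<le> \<eta> + K * norm z"
  shows "norm (heat t f x - heat s g y) \<le> \<eta> + K * (LINT z|(lborel::(real^'n) measure). norm z * heat_kernel 1 z)"
proof -
  note i1 = integrable_heat_integrand[OF assms(1) bd(1), where x=x and c="sqrt t"]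
  note i2 = integrable_heat_integrand[OF assms(2) bd(2), where x=y and c="sqrt s"]
  have "heat t f x - heat s g y = (LINT z|lborel. of_real (heat_kernel 1 z) * f (x - sqrt t *\<^sub>R z)
      - of_real (heat_kernel 1 z) * g (y - sqrt s *\<^sub>R z))"
    by (subst Bochner_Integration.integral_diff[OF i1 i2]) (simp add: heat_eq_integral_kernel1 t)
  also have "norm \<dots> \<le> (LINT z|(lborel::(real^'n) measure). \<eta> * heat_kernel 1 z + K * (norm z * heat_kernel 1 z))"
  proof (rule Bochner_Integration.integral_norm_bound_integral)
    show "integrable lborel (\<lambda>z. complex_of_real (heat_kernel 1 z) * f (x - sqrt t *\<^sub>R z)
      - of_real (heat_kernel 1 z) * g (y - sqrt s *\<^sub>R z))"
      by (rule Bochner_Integration.integrable_diff[OF i1 i2])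
    show "integrable lborel (\<lambda>z::real^'n. \<eta> * heat_kernel 1 z + K * (norm z * heat_kernel 1 z))"
      by (intro Bochner_Integration.integrable_add integrable_mult_right integrable_heat_kernel
          integrable_norm_heat_kernel) simp
    fix z :: "real^'n"
    have "norm (complex_of_real (heat_kernel 1 z) * f (x - sqrt t *\<^sub>R z)
      - of_real (heat_kernel 1 z) * g (y - sqrt s *\<^sub>R z))
      = heat_kernel 1 z * norm (f (x - sqrt t *\<^sub>R z) - g (y - sqrt s *\<^sub>R z))"
      by (simp add: norm_mult heat_kernel_nonneg flip: right_diff_distrib)
    also have "\<dots> \<le> heat_kernel 1 z * (\<eta> + K * norm z)"
      by (intro mult_left_mono le heat_kernel_nonneg)
    finally show "norm (complex_of_real (heat_kernel 1 z) * f (x - sqrt t *\<^sub>R z)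
      - of_real (heat_kernel 1 z) * g (y - sqrt s *\<^sub>R z)) \<le> \<eta> * heat_kernel 1 z + K * (norm z * heat_kernel 1 z)"
      by (simp add: algebra_simps)
  qed
  also have "\<dots> = \<eta> + K * (LINT z|(lborel::(real^'n) measure). norm z * heat_kernel 1 z)"
    by (subst Bochner_Integration.integral_add)
       (simp_all add: integrable_heat_kernel integrable_norm_heat_kernel integral_heat_kernel)
  finally show ?thesis .
qed

lemma heat_zero_fun: "heat t (\<lambda>x. 0) = (\<lambda>x. 0)"
  by (auto simp: heat_def)

lemma norm_heat_le:
  fixes f :: "real^'n::finite \<Rightarrow> complex"
  assumes "f \<in> borel_measurable borel" "\<And>x. norm (f x) \<le> B" "t \<ge> 0"
  shows "norm (heat t f x) \<le> B"
proof -
  have "B \<ge> 0" using order_trans[OF norm_ge_zero assms(2)] .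
  then show ?thesis
    using norm_heat_diff_le[of f "\<lambda>x. 0" B t t 0 x x B] assms by (simp add: heat_zero_fun)
qed

lemma heat_diff:
  fixes f g :: "real^'n::finite \<Rightarrow> complex"
  assumes "f \<in> borel_measurable borel" "g \<in> borel_measurable borel"
    "\<And>x. norm (f x) \<le> B" "\<And>x. norm (g x) \<le> B'" "t \<ge> 0"
  shows "heat t (\<lambda>x. f x - g x) x = heat t f x - heat t g x"
proof -
  have [measurable]: "f \<in> borel_measurable borel" "g \<in> borel_measurable borel" by fact+
  show ?thesis
    by (simp add: heat_eq_integral_kernel1 assms right_diff_distrib integrable_heat_integrand[OF assms(1,3)]
       integrable_heat_integrand[OF assms(2,4)])
qed

section \<open>Functions vanishing at infinity and strong continuity of the semigroup\<close>

lemma C0_iff: "h \<in> C0 \<longleftrightarrow> (\<forall>e>0. \<exists>R. \<forall>x. R \<le> norm x \<longrightarrow> norm (apply_bcontfun h x) < e)"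
  by (simp add: C0_def tendsto_iff eventually_at_infinity)

lemma subspace_C0: "subspace (C0 :: ((real^'n::finite) \<Rightarrow>\<^sub>C complex) set)"
  unfolding subspace_def
proof (intro conjI ballI allI)
  show "0 \<in> C0" by (simp add: C0_def)
  fix f g :: "(real^'n) \<Rightarrow>\<^sub>C complex" and c :: real
  assume f: "f \<in> C0"
  show "c *\<^sub>R f \<in> C0"
    using tendsto_scaleR[OF tendsto_const[of c], of "apply_bcontfun f" 0 at_infinity] f by (simp add: C0_def)
  assume g: "g \<in> C0"
  show "f + g \<in> C0"
    using tendsto_add[of "apply_bcontfun f" 0 at_infinity "apply_bcontfun g" 0] f g by (simp add: C0_def)
qed

lemma closed_C0: "closed (C0 :: ((real^'n::finite) \<Rightarrow>\<^sub>C complex) set)"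
  unfolding closed_sequential_limits
proof (intro allI impI, elim conjE)
  fix f :: "nat \<Rightarrow> (real^'n) \<Rightarrow>\<^sub>C complex" and l
  assume f: "\<forall>n. f n \<in> C0" and l: "f \<longlonglongrightarrow> l"
  show "l \<in> C0"
    unfolding C0_iff
  proof (intro allI impI)
    fix e :: real assume "e > 0"
    then obtain n where n: "dist (f n) l < e / 2"
      using l[unfolded tendsto_iff, rule_format, of "e/2"] by (auto simp: eventually_sequentially)
    obtain R where R: "R \<le> norm x \<Longrightarrow> norm (f n x) < e / 2" for x
      using f[rule_format, of n] \<open>e > 0\<close> unfolding C0_iff by (meson half_gt_zero)
    have "norm (l x) < e" if "R \<le> norm x" for x
    proof -
      have "norm (l x - f n x) < e / 2"
        using dist_bounded[of l x "f n"] n by (simp add: dist_norm norm_minus_commute)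
      with R[OF that] norm_triangle_sub[of "l x" "f n x"] show ?thesis by linarith
    qed
    then show "\<exists>R. \<forall>x. R \<le> norm x \<longrightarrow> norm (l x) < e" by blast
  qed
qed

lemma C0_uniformly_continuous:
  fixes h :: "(real^'n::finite) \<Rightarrow>\<^sub>C complex"
  assumes "h \<in> C0" "e > 0"
  obtains d where "d > 0" "\<And>x y. norm (x - y) < d \<Longrightarrow> norm (h x - h y) < e"
proof -
  obtain R where R: "R \<le> norm x \<Longrightarrow> norm (h x) < e / 2" for x
    using assms unfolding C0_iff by (meson half_gt_zero)
  have "uniformly_continuous_on (cball 0 (R + 1)) (apply_bcontfun h)"
    by (intro compact_uniformly_continuous continuous_on_apply_bcontfun compact_cball)
  then obtain d where d: "d > 0"
    "\<And>x y. x \<in> cball 0 (R + 1) \<Longrightarrow> y \<in> cball 0 (R + 1) \<Longrightarrow> dist y x < d \<Longrightarrow> dist (h y) (h x) < e"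
    using \<open>e > 0\<close> unfolding uniformly_continuous_on_def by blast
  show ?thesis
  proof
    show "min d 1 > 0" using d by simp
    fix x y :: "real^'n" assume xy: "norm (x - y) < min d 1"
    show "norm (h x - h y) < e"
    proof (cases "norm x \<le> R + 1 \<and> norm y \<le> R + 1")
      case True
      with d(2)[of y x] xy show ?thesis by (simp add: dist_norm)
    next
      case False
      then have "R \<le> norm x" "R \<le> norm y"
        using xy norm_triangle_ineq2[of x y] norm_triangle_ineq2[of y x] by (auto simp: norm_minus_commute)
      with R[of x] R[of y] norm_triangle_ineq4[of "h x" "h y"] show ?thesis by linarith
    qed
  qed
qed

text \<open>Uniform continuity is traded for a bound affine in the distance: beyond distance
  \<open>d\<close> the trivial bound \<open>2 * norm h\<close> is below
  \<open>2 * norm h / d\<close> times the distance. This is the form that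
  \<open>norm_heat_diff_le\<close> can integrate.\<close>

lemma C0_modulus:
  fixes h :: "(real^'n::finite) \<Rightarrow>\<^sub>C complex"
  assumes "h \<in> C0" "e > 0"
  obtains K where "K \<ge> 0" "\<And>x y. norm (h x - h y) \<le> e + K * norm (x - y)"
proof -
  obtain d where d: "d > 0" "\<And>x y. norm (x - y) < d \<Longrightarrow> norm (h x - h y) < e"
    using C0_uniformly_continuous[OF assms] by blast
  show ?thesis
  proof
    show "2 * norm h / d \<ge> 0" using d by simp
    fix x y
    show "norm (h x - h y) \<le> e + 2 * norm h / d * norm (x - y)"
    proof (cases "norm (x - y) < d")
      case True
      have "0 \<le> 2 * norm h / d * norm (x - y)" using d by simp
      with d(2)[OF True] show ?thesis by linarith
    next
      case False
      have "norm (h x - h y) \<le> 2 * norm h * 1"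
        using norm_triangle_ineq4[of "h x" "h y"] norm_bounded[of h x] norm_bounded[of h y] by linarith
      also have "\<dots> \<le> 2 * norm h * (norm (x - y) / d)"
        using False d by (intro mult_left_mono) auto
      finally show ?thesis using \<open>e > 0\<close> by simp
    qed
  qed
qed

abbreviation heat_moment :: "'n::finite itself \<Rightarrow> real" where
  "heat_moment _ \<equiv> LINT z|(lborel::(real^'n) measure). norm z * heat_kernel 1 z"

lemma heat_moment_nonneg: "heat_moment TYPE('n::finite) \<ge> 0"
  by (intro integral_nonneg_AE) (simp add: heat_kernel_nonneg)

text \<open>Moving from (s, y) to (t, x) displaces the argument by x - y and by (sqrt t - sqrt s) z,
  so one modulus controls space and time together, with sqrt t as the natural time variable.\<close>

lemma heat_modulus:
  fixes h :: "(real^'n::finite) \<Rightarrow>\<^sub>C complex"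
  assumes "h \<in> C0" "e > 0"
  obtains K where "K \<ge> 0"
    "\<And>t s x y. t \<ge> 0 \<Longrightarrow> s \<ge> 0 \<Longrightarrow> norm (heat t h x - heat s h y) \<le> e + K * (norm (x - y) + \<bar>sqrt t - sqrt s\<bar>)"
proof -
  obtain K where K: "K \<ge> 0" "\<And>x y. norm (h x - h y) \<le> e + K * norm (x - y)"
    using C0_modulus[OF assms] by blast
  define M where "M = heat_moment TYPE('n)"
  have M: "M \<ge> 0" unfolding M_def by (rule heat_moment_nonneg)
  show ?thesis
  proof
    show "K * (1 + M) \<ge> 0" using K M by simp
    fix t s :: real and x y :: "real^'n" assume ts: "t \<ge> 0" "s \<ge> 0"
    have "norm (heat t h x - heat s h y) \<le> (e + K * norm (x - y)) + (K * \<bar>sqrt t - sqrt s\<bar>) * M"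
      unfolding M_def
    proof (rule norm_heat_diff_le[where B="norm h"])
      fix z
      have "norm (h (x - sqrt t *\<^sub>R z) - h (y - sqrt s *\<^sub>R z)) \<le> e + K * norm ((x - sqrt t *\<^sub>R z) - (y - sqrt s *\<^sub>R z))"
        by (rule K)
      moreover have "norm ((x - sqrt t *\<^sub>R z) - (y - sqrt s *\<^sub>R z)) \<le> norm (x - y) + \<bar>sqrt t - sqrt s\<bar> * norm z"
      proof -
        have eq: "(x - sqrt t *\<^sub>R z) - (y - sqrt s *\<^sub>R z) = (x - y) - (sqrt t - sqrt s) *\<^sub>R z"
          by (simp add: algebra_simps)
        show ?thesis unfolding eq using norm_triangle_ineq4[of "x - y" "(sqrt t - sqrt s) *\<^sub>R z"] by simp
      qed
      then have "K * norm ((x - sqrt t *\<^sub>R z) - (y - sqrt s *\<^sub>R z)) \<le> K * (norm (x - y) + \<bar>sqrt t - sqrt s\<bar> * norm z)"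
        using K(1) by (rule mult_left_mono)
      ultimately show "norm (h (x - sqrt t *\<^sub>R z) - h (y - sqrt s *\<^sub>R z)) \<le> e + K * norm (x - y) + K * \<bar>sqrt t - sqrt s\<bar> * norm z"
        by (simp add: algebra_simps)
    qed (use ts K norm_bounded in auto)
    also have "\<dots> \<le> e + K * (1 + M) * (norm (x - y) + \<bar>sqrt t - sqrt s\<bar>)"
    proof -
      have "0 \<le> K * \<bar>sqrt t - sqrt s\<bar>" "0 \<le> K * M * norm (x - y)" using K M by auto
      then show ?thesis by (simp add: algebra_simps)
    qed
    finally show "norm (heat t h x - heat s h y) \<le> e + K * (1 + M) * (norm (x - y) + \<bar>sqrt t - sqrt s\<bar>)" .
  qed
qed

text \<open>The semigroup as an operator on the Banach space. It is meaningful for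
  \<open>h \<in> C0\<close> and \<open>t \<ge> 0\<close>, where \<open>apply_heatop\<close> shows
  that \<open>Bcontfun\<close> is applied to a bounded continuous function.\<close>

definition heatop :: "real \<Rightarrow> ((real^'n::finite) \<Rightarrow>\<^sub>C complex) \<Rightarrow> (real^'n) \<Rightarrow>\<^sub>C complex" where
  "heatop t h = Bcontfun (heat t (apply_bcontfun h))"

lemma apply_heatop:
  fixes h :: "(real^'n::finite) \<Rightarrow>\<^sub>C complex"
  assumes h: "h \<in> C0" and t: "t \<ge> 0"
  shows "apply_bcontfun (heatop t h) = heat t h"
proof -
  have "continuous_on UNIV (heat t h)"
    unfolding continuous_on_iff
  proof (intro ballI allI impI)
    fix x :: "real^'n" and e :: real assume "e > 0"
    then obtain K where K: "K \<ge> 0"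
      "\<And>t s x y. t \<ge> 0 \<Longrightarrow> s \<ge> 0 \<Longrightarrow> norm (heat t h x - heat s h y) \<le> e / 2 + K * (norm (x - y) + \<bar>sqrt t - sqrt s\<bar>)"
      using heat_modulus[OF h, of "e/2"] by (metis half_gt_zero)
    show "\<exists>d>0. \<forall>x'\<in>UNIV. dist x' x < d \<longrightarrow> dist (heat t h x') (heat t h x) < e"
    proof (intro exI conjI ballI impI)
      show "e / (2 * (K + 1)) > 0" using \<open>e > 0\<close> K by simp
      fix x' assume "dist x' x < e / (2 * (K + 1))"
      then have "(K + 1) * norm (x' - x) < e / 2" using K by (simp add: dist_norm field_simps)
      moreover have "K * norm (x' - x) \<le> (K + 1) * norm (x' - x)" by (intro mult_right_mono) auto
      ultimately show "dist (heat t h x') (heat t h x) < e"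
        using K(2)[OF t t, of x' x] by (simp add: dist_norm)
    qed
  qed
  moreover have "norm (heat t h x) \<le> norm h" for x
    by (rule norm_heat_le) (use t norm_bounded in auto)
  ultimately show ?thesis
    unfolding heatop_def by (intro Bcontfun_inverse bcontfun_normI)
qed

text \<open>Far from the origin, \<open>h\<close> is small at the displaced point unless the
  displacement is long, and long displacements are controlled by the first moment as in Markov's
  inequality.\<close>

lemma heatop_C0:
  fixes h :: "(real^'n::finite) \<Rightarrow>\<^sub>C complex"
  assumes h: "h \<in> C0" and t: "t \<ge> 0"
  shows "heatop t h \<in> C0"
  unfolding C0_iff apply_heatop[OF assms]
proof (intro allI impI)
  fix e :: real assume e: "e > 0"
  define M where "M = heat_moment TYPE('n)"
  have M: "M \<ge> 0" unfolding M_def by (rule heat_moment_nonneg)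
  obtain R where R: "R \<le> norm x \<Longrightarrow> norm (h x) < e / 3" for x
    using h e unfolding C0_iff by (meson divide_pos_pos zero_less_numeral)
  define C where "C = norm h * sqrt t * M"
  have C: "C \<ge> 0" using t M by (simp add: C_def)
  show "\<exists>R. \<forall>x. R \<le> norm x \<longrightarrow> norm (heat t h x) < e"
  proof (intro exI allI impI)
    \<comment> \<open>The summand 1 keeps \<open>r\<close> positive also when
      \<open>C = 0\<close>.\<close>
    fix x :: "real^'n" assume x: "R + 1 + 3 * C / e \<le> norm x"
    define r where "r = norm x - R"
    have r: "r > 0" "r \<ge> 3 * C / e"
      using x C e divide_nonneg_pos[of "3 * C" e] unfolding r_def by linarith+
    have "norm (heat t h x - heat t (\<lambda>x. 0) x) \<le> e / 3 + (norm h * sqrt t / r) * M"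
      unfolding M_def
    proof (rule norm_heat_diff_le[where B="norm h"])
      fix z
      show "norm (h (x - sqrt t *\<^sub>R z) - 0) \<le> e / 3 + norm h * sqrt t / r * norm z"
      proof (cases "R \<le> norm (x - sqrt t *\<^sub>R z)")
        case True
        have "0 \<le> norm h * sqrt t / r * norm z" using t r by simp
        with R[OF True] show ?thesis by simp
      next
        case False
        then have "r \<le> sqrt t * norm z"
          using norm_triangle_ineq2[of x "sqrt t *\<^sub>R z"] t by (simp add: r_def)
        then have "norm h * 1 \<le> norm h * (sqrt t * norm z / r)"
          using r by (intro mult_left_mono) auto
        moreover have "norm (h (x - sqrt t *\<^sub>R z)) \<le> norm h" by (rule norm_bounded)
        ultimately show ?thesis using e by simp
      qed
    qed (use t r norm_bounded in auto)
    also have "(norm h * sqrt t / r) * M = C / r" by (simp add: C_def)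
    also have "C / r \<le> e / 3" using r e by (simp add: field_simps)
    finally show "norm (heat t h x) < e" using e by (simp add: heat_zero_fun)
  qed
qed

lemma heatop_0: "h \<in> C0 \<Longrightarrow> heatop 0 h = h"
  by (intro bcontfun_eqI) (simp add: apply_heatop heat_def)

lemma norm_heatop_diff_le:
  fixes h k :: "(real^'n::finite) \<Rightarrow>\<^sub>C complex"
  assumes "h \<in> C0" "k \<in> C0" "t \<ge> 0"
  shows "norm (heatop t h - heatop t k) \<le> norm (h - k)"
proof (rule norm_bound)
  fix x
  have "apply_bcontfun (heatop t h - heatop t k) x = heat t (\<lambda>x. h x - k x) x"
    using assms by (subst heat_diff[where B="norm h" and B'="norm k"]) (auto simp: apply_heatop norm_bounded)
  also have "norm \<dots> \<le> norm (h - k)"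
    by (rule norm_heat_le) (use assms norm_bounded[of "h - k"] in auto)
  finally show "norm (apply_bcontfun (heatop t h - heatop t k) x) \<le> norm (h - k)" .
qed

lemma norm_heatop_le: "h \<in> C0 \<Longrightarrow> t \<ge> 0 \<Longrightarrow> norm (heatop t h) \<le> norm h"
  for h :: "(real^'n::finite) \<Rightarrow>\<^sub>C complex"
  by (rule norm_bound) (auto simp: apply_heatop intro!: norm_heat_le norm_bounded)

text \<open>The semigroup contracts in \<open>h\<close>, so continuity in time is needed only at the
  fixed function \<open>k\<close>, with a modulus that may depend on \<open>k\<close>.\<close>

lemma continuous_on_heatop:
  "continuous_on ({0..} \<times> (C0 :: ((real^'n::finite) \<Rightarrow>\<^sub>C complex) set)) (\<lambda>(t, h). heatop t h)"
  unfolding continuous_on_iff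
proof (intro ballI allI impI)
  fix p :: "real \<times> ((real^'n) \<Rightarrow>\<^sub>C complex)" and e :: real
  assume "p \<in> {0..} \<times> C0" and e: "e > 0"
  then obtain s k where p: "p = (s, k)" "s \<ge> 0" "k \<in> C0" by auto
  obtain K where K: "K \<ge> 0"
    "\<And>t s x y. t \<ge> 0 \<Longrightarrow> s \<ge> 0 \<Longrightarrow> norm (heat t k x - heat s k y) \<le> e / 4 + K * (norm (x - y) + \<bar>sqrt t - sqrt s\<bar>)"
    using heat_modulus[OF p(3), of "e/4"] e by (metis zero_less_divide_iff zero_less_numeral)
  have "continuous (at s) sqrt" by (rule isCont_real_sqrt)
  then obtain d where d: "d > 0" "\<And>t. dist t s < d \<Longrightarrow> dist (sqrt t) (sqrt s) < e / (4 * (K + 1))"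
    using e K(1) unfolding continuous_at_eps_delta by (metis add_nonneg_pos divide_pos_pos mult_pos_pos zero_less_numeral zero_less_one)
  show "\<exists>d>0. \<forall>x'\<in>{0..} \<times> C0. dist x' p < d \<longrightarrow> dist (case x' of (t, h) \<Rightarrow> heatop t h) (case p of (t, h) \<Rightarrow> heatop t h) < e"
  proof (intro exI conjI ballI impI)
    show "min d (e / 4) > 0" using d e by simp
    fix q :: "real \<times> ((real^'n) \<Rightarrow>\<^sub>C complex)" assume "q \<in> {0..} \<times> C0" and dist: "dist q p < min d (e / 4)"
    then obtain t h where q: "q = (t, h)" "t \<ge> 0" "h \<in> C0" by auto
    have dt: "dist t s < d" and dh: "dist h k < e / 4"
      using dist dist_fst_le[of q p] dist_snd_le[of q p] by (auto simp: p q)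
    have "norm (heatop t h - heatop t k) < e / 4"
      using norm_heatop_diff_le[OF q(3) p(3) q(2)] dh by (simp add: dist_norm)
    moreover have "norm (heatop t k - heatop s k) \<le> e / 4 + e / 4"
    proof (rule norm_bound)
      fix x
      have "norm (heat t k x - heat s k x) \<le> e / 4 + K * \<bar>sqrt t - sqrt s\<bar>"
        using K(2)[OF q(2) p(2), of x x] by simp
      also have "K * \<bar>sqrt t - sqrt s\<bar> \<le> K * (e / (4 * (K + 1)))"
        using d(2)[OF dt] K(1) by (intro mult_left_mono) (auto simp: dist_real_def)
      also have "\<dots> \<le> e / 4" using K(1) e by (simp add: field_simps)
      finally show "norm (apply_bcontfun (heatop t k - heatop s k) x) \<le> e / 4 + e / 4"
        using p q by (simp add: apply_heatop)
    qed
    ultimately have "norm ((heatop t h - heatop t k) + (heatop t k - heatop s k)) < e"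
      using e norm_triangle_ineq[of "heatop t h - heatop t k" "heatop t k - heatop s k"] by linarith
    then show "dist (case q of (t, h) \<Rightarrow> heatop t h) (case p of (t, h) \<Rightarrow> heatop t h) < e"
      by (simp add: p q dist_norm)
  qed
qed

section \<open>Reflections and odd functions\<close>

definition reflect :: "'n \<Rightarrow> real^'n::finite \<Rightarrow> real^'n" where
  "reflect k x = (\<chi> i. if i = k then - (x $ i) else x $ i)"

lemma reflect_nth [simp]: "reflect k x $ i = (if i = k then - (x $ i) else x $ i)"
  by (simp add: reflect_def)

lemma reflect_diff: "reflect k (x - c *\<^sub>R y) = reflect k x - c *\<^sub>R reflect k y"
  by (simp add: vec_eq_iff)

lemma norm_reflect [simp]: "norm (reflect k x) = norm x"
  by (rule power2_eq_imp_eq) (auto simp: norm_vec_power2 intro!: sum.cong)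

lemma heat_kernel_reflect [simp]: "heat_kernel t (reflect k x) = heat_kernel t x"
  by (simp add: heat_kernel_def)

text \<open>A reflection is a diagonal affine map with entries 1 and -1, hence has Jacobian
  1.\<close>

lemma integral_reflect:
  fixes f :: "real^'n::finite \<Rightarrow> 'b::{banach,second_countable_topology}"
  assumes [measurable]: "f \<in> borel_measurable borel"
  shows "(LINT x|lborel. f (reflect k x)) = (LINT x|lborel. f x)"
proof -
  define c :: "real^'n \<Rightarrow> real" where "c = (\<lambda>b. if b = axis k 1 then - 1 else 1)"
  have T: "reflect k = (\<lambda>x. 0 + (\<Sum>b\<in>Basis. (c b * (x \<bullet> b)) *\<^sub>R b))"
  proof
    fix x :: "real^'n"
    show "reflect k x = 0 + (\<Sum>b\<in>Basis. (c b * (x \<bullet> b)) *\<^sub>R b)"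
    proof (rule euclidean_eqI)
      fix b :: "real^'n" assume b: "b \<in> Basis"
      then obtain i where i: "b = axis i 1" by (auto simp: Basis_vec_def)
      have "(0 + (\<Sum>b\<in>Basis. (c b * (x \<bullet> b)) *\<^sub>R b)) \<bullet> b = c b * (x \<bullet> b)"
        using b by simp
      also have "\<dots> = reflect k x \<bullet> b"
        by (simp add: i c_def inner_axis axis_eq_axis)
      finally show "reflect k x \<bullet> b = (0 + (\<Sum>b\<in>Basis. (c b * (x \<bullet> b)) *\<^sub>R b)) \<bullet> b" by simp
    qed
  qed
  have [measurable]: "reflect k \<in> borel_measurable borel"
    unfolding T by measurable
  have "(lborel :: (real^'n) measure) = density (distr lborel borel (reflect k)) (\<lambda>_. (\<Prod>b\<in>Basis. \<bar>c b\<bar>))"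
    unfolding T by (rule lborel_affine_euclidean) (simp add: c_def)
  also have "(\<Prod>b\<in>Basis. \<bar>c b\<bar>) = 1" by (intro prod.neutral) (simp add: c_def)
  finally have "(lborel :: (real^'n) measure) = density (distr lborel borel (reflect k)) (\<lambda>_. ennreal 1)" .
  then have eq: "distr lborel borel (reflect k) = lborel"
    by (simp add: density_1)
  have "(LINT x|lborel. f x) = (LINT x|distr lborel borel (reflect k). f x)" by (simp add: eq)
  also have "\<dots> = (LINT x|lborel. f (reflect k x))" by (subst integral_distr) auto
  finally show ?thesis by simp
qed

lemma heat_odd:
  fixes f :: "real^'n::finite \<Rightarrow> complex"
  assumes [measurable]: "f \<in> borel_measurable borel" and odd: "\<And>x. f (reflect k x) = - f x" and t: "t \<ge> 0"
  shows "heat t f (reflect k x) = - heat t f x"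
proof -
  let ?F = "\<lambda>z. of_real (heat_kernel 1 z) * f (reflect k x - sqrt t *\<^sub>R z)"
  have "heat t f (reflect k x) = (LINT z|lborel. ?F z)"
    by (rule heat_eq_integral_kernel1) (use t in auto)
  also have "\<dots> = (LINT z|lborel. ?F (reflect k z))"
    by (rule integral_reflect[symmetric]) measurable
  also have "\<dots> = (LINT z|lborel. - (of_real (heat_kernel 1 z) * f (x - sqrt t *\<^sub>R z)))"
    by (simp flip: reflect_diff add: odd)
  also have "\<dots> = - heat t f x"
    by (subst Bochner_Integration.integral_minus) (simp add: heat_eq_integral_kernel1 t)
  finally show ?thesis .
qed

text \<open>A closed subspace invariant under the semigroup and the nonlinearity. The fixed point
  argument takes place in it, so oddness of the solution is part of existence.\<close>

definition C0_odd :: "'n \<Rightarrow> ((real^'n::finite) \<Rightarrow>\<^sub>C complex) set" where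
  "C0_odd k = {h \<in> C0. \<forall>x. h (reflect k x) = - h x}"

lemma C0_odd_subset: "C0_odd k \<subseteq> C0"
  by (auto simp: C0_odd_def)

lemma heatop_C0_odd: "h \<in> C0_odd k \<Longrightarrow> t \<ge> 0 \<Longrightarrow> heatop t h \<in> C0_odd k"
  by (auto simp: C0_odd_def heatop_C0 apply_heatop intro!: heat_odd)

lemma bounded_linear_apply_bcontfun:
  "bounded_linear (\<lambda>h :: 'a::topological_space \<Rightarrow>\<^sub>C 'b::real_normed_vector. apply_bcontfun h x)"
  by (rule bounded_linear_intro[of _ 1]) (auto simp: norm_bounded)

lemma subspace_C0_odd: "subspace (C0_odd k)"
  using subspace_C0 by (auto simp: subspace_def C0_odd_def)

lemma closed_C0_odd: "closed (C0_odd (k :: 'n::finite))"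
proof -
  have "C0_odd k = C0 \<inter> (\<Inter>x. {h :: (real^'n) \<Rightarrow>\<^sub>C complex. h (reflect k x) = - h x})" by (auto simp: C0_odd_def)
  moreover have "closed {h :: (real^'n) \<Rightarrow>\<^sub>C complex. h (reflect k x) = - h x}" for x
    by (intro closed_Collect_eq continuous_intros bounded_linear.continuous_on[OF bounded_linear_apply_bcontfun])
  ultimately show ?thesis by (auto intro!: closed_Int closed_C0)
qed

text \<open>Riemann sums are linear combinations of values in \<open>S\<close> and come arbitrarily
  close to the integral.\<close>

lemma integral_in_closed_subspace:
  fixes f :: "real \<Rightarrow> 'a::banach"
  assumes S: "subspace S" "closed S" and f: "f integrable_on {a..b}" "\<And>x. x \<in> {a..b} \<Longrightarrow> f x \<in> S"
  shows "integral {a..b} f \<in> S"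
proof -
  have "integral {a..b} f \<in> closure S"
    unfolding closure_approachable
  proof (intro allI impI)
    fix e :: real assume "e > 0"
    moreover have "(f has_integral integral (cbox a b) f) (cbox a b)"
      using f(1) by (simp add: integrable_integral)
    ultimately obtain \<gamma> where \<gamma>: "gauge \<gamma>" "\<And>\<D>. \<D> tagged_division_of cbox a b \<Longrightarrow> \<gamma> fine \<D> \<Longrightarrow>
        norm ((\<Sum>(x, K)\<in>\<D>. measure lborel K *\<^sub>R f x) - integral (cbox a b) f) < e"
      unfolding has_integral by metis
    obtain \<D> where \<D>: "\<D> tagged_division_of cbox a b" "\<gamma> fine \<D>"
      using fine_division_exists[OF \<gamma>(1)] by blast
    have "(\<Sum>(x, K)\<in>\<D>. measure lborel K *\<^sub>R f x) \<in> S"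
    proof (intro subspace_sum[OF S(1)], clarify)
      fix x K assume "(x, K) \<in> \<D>"
      then have "x \<in> {a..b}" using tagged_division_ofD(2,3)[OF \<D>(1)] by (metis box_real(2) subsetD)
      then show "measure lborel K *\<^sub>R f x \<in> S" by (intro subspace_scale[OF S(1)] f(2))
    qed
    with \<gamma>(2)[OF \<D>] show "\<exists>y\<in>S. dist y (integral {a..b} f) < e"
      by (auto simp: dist_norm intro!: bexI[of _ "\<Sum>(x, K)\<in>\<D>. measure lborel K *\<^sub>R f x"])
  qed
  then show ?thesis using S(2) by simp
qed

section \<open>Local well-posedness\<close>

instance bcontfun :: (metric_space, banach) banach ..

section \<open>The power nonlinearity\<close>

definition pnl :: "real \<Rightarrow> complex \<Rightarrow> complex" where
  "pnl \<alpha> z = of_real (norm z powr \<alpha>) * z"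

lemma norm_pnl: "norm (pnl \<alpha> z) = norm z powr (\<alpha> + 1)"
proof (cases "z = 0")
  case False
  then have "norm z powr (\<alpha> + 1) = norm z powr \<alpha> * norm z" by (simp add: powr_add)
  then show ?thesis by (simp add: pnl_def norm_mult)
qed (simp add: pnl_def)

lemma pnl_uminus [simp]: "pnl \<alpha> (- z) = - pnl \<alpha> z"
  by (simp add: pnl_def)

lemma powr_diff_le:
  fixes A B \<alpha> :: real
  assumes "0 \<le> B" "B \<le> A" "\<alpha> > 0"
  shows "A powr (\<alpha> + 1) - B powr (\<alpha> + 1) \<le> (\<alpha> + 1) * A powr \<alpha> * (A - B)"
proof (cases "B = 0 \<or> A = B")
  case True
  have "A powr (\<alpha> + 1) = A powr \<alpha> * A" using assms by (cases "A = 0") (auto simp: powr_add)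
  with True assms show ?thesis by (auto simp: algebra_simps)
next
  case False
  with assms have AB: "0 < B" "B < A" by auto
  have "((\<lambda>x. x powr (\<alpha> + 1)) has_real_derivative (\<alpha> + 1) * x powr (\<alpha> + 1 - 1)) (at x)" if "B \<le> x" "x \<le> A" for x
    using that AB by (intro has_real_derivative_powr) auto
  from MVT2[OF AB(2) this] obtain z where z: "B < z" "z < A"
    "A powr (\<alpha> + 1) - B powr (\<alpha> + 1) = (A - B) * ((\<alpha> + 1) * z powr (\<alpha> + 1 - 1))" by blast
  have "z powr \<alpha> \<le> A powr \<alpha>" using z AB assms by (intro powr_mono2) auto
  then have "(A - B) * ((\<alpha> + 1) * z powr \<alpha>) \<le> (A - B) * ((\<alpha> + 1) * A powr \<alpha>)"
    using AB assms by (intro mult_left_mono) auto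
  then show ?thesis using z(3) by (simp add: mult_ac)
qed

text \<open>The difference is split so that the larger modulus multiplies \<open>z - w\<close> and
  the difference of the powers multiplies the smaller argument. The second part is at most the
  difference of the powers of order \<alpha> + 1, to which the mean value theorem applies even when
  \<alpha> < 1 and the power of order \<alpha> is not Lipschitz.\<close>

lemma pnl_lipschitz:
  assumes "\<alpha> > 0" "norm z \<le> R" "norm w \<le> R"
  shows "norm (pnl \<alpha> z - pnl \<alpha> w) \<le> (\<alpha> + 2) * R powr \<alpha> * norm (z - w)"
proof -
  have *: "norm (pnl \<alpha> z - pnl \<alpha> w) \<le> (\<alpha> + 2) * R powr \<alpha> * norm (z - w)"
    if zw: "norm w \<le> norm z" "norm z \<le> R" for z w
  proof -
    let ?A = "norm z" and ?B = "norm w"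
    have AB: "?A - ?B \<le> norm (z - w)" by (rule norm_triangle_ineq2)
    have mono: "?B powr \<alpha> \<le> ?A powr \<alpha>" using zw assms by (intro powr_mono2) auto
    have pa: "x powr (\<alpha> + 1) = x powr \<alpha> * x" if "x \<ge> 0" for x :: real
      using that assms by (cases "x = 0") (auto simp: powr_add)
    have "pnl \<alpha> z - pnl \<alpha> w = of_real (?A powr \<alpha>) * (z - w) + of_real (?A powr \<alpha> - ?B powr \<alpha>) * w"
      by (simp add: pnl_def algebra_simps)
    also have "norm \<dots> \<le> ?A powr \<alpha> * norm (z - w) + (?A powr \<alpha> - ?B powr \<alpha>) * ?B"
      using mono by (intro order_trans[OF norm_triangle_ineq]) (simp add: norm_mult del: of_real_diff)
    also have "(?A powr \<alpha> - ?B powr \<alpha>) * ?B \<le> ?A powr (\<alpha> + 1) - ?B powr (\<alpha> + 1)"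
      unfolding pa[OF norm_ge_zero] using zw mult_left_mono[OF zw(1), of "?A powr \<alpha>"] by (simp add: algebra_simps)
    also have "\<dots> \<le> (\<alpha> + 1) * ?A powr \<alpha> * (?A - ?B)"
      using zw assms by (intro powr_diff_le) auto
    also have "\<dots> \<le> (\<alpha> + 1) * ?A powr \<alpha> * norm (z - w)"
      using AB assms by (intro mult_left_mono) auto
    finally have "norm (pnl \<alpha> z - pnl \<alpha> w) \<le> (\<alpha> + 2) * ?A powr \<alpha> * norm (z - w)"
      by (simp add: algebra_simps)
    also have "?A powr \<alpha> \<le> R powr \<alpha>" using zw assms by (intro powr_mono2) auto
    finally show ?thesis using assms by (simp add: mult_left_mono mult_right_mono)
  qed
  show ?thesis
    using *[of w z] *[of z w] assms by (cases "norm w \<le> norm z") (auto simp: norm_minus_commute)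
qed

lemma continuous_on_pnl: "\<alpha> > 0 \<Longrightarrow> continuous_on S f \<Longrightarrow> continuous_on S (\<lambda>x. pnl \<alpha> (f x))"
  unfolding pnl_def by (intro continuous_intros continuous_on_powr') auto

definition source :: "complex \<Rightarrow> real \<Rightarrow> ((real^'n::finite) \<Rightarrow>\<^sub>C complex) \<Rightarrow> (real^'n) \<Rightarrow>\<^sub>C complex" where
  "source lam \<alpha> h = Bcontfun (\<lambda>x. lam * pnl \<alpha> (h x))"

context
  fixes \<alpha> :: real assumes \<alpha>: "\<alpha> > 0"
begin

lemma apply_source: "apply_bcontfun (source lam \<alpha> h) x = lam * pnl \<alpha> (h x)"
proof -
  have "(\<lambda>x. lam * pnl \<alpha> (h x)) \<in> bcontfun"
  proof (rule bcontfun_normI)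
    show "continuous_on UNIV (\<lambda>x. lam * pnl \<alpha> (h x))"
      by (intro continuous_intros continuous_on_pnl \<alpha> continuous_on_apply_bcontfun)
    show "norm (lam * pnl \<alpha> (h x)) \<le> norm lam * norm h powr (\<alpha> + 1)" for x
      using \<alpha> by (auto simp: norm_mult norm_pnl intro!: mult_left_mono powr_mono2 norm_bounded)
  qed
  then show ?thesis by (simp add: source_def Bcontfun_inverse)
qed

lemma source_lipschitz:
  assumes "norm h \<le> R" "norm k \<le> R"
  shows "norm (source lam \<alpha> h - source lam \<alpha> k) \<le> norm lam * ((\<alpha> + 2) * R powr \<alpha>) * norm (h - k)"
proof (rule norm_bound)
  fix x
  have R: "norm (h x) \<le> R" "norm (k x) \<le> R"
    using norm_bounded[of h x] norm_bounded[of k x] assms by auto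
  have "norm (apply_bcontfun (source lam \<alpha> h - source lam \<alpha> k) x) = norm lam * norm (pnl \<alpha> (h x) - pnl \<alpha> (k x))"
    by (simp add: apply_source norm_mult flip: right_diff_distrib)
  also have "\<dots> \<le> norm lam * ((\<alpha> + 2) * R powr \<alpha> * norm (h x - k x))"
    by (intro mult_left_mono pnl_lipschitz R \<alpha>) simp
  also have "\<dots> \<le> norm lam * ((\<alpha> + 2) * R powr \<alpha> * norm (h - k))"
    using \<alpha> norm_bounded[of "h - k" x] by (intro mult_left_mono) auto
  finally show "norm (apply_bcontfun (source lam \<alpha> h - source lam \<alpha> k) x)
      \<le> norm lam * ((\<alpha> + 2) * R powr \<alpha>) * norm (h - k)" by (simp add: mult_ac)
qed

lemma norm_source_le:
  assumes "norm h \<le> R"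
  shows "norm (source lam \<alpha> h) \<le> norm lam * R powr (\<alpha> + 1)"
proof (rule norm_bound)
  fix x
  show "norm (source lam \<alpha> h x) \<le> norm lam * R powr (\<alpha> + 1)"
    using \<alpha> norm_bounded[of h x] assms
    by (auto simp: apply_source norm_mult norm_pnl intro!: mult_left_mono powr_mono2)
qed

lemma source_C0: "h \<in> C0 \<Longrightarrow> source lam \<alpha> h \<in> C0"
proof -
  assume h: "h \<in> C0"
  have "((\<lambda>x. norm lam * norm (h x) powr (\<alpha> + 1)) \<longlongrightarrow> norm lam * norm (0::complex) powr (\<alpha> + 1)) at_infinity"
    using h \<alpha> unfolding C0_def by (intro tendsto_intros tendsto_powr') auto
  then have "((\<lambda>x. norm (source lam \<alpha> h x)) \<longlongrightarrow> 0) at_infinity"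
    by (simp add: apply_source norm_mult norm_pnl)
  then show "source lam \<alpha> h \<in> C0" unfolding C0_def by (simp add: tendsto_norm_zero_iff)
qed

lemma source_C0_odd: "h \<in> C0_odd k \<Longrightarrow> source lam \<alpha> h \<in> C0_odd k"
  by (auto simp: C0_odd_def source_C0 apply_source)

lemma continuous_on_source:
  fixes U :: "'a::topological_space \<Rightarrow> (real^'n::finite) \<Rightarrow>\<^sub>C complex"
  assumes "continuous_on S U" shows "continuous_on S (\<lambda>t. source lam \<alpha> (U t))"
proof -
  have "isCont (source lam \<alpha>) h" for h :: "(real^'n) \<Rightarrow>\<^sub>C complex"
    unfolding isCont_def
  proof (rule Lim_null[THEN iffD2], rule Lim_null_comparison)
    have "\<forall>\<^sub>F k in at h. dist k h < 1" by (simp add: eventually_at) (use zero_less_one in blast)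
    then show "\<forall>\<^sub>F k in at h. norm (source lam \<alpha> k - source lam \<alpha> h)
       \<le> norm lam * ((\<alpha> + 2) * (norm h + 1) powr \<alpha>) * norm (k - h)"
    proof eventually_elim
      case (elim k)
      then have "norm k \<le> norm h + 1" using norm_triangle_sub[of k h] by (simp add: dist_norm)
      then show ?case by (intro source_lipschitz) auto
    qed
    show "((\<lambda>k. norm lam * ((\<alpha> + 2) * (norm h + 1) powr \<alpha>) * norm (k - h)) \<longlongrightarrow> 0) (at h)"
      by (rule tendsto_eq_intros refl)+ simp
  qed
  then have "continuous_on UNIV (source lam \<alpha> :: ((real^'n) \<Rightarrow>\<^sub>C complex) \<Rightarrow> _)"
    by (simp add: continuous_at_imp_continuous_on)
  then show ?thesis using assms continuous_on_compose2 by blast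
qed

end

section \<open>Duhamel's integral\<close>

lemma continuous_on_heatop_diff:
  fixes F :: "real \<Rightarrow> (real^'n::finite) \<Rightarrow>\<^sub>C complex"
  assumes "continuous_on {0..t} F" "\<And>\<sigma>. \<sigma> \<in> {0..t} \<Longrightarrow> F \<sigma> \<in> C0"
  shows "continuous_on {0..t} (\<lambda>\<sigma>. heatop (t - \<sigma>) (F \<sigma>))"
proof -
  have "continuous_on {0..t} ((\<lambda>(t, h). heatop t h) \<circ> (\<lambda>\<sigma>. (t - \<sigma>, F \<sigma>)))"
    by (rule continuous_on_compose)
       (use assms in \<open>auto intro!: continuous_intros continuous_on_subset[OF continuous_on_heatop]\<close>)
  then show ?thesis by (simp add: o_def)
qed

text \<open>The integral takes values in the Banach space, so bounded functionals and closed
  subspaces pass through it; \<open>apply_conv_heat\<close> recovers the pointwise integral that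
  appears in \<open>solution\<close>.\<close>

definition conv_heat :: "(real \<Rightarrow> (real^'n::finite) \<Rightarrow>\<^sub>C complex) \<Rightarrow> real \<Rightarrow> (real^'n) \<Rightarrow>\<^sub>C complex" where
  "conv_heat F t = integral {0..t} (\<lambda>\<sigma>. heatop (t - \<sigma>) (F \<sigma>))"

context
  fixes F :: "real \<Rightarrow> (real^'n::finite) \<Rightarrow>\<^sub>C complex" and T :: real
  assumes F: "continuous_on {0..T} F" "\<And>\<sigma>. \<sigma> \<in> {0..T} \<Longrightarrow> F \<sigma> \<in> C0"
begin

lemma continuous_on_conv_heat_integrand:
  "t \<le> T \<Longrightarrow> continuous_on {0..t} (\<lambda>\<sigma>. heatop (t - \<sigma>) (F \<sigma>))"
  by (intro continuous_on_heatop_diff continuous_on_subset[OF F(1)] F(2)) auto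

lemma apply_conv_heat:
  assumes "t \<le> T"
  shows "conv_heat F t x = integral {0..t} (\<lambda>\<sigma>. heat (t - \<sigma>) (F \<sigma>) x)"
proof -
  have "conv_heat F t x = integral {0..t} ((\<lambda>h. apply_bcontfun h x) \<circ> (\<lambda>\<sigma>. heatop (t - \<sigma>) (F \<sigma>)))"
    unfolding conv_heat_def
    by (intro integral_linear[symmetric] bounded_linear_apply_bcontfun integrable_continuous_real
        continuous_on_conv_heat_integrand assms)
  also have "\<dots> = integral {0..t} (\<lambda>\<sigma>. heat (t - \<sigma>) (F \<sigma>) x)"
    by (rule Henstock_Kurzweil_Integration.integral_cong) (use assms F(2) in \<open>auto simp: apply_heatop\<close>)
  finally show ?thesis .
qed

text \<open>Rescaling to a fixed interval turns continuity in \<open>t\<close> into continuity of a parameter integral.\<close>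

lemma conv_heat_eq:
  assumes "0 \<le> t" "t \<le> T"
  shows "conv_heat F t = t *\<^sub>R integral {0..1} (\<lambda>\<rho>. heatop (t * (1 - \<rho>)) (F (t * \<rho>)))"
proof (cases "t = 0")
  case True
  then show ?thesis by (simp add: conv_heat_def)
next
  case False
  with assms have t: "t > 0" by simp
  have "((\<lambda>\<sigma>. heatop (t - \<sigma>) (F \<sigma>)) has_integral conv_heat F t) (cbox 0 t)"
    unfolding conv_heat_def cbox_interval
    by (intro integrable_integral integrable_continuous_real continuous_on_conv_heat_integrand assms)
  from has_integral_affinity'[OF this t, of 0]
  have "((\<lambda>\<rho>. heatop (t - t * \<rho>) (F (t * \<rho>))) has_integral (conv_heat F t /\<^sub>R t)) {0..1}"
    using t by simp
  then have "integral {0..1} (\<lambda>\<rho>. heatop (t * (1 - \<rho>)) (F (t * \<rho>))) = conv_heat F t /\<^sub>R t"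
    by (intro integral_unique) (simp add: algebra_simps)
  then show ?thesis using t by simp
qed

lemma continuous_on_conv_heat: "continuous_on {0..T} (conv_heat F)"
proof -
  have "continuous_on ({0..T} \<times> {0..1}) ((\<lambda>(t, h). heatop t h) \<circ> (\<lambda>(t, \<rho>). (t * (1 - \<rho>), F (t * \<rho>))))"
  proof (rule continuous_on_compose)
    have in_T: "t * \<rho> \<in> {0..T}" if "t \<in> {0..T}" "\<rho> \<in> {0..1}" for t \<rho> :: real
      using that mult_mono[of t T \<rho> 1] by auto
    show "continuous_on ({0..T} \<times> {0..1}) (\<lambda>(t, \<rho>). (t * (1 - \<rho>), F (t * \<rho>)))"
      unfolding case_prod_beta
      by (intro continuous_intros continuous_on_compose2[OF F(1)]) (use in_T in auto)
    show "continuous_on ((\<lambda>(t, \<rho>). (t * (1 - \<rho>), F (t * \<rho>))) ` ({0..T} \<times> {0..1})) (\<lambda>(t, h). heatop t h)"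
      by (rule continuous_on_subset[OF continuous_on_heatop]) (use in_T F(2) in \<open>auto simp: mult_nonneg_nonneg\<close>)
  qed
  then have "continuous_on ({0..T} \<times> cbox 0 1) (\<lambda>(t, \<rho>). heatop (t * (1 - \<rho>)) (F (t * \<rho>)))"
    by (simp add: o_def case_prod_beta)
  from integral_continuous_on_param[OF this]
  have "continuous_on {0..T} (\<lambda>t. t *\<^sub>R integral {0..1} (\<lambda>\<rho>. heatop (t * (1 - \<rho>)) (F (t * \<rho>))))"
    by (intro continuous_intros) simp
  then show ?thesis
    by (rule continuous_on_eq) (simp add: conv_heat_eq)
qed

lemma conv_heat_in_subspace:
  assumes "t \<le> T" "subspace S" "closed S" "\<And>\<sigma>. \<sigma> \<in> {0..t} \<Longrightarrow> heatop (t - \<sigma>) (F \<sigma>) \<in> S"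
  shows "conv_heat F t \<in> S"
  unfolding conv_heat_def
  by (rule integral_in_closed_subspace)
     (use assms in \<open>auto intro!: integrable_continuous_real continuous_on_conv_heat_integrand\<close>)

lemma norm_conv_heat_le:
  assumes "0 \<le> t" "t \<le> T" "\<And>\<sigma>. \<sigma> \<in> {0..t} \<Longrightarrow> norm (F \<sigma>) \<le> B"
  shows "norm (conv_heat F t) \<le> t * B"
proof -
  have "norm (integral {0..t} (\<lambda>\<sigma>. heatop (t - \<sigma>) (F \<sigma>))) \<le> integral {0..t} (\<lambda>_. B)"
    by (rule Henstock_Kurzweil_Integration.integral_norm_bound_integral)
       (use assms F(2) in \<open>auto intro!: integrable_continuous_real continuous_on_conv_heat_integrand
         order_trans[OF norm_heatop_le]\<close>)
  then show ?thesis using assms by (simp add: conv_heat_def mult.commute)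
qed

end

text \<open>The bound on the difference may depend on time: uniqueness uses an exponential, the
  contraction argument a constant.\<close>

lemma norm_conv_heat_diff_le:
  fixes F G :: "real \<Rightarrow> (real^'n::finite) \<Rightarrow>\<^sub>C complex"
  assumes F: "continuous_on {0..t} F" "\<And>\<sigma>. \<sigma> \<in> {0..t} \<Longrightarrow> F \<sigma> \<in> C0"
    and G: "continuous_on {0..t} G" "\<And>\<sigma>. \<sigma> \<in> {0..t} \<Longrightarrow> G \<sigma> \<in> C0"
    and le: "\<And>\<sigma>. \<sigma> \<in> {0..t} \<Longrightarrow> norm (F \<sigma> - G \<sigma>) \<le> b \<sigma>" and b: "(b has_integral I) {0..t}"
  shows "norm (conv_heat F t - conv_heat G t) \<le> I"
proof -
  note iF = integrable_continuous_real[OF continuous_on_conv_heat_integrand[OF F order_refl]]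
  note iG = integrable_continuous_real[OF continuous_on_conv_heat_integrand[OF G order_refl]]
  have "conv_heat F t - conv_heat G t = integral {0..t} (\<lambda>\<sigma>. heatop (t - \<sigma>) (F \<sigma>) - heatop (t - \<sigma>) (G \<sigma>))"
    unfolding conv_heat_def by (rule Henstock_Kurzweil_Integration.integral_diff[OF iF iG, symmetric])
  also have "norm \<dots> \<le> integral {0..t} b"
    by (rule Henstock_Kurzweil_Integration.integral_norm_bound_integral)
       (use b F G in \<open>auto intro!: Henstock_Kurzweil_Integration.integrable_diff iF iG order_trans[OF norm_heatop_diff_le] le\<close>)
  also have "integral {0..t} b = I" using b by (rule integral_unique)
  finally show ?thesis .
qed

section \<open>Mild solutions: uniqueness, local existence, maximal extension\<close>

definition mild ::
  "complex \<Rightarrow> real \<Rightarrow> ((real^'n::finite) \<Rightarrow>\<^sub>C complex) \<Rightarrow> ereal \<Rightarrow> (real \<Rightarrow> (real^'n) \<Rightarrow>\<^sub>C complex) \<Rightarrow> bool" where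
  "mild lam \<alpha> w T u \<longleftrightarrow> continuous_on {t. 0 \<le> t \<and> ereal t < T} u \<and>
     (\<forall>t. 0 \<le> t \<and> ereal t < T \<longrightarrow> u t \<in> C0 \<and> u t = heatop t w + conv_heat (\<lambda>\<sigma>. source lam \<alpha> (u \<sigma>)) t)"

lemma heat_cmult: "heat t (\<lambda>y. c * f y) x = c * heat t f x"
proof (cases "t = 0")
  case False
  have "of_real (heat_kernel t (x - y)) * (c * f y) = c * (of_real (heat_kernel t (x - y)) * f y)" for y
    by (simp add: mult_ac)
  with False show ?thesis by (simp only: heat_def if_False integral_mult_right_zero)
qed (simp add: heat_def)

lemma interval_initial_subset: "ereal t < T \<Longrightarrow> {0..t} \<subseteq> {s. 0 \<le> s \<and> ereal s < T}"
  by (auto intro: le_less_trans[of "ereal _" "ereal t"])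

context
  fixes \<alpha> :: real and lam :: complex and w :: "(real^'n::finite) \<Rightarrow>\<^sub>C complex"
  assumes \<alpha>: "\<alpha> > 0" and w: "w \<in> C0"
begin

lemma source_continuous_C0:
  assumes "continuous_on {t. 0 \<le> t \<and> ereal t < T} u" "\<And>t. 0 \<le> t \<Longrightarrow> ereal t < T \<Longrightarrow> u t \<in> C0" "ereal t < T"
  shows "continuous_on {0..t} (\<lambda>\<sigma>. source lam \<alpha> (u \<sigma>))"
    and "\<And>\<sigma>. \<sigma> \<in> {0..t} \<Longrightarrow> source lam \<alpha> (u \<sigma>) \<in> C0"
proof -
  note sub = interval_initial_subset[OF assms(3)]
  show "continuous_on {0..t} (\<lambda>\<sigma>. source lam \<alpha> (u \<sigma>))"
    by (intro continuous_on_source \<alpha> continuous_on_subset[OF assms(1) sub])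
  show "source lam \<alpha> (u \<sigma>) \<in> C0" if "\<sigma> \<in> {0..t}" for \<sigma>
    using sub that by (intro source_C0 \<alpha> assms(2)) auto
qed

text \<open>Transfers the dynamics, which is carried out in the Banach space, to the pointwise
  formulation. The two differ only in where the integral is taken and in whether \<open>lam\<close>
  stands inside or outside of it.\<close>

lemma solution_iff_mild: "solution \<alpha> lam (apply_bcontfun w) T u \<longleftrightarrow> mild lam \<alpha> w T u"
proof -
  have eq: "(\<forall>x. apply_bcontfun (u t) x = heat t w x + lam * integral {0..t} (\<lambda>\<sigma>. heat (t - \<sigma>)
        (\<lambda>y. of_real (norm (apply_bcontfun (u \<sigma>) y) powr \<alpha>) * apply_bcontfun (u \<sigma>) y) x))
      \<longleftrightarrow> u t = heatop t w + conv_heat (\<lambda>\<sigma>. source lam \<alpha> (u \<sigma>)) t"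
    if u: "continuous_on {t. 0 \<le> t \<and> ereal t < T} u" "\<And>t. 0 \<le> t \<Longrightarrow> ereal t < T \<Longrightarrow> u t \<in> C0"
      and t: "0 \<le> t" "ereal t < T" for t
  proof -
    have "conv_heat (\<lambda>\<sigma>. source lam \<alpha> (u \<sigma>)) t x = lam * integral {0..t} (\<lambda>\<sigma>. heat (t - \<sigma>)
        (\<lambda>y. of_real (norm (apply_bcontfun (u \<sigma>) y) powr \<alpha>) * apply_bcontfun (u \<sigma>) y) x)" for x
    proof -
      have s: "apply_bcontfun (source lam \<alpha> (u \<sigma>)) =
          (\<lambda>y. lam * (of_real (norm (apply_bcontfun (u \<sigma>) y) powr \<alpha>) * apply_bcontfun (u \<sigma>) y))" for \<sigma>
        by (rule ext) (simp add: apply_source \<alpha> pnl_def)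
      show ?thesis
        by (subst apply_conv_heat[OF source_continuous_C0[OF u t(2)] order_refl]) (auto simp: s heat_cmult)
    qed
    moreover have "u t = v \<longleftrightarrow> (\<forall>x. u t x = v x)" for v
      using bcontfun_eqI by metis
    ultimately show ?thesis
      using t w by (simp add: apply_heatop)
  qed
  show ?thesis
    unfolding solution_def mild_def using eq by (intro conj_cong refl) blast
qed

lemma mildD:
  assumes "mild lam \<alpha> w T u"
  shows "continuous_on {t. 0 \<le> t \<and> ereal t < T} u"
    and "0 \<le> t \<Longrightarrow> ereal t < T \<Longrightarrow> u t \<in> C0"
    and "0 \<le> t \<Longrightarrow> ereal t < T \<Longrightarrow> u t = heatop t w + conv_heat (\<lambda>\<sigma>. source lam \<alpha> (u \<sigma>)) t"
  using assms unfolding mild_def by blast+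

text \<open>The maximum \<open>D\<close> of the weighted difference over the whole interval
  satisfies \<open>D \<le> D / 2\<close>, so no continuation from short intervals is necessary. The
  two existence times may differ, as the gluing in \<open>mild_maximal\<close> requires.\<close>

lemma mild_unique:
  assumes u: "mild lam \<alpha> w T u" and v: "mild lam \<alpha> w T' v"
    and t: "0 \<le> t" "ereal t < T" "ereal t < T'"
  shows "u t = v t"
proof -
  have sub: "{0..t} \<subseteq> {s. 0 \<le> s \<and> ereal s < T}" "{0..t} \<subseteq> {s. 0 \<le> s \<and> ereal s < T'}"
    using t interval_initial_subset by blast+
  have cu: "continuous_on {0..t} u" and cv: "continuous_on {0..t} v"
    using mildD(1)[OF u] mildD(1)[OF v] sub continuous_on_subset by blast+
  have "bounded (u ` {0..t} \<union> v ` {0..t})"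
    using cu cv by (intro bounded_Un[THEN iffD2] conjI compact_imp_bounded compact_continuous_image) auto
  then obtain R where R: "\<And>s. s \<in> {0..t} \<Longrightarrow> norm (u s) \<le> R \<and> norm (v s) \<le> R"
    unfolding bounded_iff by (metis UnI1 UnI2 imageI)
  define L where "L = norm lam * ((\<alpha> + 2) * R powr \<alpha>)"
  \<comment> \<open>In the norm weighted with \<open>exp (- K * t)\<close>, Duhamel's map contracts on the whole interval.\<close>
  define K where "K = 2 * L + 1"
  have "L \<ge> 0" using \<alpha> by (auto simp: L_def)
  then have LK: "L \<ge> 0" "K > 0" "2 * L \<le> K" by (auto simp: K_def)
  define f where "f = (\<lambda>s. exp (- K * s) * norm (u s - v s))"
  have "continuous_on {0..t} f"
    unfolding f_def by (intro continuous_intros cu cv)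
  then obtain m where m: "m \<in> {0..t}" "\<And>s. s \<in> {0..t} \<Longrightarrow> f s \<le> f m"
    using continuous_attains_sup[of "{0..t}" f] t by auto
  define D where "D = f m"
  have D: "D \<ge> 0" by (simp add: D_def f_def)
  have le: "norm (u s - v s) \<le> D * exp (K * s)" if "s \<in> {0..t}" for s
    using m(2)[OF that] by (simp add: D_def f_def exp_minus field_simps)
  have m': "0 \<le> m" "ereal m < T" "ereal m < T'" using m(1) sub by auto
  have "norm (conv_heat (\<lambda>\<sigma>. source lam \<alpha> (u \<sigma>)) m - conv_heat (\<lambda>\<sigma>. source lam \<alpha> (v \<sigma>)) m)
      \<le> L * D * (exp (K * m) / K - exp (K * 0) / K)"
  proof (rule norm_conv_heat_diff_le[where b="\<lambda>s. L * D * exp (K * s)"])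
    show "continuous_on {0..m} (\<lambda>\<sigma>. source lam \<alpha> (u \<sigma>))" "\<And>\<sigma>. \<sigma> \<in> {0..m} \<Longrightarrow> source lam \<alpha> (u \<sigma>) \<in> C0"
      using source_continuous_C0[OF mildD(1)[OF u] mildD(2)[OF u] m'(2)] by blast+
    show "continuous_on {0..m} (\<lambda>\<sigma>. source lam \<alpha> (v \<sigma>))" "\<And>\<sigma>. \<sigma> \<in> {0..m} \<Longrightarrow> source lam \<alpha> (v \<sigma>) \<in> C0"
      using source_continuous_C0[OF mildD(1)[OF v] mildD(2)[OF v] m'(3)] by blast+
    show "norm (source lam \<alpha> (u \<sigma>) - source lam \<alpha> (v \<sigma>)) \<le> L * D * exp (K * \<sigma>)" if "\<sigma> \<in> {0..m}" for \<sigma>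
    proof -
      have s: "\<sigma> \<in> {0..t}" using that m by auto
      have "norm (source lam \<alpha> (u \<sigma>) - source lam \<alpha> (v \<sigma>)) \<le> L * norm (u \<sigma> - v \<sigma>)"
        unfolding L_def using R[OF s] by (intro source_lipschitz \<alpha>) auto
      also have "\<dots> \<le> L * (D * exp (K * \<sigma>))" using LK le[OF s] by (intro mult_left_mono) auto
      finally show ?thesis by simp
    qed
    have "((\<lambda>s. exp (K * s)) has_integral exp (K * m) / K - exp (K * 0) / K) {0..m}"
      using m' LK by (intro fundamental_theorem_of_calculus)
        (auto intro!: derivative_eq_intros simp flip: has_real_derivative_iff_has_vector_derivative)
    then show "((\<lambda>s. L * D * exp (K * s)) has_integral L * D * (exp (K * m) / K - exp (K * 0) / K)) {0..m}"
      by (rule has_integral_mult_right)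
  qed
  also have "conv_heat (\<lambda>\<sigma>. source lam \<alpha> (u \<sigma>)) m - conv_heat (\<lambda>\<sigma>. source lam \<alpha> (v \<sigma>)) m = u m - v m"
  proof -
    have "u m = heatop m w + conv_heat (\<lambda>\<sigma>. source lam \<alpha> (u \<sigma>)) m"
      by (rule mildD(3)[OF u m'(1,2)])
    moreover have "v m = heatop m w + conv_heat (\<lambda>\<sigma>. source lam \<alpha> (v \<sigma>)) m"
      by (rule mildD(3)[OF v m'(1,3)])
    ultimately show ?thesis by (metis add_diff_cancel_left)
  qed
  also have "L * D * (exp (K * m) / K - exp (K * 0) / K) \<le> L * D * (exp (K * m) / K)"
    using LK D by (intro mult_left_mono) auto
  also have "\<dots> = (2 * L / K) * (D / 2 * exp (K * m))" by simp
  also have "\<dots> \<le> 1 * (D / 2 * exp (K * m))"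
    using LK D by (intro mult_right_mono) auto
  finally have "exp (- K * m) * norm (u m - v m) \<le> exp (- K * m) * (D / 2 * exp (K * m))"
    by (intro mult_left_mono) auto
  also have "\<dots> = D / 2" by (simp add: exp_minus)
  finally have "D \<le> D / 2" by (simp add: D_def f_def)
  then have "norm (u t - v t) \<le> 0" using le[of t] t D by simp
  then show ?thesis by simp
qed

text \<open>Banach's fixed point theorem in the odd functions of norm at most
  \<open>norm w + 1\<close>. Bounded continuous functions are defined on a whole type, so time is
  clamped to the interval from 0 to \<open>T\<close> by \<open>cl\<close>; outside of it the fixed
  point is constant.\<close>

lemma mild_local_existence:
  assumes wk: "w \<in> C0_odd k"
  obtains T u where "T > 0" "mild lam \<alpha> w (ereal T) u"
    "\<And>t. 0 \<le> t \<Longrightarrow> t < T \<Longrightarrow> u t \<in> C0_odd k" "\<And>t. 0 \<le> t \<Longrightarrow> t < T \<Longrightarrow> norm (u t) \<le> norm w + 1"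
proof -
  define R where "R = norm w + 1"
  define B where "B = norm lam * R powr (\<alpha> + 1)"
  define L where "L = norm lam * ((\<alpha> + 2) * R powr \<alpha>)"
  \<comment> \<open>Chosen for both requirements at once: \<open>T * B \<le> 1\<close> keeps the
    ball invariant and \<open>T * L \<le> 1 / 2\<close> gives the contraction. The summand 1 covers
    the case that \<open>B\<close> and \<open>L\<close> vanish.\<close>
  define T where "T = 1 / (1 + B + 2 * L)"
  have BL: "B \<ge> 0" "L \<ge> 0" using \<alpha> by (auto simp: B_def L_def)
  have T: "T > 0" "T * B \<le> 1" "T * L \<le> 1 / 2"
    using BL by (auto simp: T_def field_simps)
  define S where "S = C0_odd k \<inter> cball 0 R"
  define X where "X = PiC (UNIV::real set) (\<lambda>_. S)"
  have X_iff: "U \<in> X \<longleftrightarrow> (\<forall>t. U t \<in> C0_odd k \<and> norm (U t) \<le> R)" for U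
    by (auto simp: X_def S_def mem_PiC_iff)
  define cl where "cl = (\<lambda>t. max 0 (min T t))"
  have cl: "cl t \<in> {0..T}" for t using T by (auto simp: cl_def)
  have cl_id: "cl t = t" if "t \<in> {0..T}" for t using that by (auto simp: cl_def)
  define \<Psi> where "\<Psi> = (\<lambda>U t. heatop (cl t) w + conv_heat (\<lambda>\<sigma>. source lam \<alpha> (apply_bcontfun U \<sigma>)) (cl t))"
  define \<Phi> where "\<Phi> = (\<lambda>U. Bcontfun (\<Psi> U))"
  have src: "continuous_on A (\<lambda>\<sigma>. source lam \<alpha> (U \<sigma>))" for U :: "real \<Rightarrow>\<^sub>C (real^'n) \<Rightarrow>\<^sub>C complex" and A
    by (intro continuous_on_source \<alpha> continuous_on_apply_bcontfun)
  have srcC: "source lam \<alpha> (U \<sigma>) \<in> C0_odd k" "norm (source lam \<alpha> (U \<sigma>)) \<le> B" if "U \<in> X" for U \<sigma>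
    using that by (auto simp: X_iff B_def intro!: source_C0_odd norm_source_le \<alpha>)
  have srcC0: "source lam \<alpha> (U \<sigma>) \<in> C0" if "U \<in> X" for U \<sigma>
    using srcC(1)[OF that] C0_odd_subset by blast
  have \<Psi>_odd: "\<Psi> U t \<in> C0_odd k" if "U \<in> X" for U t
    unfolding \<Psi>_def
  proof (rule subspace_add[OF subspace_C0_odd])
    show "heatop (cl t) w \<in> C0_odd k" using cl[of t] by (intro heatop_C0_odd wk) auto
    show "conv_heat (\<lambda>\<sigma>. source lam \<alpha> (U \<sigma>)) (cl t) \<in> C0_odd k"
      by (rule conv_heat_in_subspace[where T=T, OF src srcC0[OF that] _ subspace_C0_odd closed_C0_odd])
         (use cl[of t] srcC(1)[OF that] in \<open>auto intro!: heatop_C0_odd\<close>)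
  qed
  have \<Psi>_norm: "norm (\<Psi> U t) \<le> R" if "U \<in> X" for U t
  proof -
    have "norm (conv_heat (\<lambda>\<sigma>. source lam \<alpha> (U \<sigma>)) (cl t)) \<le> cl t * B"
      by (rule norm_conv_heat_le[where T=T, OF src srcC0[OF that]]) (use cl[of t] srcC(2)[OF that] in auto)
    also have "\<dots> \<le> T * B" using cl[of t] BL by (intro mult_right_mono) auto
    finally have "norm (conv_heat (\<lambda>\<sigma>. source lam \<alpha> (U \<sigma>)) (cl t)) \<le> 1" using T by linarith
    moreover have "norm (heatop (cl t) w) \<le> norm w" using cl[of t] w by (intro norm_heatop_le) auto
    ultimately show ?thesis
      unfolding \<Psi>_def R_def by (intro order_trans[OF norm_triangle_ineq]) simp
  qed
  have \<Psi>_cont: "continuous_on UNIV (\<Psi> U)" if "U \<in> X" for U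
  proof -
    have ccl: "continuous_on UNIV cl" unfolding cl_def by (intro continuous_intros)
    have "continuous_on {0..T} (conv_heat (\<lambda>\<sigma>. source lam \<alpha> (U \<sigma>)))"
      by (rule continuous_on_conv_heat[OF src srcC0[OF that]])
    then have 1: "continuous_on UNIV (\<lambda>t. conv_heat (\<lambda>\<sigma>. source lam \<alpha> (U \<sigma>)) (cl t))"
      by (rule continuous_on_compose2[OF _ ccl]) (use cl in blast)
    have "continuous_on UNIV ((\<lambda>(t, h). heatop t h) \<circ> (\<lambda>t. (cl t, w)))"
      by (rule continuous_on_compose)
         (use cl w in \<open>auto intro!: continuous_intros ccl continuous_on_subset[OF continuous_on_heatop]\<close>)
    then have 2: "continuous_on UNIV (\<lambda>t. heatop (cl t) w)" by (simp add: o_def)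
    show ?thesis unfolding \<Psi>_def by (intro continuous_on_add 1 2)
  qed
  have app: "apply_bcontfun (\<Phi> U) = \<Psi> U" if "U \<in> X" for U
    unfolding \<Phi>_def by (rule Bcontfun_inverse, rule bcontfun_normI[OF \<Psi>_cont \<Psi>_norm], (rule that)+)
  have "\<exists>!U\<in>X. \<Phi> U = U"
  proof (rule Banach_fix[OF complete_eq_closed[THEN iffD2]])
    show "closed X"
      unfolding X_def S_def by (intro closed_PiC closed_Int closed_C0_odd closed_cball)
    show "X \<noteq> {}"
    proof -
      have "0 \<in> X" using subspace_0[OF subspace_C0_odd, of k] by (simp add: X_iff R_def)
      then show ?thesis by blast
    qed
    show "\<Phi> ` X \<subseteq> X" by (auto simp: X_iff app \<Psi>_odd \<Psi>_norm)
    show "dist (\<Phi> U) (\<Phi> V) \<le> 1 / 2 * dist U V" if UV: "U \<in> X" "V \<in> X" for U V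
    proof (rule dist_bound)
      fix t
      have "norm (conv_heat (\<lambda>\<sigma>. source lam \<alpha> (U \<sigma>)) (cl t) - conv_heat (\<lambda>\<sigma>. source lam \<alpha> (V \<sigma>)) (cl t))
          \<le> cl t * (L * dist U V)"
      proof (rule norm_conv_heat_diff_le[where b="\<lambda>_. L * dist U V"])
        show "continuous_on {0..cl t} (\<lambda>\<sigma>. source lam \<alpha> (U \<sigma>))" "continuous_on {0..cl t} (\<lambda>\<sigma>. source lam \<alpha> (V \<sigma>))"
          by (rule src)+
        fix \<sigma>
        show "source lam \<alpha> (U \<sigma>) \<in> C0" "source lam \<alpha> (V \<sigma>) \<in> C0"
          using UV srcC0 by blast+
        have "norm (source lam \<alpha> (U \<sigma>) - source lam \<alpha> (V \<sigma>)) \<le> L * norm (U \<sigma> - V \<sigma>)"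
          unfolding L_def using UV by (intro source_lipschitz \<alpha>) (auto simp: X_iff)
        also have "\<dots> \<le> L * dist U V"
          using dist_bounded[of U \<sigma> V] BL by (intro mult_left_mono) (auto simp: dist_norm)
        finally show "norm (source lam \<alpha> (U \<sigma>) - source lam \<alpha> (V \<sigma>)) \<le> L * dist U V" .
      next
        show "((\<lambda>\<sigma>. L * dist U V) has_integral cl t * (L * dist U V)) {0..cl t}"
          using has_integral_const_real[of "L * dist U V" 0 "cl t"] cl[of t] by simp
      qed
      also have "\<dots> \<le> T * (L * dist U V)" using cl[of t] BL by (intro mult_right_mono) auto
      also have "\<dots> \<le> 1 / 2 * dist U V" using mult_right_mono[OF T(3), of "dist U V"] by simp
      finally show "dist (\<Phi> U t) (\<Phi> V t) \<le> 1 / 2 * dist U V"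
        by (simp add: app UV \<Psi>_def dist_norm)
    qed
  qed auto
  then obtain U where U: "U \<in> X" "\<Phi> U = U" by blast
  show ?thesis
  proof
    show "T > 0" by (rule T)
    show "U t \<in> C0_odd k" "norm (U t) \<le> norm w + 1" for t
      using U(1) by (auto simp: X_iff R_def)
    have "U t = heatop t w + conv_heat (\<lambda>\<sigma>. source lam \<alpha> (U \<sigma>)) t" if "0 \<le> t" "t < T" for t
    proof -
      have "U t = \<Psi> U t" using app[OF U(1)] U(2) by simp
      then show ?thesis using that by (simp add: \<Psi>_def cl_id)
    qed
    moreover have "U t \<in> C0" for t using U(1) C0_odd_subset by (auto simp: X_iff)
    ultimately show "mild lam \<alpha> w (ereal T) U"
      unfolding mild_def less_ereal.simps by (intro conjI allI impI continuous_on_apply_bcontfun) blast+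
  qed
qed

text \<open>By uniqueness any two solutions agree where both exist, so their union is a solution up
  to the supremum of all existence times. Taking the supremum in \<open>ereal\<close> admits an
  infinite existence time.\<close>

lemma mild_maximal:
  assumes ex: "mild lam \<alpha> w T0 u0" "T0 > 0"
  obtains T u where "T > 0" "mild lam \<alpha> w T u"
    "\<And>T' v. mild lam \<alpha> w T' v \<Longrightarrow> T' \<le> T \<and> (\<forall>t. 0 \<le> t \<and> ereal t < T' \<longrightarrow> v t = u t)"
proof -
  define T where "T = Sup {T'. \<exists>v. mild lam \<alpha> w T' v}"
  define u where "u = (\<lambda>t. SOME y. \<exists>T' v. mild lam \<alpha> w T' v \<and> ereal t < T' \<and> y = v t)"
  have le: "T' \<le> T" if "mild lam \<alpha> w T' v" for T' v
    unfolding T_def using that by (intro Sup_upper) auto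
  have u_eq: "v t = u t" if "mild lam \<alpha> w T' v" "0 \<le> t" "ereal t < T'" for T' v t
  proof -
    have "\<exists>y T' v. mild lam \<alpha> w T' v \<and> ereal t < T' \<and> y = v t"
      using that by blast
    then have "\<exists>T' v. mild lam \<alpha> w T' v \<and> ereal t < T' \<and> u t = v t"
      unfolding u_def by (rule someI_ex)
    then obtain T'' v' where v': "mild lam \<alpha> w T'' v'" "ereal t < T''" "u t = v' t" by blast
    show ?thesis using mild_unique[OF that(1) v'(1) that(2,3) v'(2)] v'(3) by simp
  qed
  have ex_v: "\<exists>T' v. mild lam \<alpha> w T' v \<and> ereal t < T'" if "ereal t < T" for t
    using that unfolding T_def less_Sup_iff by blast
  have "mild lam \<alpha> w T u"
    unfolding mild_def
  proof (intro conjI allI impI)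
    let ?S = "\<lambda>T. {t. 0 \<le> t \<and> ereal t < T}"
    show "continuous_on (?S T) u"
      unfolding continuous_on_def
    proof
      fix t assume t: "t \<in> ?S T"
      then obtain T' v where v: "mild lam \<alpha> w T' v" "ereal t < T'" using ex_v by blast
      \<comment> \<open>Below an intermediate time \<open>b\<close> the domains of \<open>u\<close>
        and \<open>v\<close> coincide, so both have the same filter of neighbourhoods at
        \<open>t\<close> and continuity carries over from \<open>v\<close>.\<close>
      obtain b where b: "t < b" "ereal b < T'"
        using ereal_dense2[OF v(2)] by auto
      have lt: "ereal x < T'" if "x < b" for x
        by (rule less_trans[OF _ b(2)]) (simp add: that)
      have lt': "ereal x < T" if "x < b" for x
        using lt[OF that] le[OF v(1)] by (rule less_le_trans)
      have W: "?S T \<inter> {..<b} - {t} = ?S T' \<inter> {..<b} - {t}"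
        using lt lt' by (intro set_eqI) (simp, blast)
      have at: "at t within ?S T = at t within ?S T'"
        by (rule at_within_nhd[OF _ open_lessThan W]) (use b in simp)
      have "(v \<longlongrightarrow> v t) (at t within ?S T')"
        using mildD(1)[OF v(1)] t v(2) unfolding continuous_on_def by auto
      moreover have "\<forall>\<^sub>F s in at t within ?S T'. v s = u s"
        by (simp add: eventually_at_filter u_eq[OF v(1)])
      moreover have "v t = u t" using t by (intro u_eq[OF v(1) _ v(2)]) simp
      ultimately show "(u \<longlongrightarrow> u t) (at t within ?S T)"
        unfolding at by (simp only: Lim_transform_eventually)
    qed
    fix t assume t: "0 \<le> t \<and> ereal t < T"
    then obtain T' v where v: "mild lam \<alpha> w T' v" "ereal t < T'" using ex_v by blast
    have uv: "v s = u s" if "s \<in> {0..t}" for s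
      using interval_initial_subset[OF v(2)] that by (intro u_eq[OF v(1)]) auto
    have vt: "v t \<in> C0" "v t = heatop t w + conv_heat (\<lambda>\<sigma>. source lam \<alpha> (v \<sigma>)) t"
      using v t unfolding mild_def by blast+
    show "u t \<in> C0" using vt(1) uv[of t] t by (metis atLeastAtMost_iff order_refl)
    have "conv_heat (\<lambda>\<sigma>. source lam \<alpha> (v \<sigma>)) t = conv_heat (\<lambda>\<sigma>. source lam \<alpha> (u \<sigma>)) t"
      unfolding conv_heat_def by (rule Henstock_Kurzweil_Integration.integral_cong) (simp add: uv)
    then show "u t = heatop t w + conv_heat (\<lambda>\<sigma>. source lam \<alpha> (u \<sigma>)) t"
      using vt(2) uv[of t] t by (metis atLeastAtMost_iff order_refl)
  qed
  then show ?thesis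
  proof (rule that[rotated])
    show "T > 0" using le[OF ex(1)] ex(2) by (rule less_le_trans[rotated])
    fix T' v assume v: "mild lam \<alpha> w T' v"
    show "T' \<le> T \<and> (\<forall>t. 0 \<le> t \<and> ereal t < T' \<longrightarrow> v t = u t)"
      using le[OF v] u_eq[OF v] by blast
  qed
qed

end

section \<open>Smooth bumps\<close>

text \<open>Smoothness without computing higher derivatives: it suffices to exhibit a class of
  differentiable functions that is closed under partial derivatives. Products of bumps and Gamma
  mixtures are both treated this way.\<close>

lemma smooth_if_closed_class:
  assumes f: "f \<in> \<C>" and diff: "\<And>f. f \<in> \<C> \<Longrightarrow> f differentiable_on UNIV"
    and closed: "\<And>f i. f \<in> \<C> \<Longrightarrow> partial_deriv i f \<in> \<C>"
  shows "smooth f" and "partial_derivs is f \<in> \<C>"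
proof -
  show *: "partial_derivs is f \<in> \<C>" for "is"
    by (induction "is") (auto simp: partial_derivs_def f closed)
  show "smooth f" unfolding smooth_def using * diff by blast
qed

lemma partial_deriv_eq:
  assumes "\<And>x. (f has_derivative D x) (at x)"
  shows "partial_deriv i f = (\<lambda>x. D x (axis i 1))"
  unfolding partial_deriv_def using frechet_derivative_at[OF assms] by metis

text \<open>Each summand replaces a single factor by its derivative. Written as the update
  \<open>h(i := h' i)\<close> it is again a product function, which is what makes classes of such
  products closed under partial derivatives.\<close>

lemma has_derivative_prod_vec:
  fixes h h' :: "'n::finite \<Rightarrow> real \<Rightarrow> real" and x :: "real^'n"
  assumes "\<And>i. (h i has_real_derivative h' i (x $ i)) (at (x $ i))"
  shows "((\<lambda>x. \<Prod>i\<in>UNIV. h i (x $ i)) has_derivative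
     (\<lambda>v. \<Sum>i\<in>UNIV. v $ i * (\<Prod>j\<in>UNIV. (h(i := h' i)) j (x $ j)))) (at x)"
proof -
  have 1: "((\<lambda>x. h i (x $ i)) has_derivative (\<lambda>v. v $ i * h' i (x $ i))) (at x)" for i
  proof -
    have "((\<lambda>x. x $ i) has_derivative (\<lambda>v. v $ i)) (at x)"
      by (rule bounded_linear_imp_has_derivative[OF bounded_linear_vec_nth])
    moreover have "(h i has_derivative (\<lambda>r. r * h' i (x $ i))) (at (x $ i))"
      using assms[of i] by (simp add: has_field_derivative_def mult_commute_abs)
    ultimately show ?thesis
      using has_derivative_compose[of "\<lambda>x. x $ i" "\<lambda>v. v $ i" x UNIV "h i"] by simp
  qed
  have "((\<lambda>x. \<Prod>i\<in>UNIV. h i (x $ i)) has_derivative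
      (\<lambda>v. \<Sum>i\<in>UNIV. (v $ i * h' i (x $ i)) * (\<Prod>j\<in>UNIV - {i}. h j (x $ j)))) (at x)"
    by (rule has_derivative_prod[OF 1])
  moreover have "(v $ i * h' i (x $ i)) * (\<Prod>j\<in>UNIV - {i}. h j (x $ j)) =
      v $ i * (\<Prod>j\<in>UNIV. (h(i := h' i)) j (x $ j))" for v :: "real^'n" and i
    by (subst (2) prod.remove[of _ i]) (auto intro!: prod.cong)
  ultimately show ?thesis by simp
qed

section \<open>Smooth compactly supported functions on the line\<close>

definition bmp :: "nat \<Rightarrow> real \<Rightarrow> real" where
  "bmp m y = (if y \<le> 0 then 0 else exp (- 1 / y) / y ^ m)"

text \<open>The term of order \<open>m + 2\<close> of the exponential series of 1 / y. Two spare
  powers of \<open>y\<close> leave one after division by the increment, which gives the derivative 0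
  at the origin in \<open>DERIV_bmp\<close>.\<close>

lemma bmp_bound:
  fixes y :: real
  assumes "y > 0" shows "exp (- 1 / y) / y ^ m \<le> fact (m + 2) * y\<^sup>2"
proof -
  obtain n where n: "n = m + 2" by blast
  have "(\<Sum>i\<in>{n}. (1 / y) ^ i /\<^sub>R fact i) \<le> exp (1 / y)"
    unfolding exp_def by (rule sum_le_suminf[OF summable_exp_generic]) (use assms in auto)
  then have "1 \<le> exp (1 / y) * fact n * y ^ n"
    using assms by (simp add: field_simps)
  then have "exp (- 1 / y) * 1 \<le> exp (- 1 / y) * (exp (1 / y) * fact n * y ^ n)"
    by (intro mult_left_mono) auto
  also have "\<dots> = fact n * y ^ n"
    by (simp flip: exp_add mult.assoc)
  also have "y ^ n = y\<^sup>2 * y ^ m" by (simp add: n power_add power2_eq_square)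
  finally show ?thesis unfolding n[symmetric] using assms by (simp add: field_simps)
qed

lemma DERIV_bmp: "(bmp m has_real_derivative (bmp (m + 2) y - real m * bmp (m + 1) y)) (at y)"
proof -
  consider "y > 0" | "y < 0" | "y = 0" by linarith
  then show ?thesis
  proof cases
    case 1
    have "((\<lambda>y. exp (- 1 / y) / y ^ m) has_real_derivative (bmp (m + 2) y - real m * bmp (m + 1) y)) (at y)"
      using 1 by (auto intro!: derivative_eq_intros simp: bmp_def)
        (cases m; simp add: field_simps power_add power2_eq_square)
    then show ?thesis
      by (rule has_field_derivative_transform_within_open[of _ _ _ "{0<..}"]) (use 1 in \<open>auto simp: bmp_def\<close>)
  next
    case 2
    have "((\<lambda>y. 0) has_real_derivative (bmp (m + 2) y - real m * bmp (m + 1) y)) (at y)"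
      using 2 by (auto simp: bmp_def)
    then show ?thesis
      by (rule has_field_derivative_transform_within_open[of _ _ _ "{..<0}"]) (use 2 in \<open>auto simp: bmp_def\<close>)
  next
    case 3
    define K :: real where "K = fact (m + 2)"
    have "((\<lambda>h. (bmp m (0 + h) - bmp m 0) / h) \<longlongrightarrow> 0) (at 0)"
    proof (rule Lim_null_comparison)
      show "\<forall>\<^sub>F h in at 0. norm ((bmp m (0 + h) - bmp m 0) / h) \<le> K * \<bar>h\<bar>"
      proof (rule always_eventually, rule allI)
        fix h :: real
        have K: "K \<ge> 0" by (simp add: K_def)
        show "norm ((bmp m (0 + h) - bmp m 0) / h) \<le> K * \<bar>h\<bar>"
        proof (cases "h > 0")
          case True
          have "exp (- 1 / h) / h ^ m / h \<le> K * h\<^sup>2 / h"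
            unfolding K_def using True by (intro divide_right_mono bmp_bound) auto
          with True show ?thesis by (simp add: bmp_def power2_eq_square)
        next
          case False
          have "0 \<le> K * \<bar>h\<bar>" using K by simp
          with False show ?thesis by (simp add: bmp_def)
        qed
      qed
      show "((\<lambda>h. K * \<bar>h\<bar>) \<longlongrightarrow> 0) (at (0::real))"
        by (rule tendsto_eq_intros refl)+ simp
    qed
    then show ?thesis using 3 by (simp add: DERIV_def bmp_def)
  qed
qed

text \<open>The powers of \<open>r\<close> and the index \<open>m\<close> are what differentiation
  produces, so \<open>bumps_deriv\<close> stays inside the class. All members vanish outside the
  interval from -1 to 1.\<close>

inductive_set bumps :: "(real \<Rightarrow> real) set" where
  base: "(\<lambda>r. c * r ^ j * bmp m (1 - r\<^sup>2)) \<in> bumps"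
| add: "f \<in> bumps \<Longrightarrow> g \<in> bumps \<Longrightarrow> (\<lambda>r. f r + g r) \<in> bumps"

lemma bumps_deriv: "f \<in> bumps \<Longrightarrow> \<exists>f'\<in>bumps. \<forall>r. (f has_real_derivative f' r) (at r)"
proof (induction rule: bumps.induct)
  case (base c j m)
  let ?f' = "\<lambda>r. (c * real j * r ^ (j - 1) * bmp m (1 - r\<^sup>2) + (- 2 * c) * r ^ (j + 1) * bmp (m + 2) (1 - r\<^sup>2))
      + (2 * c * real m) * r ^ (j + 1) * bmp (m + 1) (1 - r\<^sup>2)"
  have "?f' \<in> bumps" by (intro bumps.intros)
  moreover have "((\<lambda>r. c * r ^ j * bmp m (1 - r\<^sup>2)) has_real_derivative ?f' r) (at r)" for r
  proof -
    have 1: "((\<lambda>r. c * r ^ j) has_real_derivative c * (real j * r ^ (j - 1))) (at r)"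
      by (auto intro!: derivative_eq_intros)
    have "((\<lambda>r. 1 - r\<^sup>2) has_real_derivative (- 2 * r)) (at r)"
      by (auto intro!: derivative_eq_intros)
    from DERIV_chain2[OF DERIV_bmp this] have 2: "((\<lambda>r. bmp m (1 - r\<^sup>2)) has_real_derivative
        (bmp (m + 2) (1 - r\<^sup>2) - real m * bmp (m + 1) (1 - r\<^sup>2)) * (- 2 * r)) (at r)" .
    show ?thesis
      by (rule DERIV_cong[OF DERIV_mult[OF 1 2]]) (simp add: algebra_simps)
  qed
  ultimately show ?case by (intro bexI[of _ ?f'] allI)
next
  case (add f g)
  then obtain f' g' where "f' \<in> bumps" "\<forall>r. (f has_real_derivative f' r) (at r)"
    "g' \<in> bumps" "\<forall>r. (g has_real_derivative g' r) (at r)" by blast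
  then show ?case
    by (intro bexI[of _ "\<lambda>r. f' r + g' r"] allI DERIV_add bumps.add) auto
qed

lemma bumps_zero: "f \<in> bumps \<Longrightarrow> \<bar>r\<bar> \<ge> 1 \<Longrightarrow> f r = 0"
proof (induction rule: bumps.induct)
  case (base c j m)
  then have "r\<^sup>2 \<ge> 1" using power_mono[of 1 "\<bar>r\<bar>" 2] by simp
  then show ?case by (simp add: bmp_def)
qed simp

lemma bumps_continuous: "f \<in> bumps \<Longrightarrow> continuous_on S f"
proof -
  assume "f \<in> bumps"
  then obtain f' where "\<And>r. (f has_real_derivative f' r) (at r)" using bumps_deriv by blast
  then show ?thesis by (rule DERIV_continuous_on[OF has_field_derivative_at_within])
qed

lemma bumps_bounded:
  assumes "f \<in> bumps"
  obtains B where "B \<ge> 0" "\<And>r. \<bar>f r\<bar> \<le> B"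
proof -
  have "bounded (f ` {-1..1})"
    by (intro compact_imp_bounded compact_continuous_image bumps_continuous assms) simp
  then obtain B where "\<forall>x\<in>f ` {-1..1}. norm x \<le> B"
    unfolding bounded_iff by blast
  then have B: "\<bar>f r\<bar> \<le> B" if "r \<in> {-1..1}" for r using that by simp
  have "\<bar>f r\<bar> \<le> max B 0" for r
  proof (cases "\<bar>r\<bar> \<ge> 1")
    case False
    then have "r \<in> {-1..1}" by auto
    from B[OF this] show ?thesis by linarith
  qed (simp add: bumps_zero[OF assms])
  then show ?thesis using that[of "max B 0"] by simp
qed

section \<open>Products of bumps\<close>

lemma prod_bumps_bounded:
  fixes h :: "'n::finite \<Rightarrow> real \<Rightarrow> real"
  assumes "\<And>i. h i \<in> bumps"
  obtains B where "B \<ge> 0" "\<And>x :: real^'n. \<bar>\<Prod>i\<in>UNIV. h i (x $ i)\<bar> \<le> B"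
proof -
  have "\<forall>i. \<exists>B\<ge>0. \<forall>r. \<bar>h i r\<bar> \<le> B" using bumps_bounded[OF assms] by metis
  then obtain B where B: "\<And>i. B i \<ge> 0" "\<And>i r. \<bar>h i r\<bar> \<le> B i" by metis
  show ?thesis
  proof
    show "(\<Prod>i\<in>UNIV. B i) \<ge> 0" by (intro prod_nonneg B) 
    show "\<bar>\<Prod>i\<in>UNIV. h i (x $ i)\<bar> \<le> (\<Prod>i\<in>UNIV. B i)" for x :: "real^'n"
      unfolding abs_prod by (intro prod_mono) (use B in auto)
  qed
qed

lemma prod_bumps_lipschitz:
  fixes h :: "'n::finite \<Rightarrow> real \<Rightarrow> real"
  assumes h: "\<And>i. h i \<in> bumps"
  obtains C where "C \<ge> 0" "\<And>x y :: real^'n. \<bar>(\<Prod>i\<in>UNIV. h i (x $ i)) - (\<Prod>i\<in>UNIV. h i (y $ i))\<bar> \<le> C * norm (x - y)"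
proof -
  obtain h' where h': "\<And>i. h' i \<in> bumps" "\<And>i r. (h i has_real_derivative h' i r) (at r)"
    using bumps_deriv[OF h] by metis
  have "\<forall>i. \<exists>B\<ge>0. \<forall>x::real^'n. \<bar>\<Prod>j\<in>UNIV. (h(i := h' i)) j (x $ j)\<bar> \<le> B"
  proof
    fix i
    have hb: "(h(i := h' i)) j \<in> bumps" for j using h h' by simp
    show "\<exists>B\<ge>0. \<forall>x::real^'n. \<bar>\<Prod>j\<in>UNIV. (h(i := h' i)) j (x $ j)\<bar> \<le> B"
      using prod_bumps_bounded[of "h(i := h' i)", OF hb] by metis
  qed
  then obtain B where B: "\<And>i. B i \<ge> 0" "\<And>i (x::real^'n). \<bar>\<Prod>j\<in>UNIV. (h(i := h' i)) j (x $ j)\<bar> \<le> B i" by metis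
  define D where "D = (\<lambda>(x::real^'n) v. \<Sum>i\<in>UNIV. v $ i * (\<Prod>j\<in>UNIV. (h(i := h' i)) j (x $ j)))"
  have der: "((\<lambda>x. \<Prod>i\<in>UNIV. h i (x $ i)) has_derivative D x) (at x)" for x :: "real^'n"
    unfolding D_def by (rule has_derivative_prod_vec) (rule h')
  have on: "onorm (D x) \<le> (\<Sum>i\<in>UNIV. B i)" for x
  proof (rule onorm_bound)
    show "0 \<le> (\<Sum>i\<in>UNIV. B i)" by (intro sum_nonneg B)
    fix v :: "real^'n"
    have "norm (D x v) \<le> (\<Sum>i\<in>UNIV. norm v * B i)"
      unfolding D_def real_norm_def
      by (intro order_trans[OF sum_abs] sum_mono)
         (use B component_le_norm_cart in \<open>auto simp: abs_mult intro!: mult_mono\<close>)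
    then show "norm (D x v) \<le> (\<Sum>i\<in>UNIV. B i) * norm v"
      by (simp add: sum_distrib_left mult.commute)
  qed
  show ?thesis
  proof
    show "(\<Sum>i\<in>UNIV. B i) \<ge> 0" by (intro sum_nonneg B)
    fix x y :: "real^'n"
    show "\<bar>(\<Prod>i\<in>UNIV. h i (x $ i)) - (\<Prod>i\<in>UNIV. h i (y $ i))\<bar> \<le> (\<Sum>i\<in>UNIV. B i) * norm (x - y)"
      using differentiable_bound[OF convex_UNIV der on, of x y] by simp
  qed
qed

text \<open>Mean value theorem in \<open>s\<close> for the increment in \<open>y\<close>: its
  derivative is an increment of a partial derivative, which is again a product of bumps and hence
  Lipschitz. The product of both increments is what preserves the factor
  \<open>\<bar>x $ k\<bar>\<close> in \<open>heat_datum_near\<close>.\<close>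

lemma prod_bumps_mixed_difference:
  fixes h :: "'n::finite \<Rightarrow> real \<Rightarrow> real"
  assumes h: "\<And>i. h i \<in> bumps"
  defines "F \<equiv> \<lambda>x :: real^'n. \<Prod>i\<in>UNIV. h i (x $ i)"
  obtains C where "C \<ge> 0"
    "\<And>x y s. \<bar>(F (x + s *\<^sub>R axis k 1 + y) - F (x + s *\<^sub>R axis k 1)) - (F (x + y) - F x)\<bar> \<le> C * \<bar>s\<bar> * norm y"
proof -
  obtain h' where h': "\<And>i. h' i \<in> bumps" "\<And>i r. (h i has_real_derivative h' i r) (at r)"
    using bumps_deriv[OF h] by metis
  define F' where "F' = (\<lambda>x :: real^'n. \<Prod>j\<in>UNIV. (h(k := h' k)) j (x $ j))"
  have hb: "(h(k := h' k)) j \<in> bumps" for j using h h' by simp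
  obtain C where C: "C \<ge> 0" "\<And>x y. \<bar>F' x - F' y\<bar> \<le> C * norm (x - y)"
    using prod_bumps_lipschitz[of "h(k := h' k)", OF hb] unfolding F'_def by metis
  have der: "((\<lambda>s. F (p + s *\<^sub>R axis k 1)) has_real_derivative F' (p + s *\<^sub>R axis k 1)) (at s)" for p s
  proof -
    have "((\<lambda>s. p + s *\<^sub>R axis k 1) has_derivative (\<lambda>r. r *\<^sub>R axis k 1)) (at s)"
      by (auto intro!: derivative_eq_intros)
    from has_derivative_compose[OF this has_derivative_prod_vec[of h h' "p + s *\<^sub>R axis k 1", OF h'(2)]]
    have "((\<lambda>s. F (p + s *\<^sub>R axis k 1)) has_derivative
       (\<lambda>r. \<Sum>i\<in>UNIV. (r *\<^sub>R axis k 1) $ i * (\<Prod>j\<in>UNIV. (h(i := h' i)) j ((p + s *\<^sub>R axis k 1) $ j)))) (at s)"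
      unfolding F_def .
    moreover have "(\<Sum>i\<in>UNIV. (r *\<^sub>R axis k 1) $ i * (\<Prod>j\<in>UNIV. (h(i := h' i)) j ((p + s *\<^sub>R axis k 1) $ j)))
        = F' (p + s *\<^sub>R axis k 1) * r" for r
    proof -
      have "(\<Sum>i\<in>UNIV. (r *\<^sub>R axis k 1) $ i * (\<Prod>j\<in>UNIV. (h(i := h' i)) j ((p + s *\<^sub>R axis k 1) $ j)))
        = (\<Sum>i\<in>UNIV. if i = k then r * F' (p + s *\<^sub>R axis k 1) else 0)"
        by (rule sum.cong) (auto simp: axis_def F'_def)
      then show ?thesis by simp
    qed
    ultimately show ?thesis by (simp add: has_field_derivative_def)
  qed
  show ?thesis
  proof
    show "C \<ge> 0" by fact
    fix x y :: "real^'n" and s :: real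
    let ?g = "\<lambda>s. F ((x + y) + s *\<^sub>R axis k 1) - F (x + s *\<^sub>R axis k 1)"
    have "norm (?g s - ?g 0) \<le> (C * norm y) * norm (s - 0)"
    proof (rule field_differentiable_bound[where S=UNIV])
      show "(?g has_field_derivative (F' ((x + y) + r *\<^sub>R axis k 1) - F' (x + r *\<^sub>R axis k 1))) (at r within UNIV)" for r
        by (intro DERIV_diff der)
      show "norm (F' ((x + y) + r *\<^sub>R axis k 1) - F' (x + r *\<^sub>R axis k 1)) \<le> C * norm y" for r
        using C(2)[of "(x + y) + r *\<^sub>R axis k 1" "x + r *\<^sub>R axis k 1"] by simp
    qed auto
    then show "\<bar>(F (x + s *\<^sub>R axis k 1 + y) - F (x + s *\<^sub>R axis k 1)) - (F (x + y) - F x)\<bar> \<le> C * \<bar>s\<bar> * norm y"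
      by (simp add: algebra_simps)
  qed
qed

lemma prod_bumps_Cc_infty:
  fixes h :: "'n::finite \<Rightarrow> real \<Rightarrow> real"
  assumes h: "\<And>i. h i \<in> bumps"
  shows "(\<lambda>x :: real^'n. complex_of_real (\<Prod>i\<in>UNIV. h i (x $ i))) \<in> Cc_infty"
proof -
  define P where "P = {\<lambda>x :: real^'n. complex_of_real (\<Prod>i\<in>UNIV. h i (x $ i)) | h. \<forall>i. h i \<in> bumps}"
  have der: "f differentiable_on UNIV \<and> partial_deriv k f \<in> P" if fP: "f \<in> P" for f k
  proof -
    obtain h where f: "f = (\<lambda>x. complex_of_real (\<Prod>i\<in>UNIV. h i (x $ i)))" "\<And>i. h i \<in> bumps"
      using fP unfolding P_def by blast
    obtain h' where h': "\<And>i. h' i \<in> bumps" "\<And>i r. (h i has_real_derivative h' i r) (at r)"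
      using bumps_deriv[OF f(2)] by metis
    define D where "D = (\<lambda>(x::real^'n) v. complex_of_real (\<Sum>i\<in>UNIV. v $ i * (\<Prod>j\<in>UNIV. (h(i := h' i)) j (x $ j))))"
    have der: "(f has_derivative D x) (at x)" for x
      unfolding f D_def by (intro has_derivative_of_real has_derivative_prod_vec h')
    have "D x (axis k 1) = complex_of_real (\<Prod>j\<in>UNIV. (h(k := h' k)) j (x $ j))" for x
    proof -
      have "(\<Sum>i\<in>UNIV. (axis k 1 :: real^'n) $ i * (\<Prod>j\<in>UNIV. (h(i := h' i)) j (x $ j)))
         = (\<Sum>i\<in>UNIV. if i = k then (\<Prod>j\<in>UNIV. (h(k := h' k)) j (x $ j)) else 0)"
        by (rule sum.cong) (auto simp: axis_def)
      also have "\<dots> = (\<Prod>j\<in>UNIV. (h(k := h' k)) j (x $ j))"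
        by (simp only: sum.delta[OF finite] UNIV_I if_True)
      finally show ?thesis unfolding D_def by (rule arg_cong)
    qed
    then have "partial_deriv k f = (\<lambda>x. complex_of_real (\<Prod>j\<in>UNIV. (h(k := h' k)) j (x $ j)))"
      using partial_deriv_eq[OF der] by simp
    moreover have "(\<lambda>x. complex_of_real (\<Prod>j\<in>UNIV. (h(k := h' k)) j (x $ j))) \<in> P"
      unfolding P_def using f(2) h'(1) by (intro CollectI exI[of _ "h(k := h' k)"]) simp
    moreover have "f differentiable_on UNIV"
      using der by (auto simp: differentiable_on_def differentiable_def)
    ultimately show ?thesis by simp
  qed
  let ?f = "\<lambda>x :: real^'n. complex_of_real (\<Prod>i\<in>UNIV. h i (x $ i))"
  have "?f \<in> P" unfolding P_def using h by blast
  then have "smooth ?f" by (rule smooth_if_closed_class) (simp_all only: der)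
  moreover have "compact (closure {x. ?f x \<noteq> 0})"
  proof -
    have "{x. ?f x \<noteq> 0} \<subseteq> cbox (- 1) 1"
    proof
      fix x assume "x \<in> {x. ?f x \<noteq> 0}"
      then have "h i (x $ i) \<noteq> 0" for i by simp
      then have "\<bar>x $ i\<bar> \<le> 1" for i using bumps_zero[OF h] by (meson linear)
      then show "x \<in> cbox (- 1) 1" by (auto simp: mem_box_cart abs_le_iff minus_le_iff)
    qed
    then show ?thesis by (meson bounded_cbox bounded_subset compact_closure)
  qed
  ultimately show ?thesis by (simp add: Cc_infty_def)
qed

section \<open>Test functions\<close>

lemma prod_if_eq_UNIV: "(\<Prod>i\<in>UNIV. if i = k then a else b) = a * b ^ (CARD('n) - 1)"
  for k :: "'n::finite" and a b :: "'a::comm_monoid_mult"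
proof -
  have "(\<Prod>i\<in>UNIV. if i = k then a else b) = a * (\<Prod>i\<in>UNIV - {k}. if i = k then a else b)"
    by (subst prod.remove[of _ k]) auto
  also have "(\<Prod>i\<in>UNIV - {k}. if i = k then a else b) = (\<Prod>i\<in>UNIV - {k}. b)"
    by (rule prod.cong) auto
  finally show ?thesis by (simp add: card_Diff_singleton)
qed

section \<open>The probes and their Fourier transforms\<close>

lemma quint1_measurable [measurable]: "quint1 a \<in> borel_measurable borel"
  unfolding quint1_def[abs_def] by measurable

text \<open>Deliberately crude in \<open>a\<close>: it serves integrability only, while all rates in
  \<open>a\<close> come from scaling.\<close>

lemma abs_quint1_le:
  assumes a: "a > 0"
  shows "\<bar>quint1 a r\<bar> \<le> (15 / 4 + 5 / 4 / a + 1 / 16 / a\<^sup>2) / (a ^ 3 * sqrt a) * ((1 + \<bar>r\<bar>) ^ 5 * exp (- (1 / (4 * a)) * r\<^sup>2))"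
proof -
  have r: "\<bar>r\<bar> ^ m \<le> (1 + \<bar>r\<bar>) ^ 5" if "m \<le> 5" for m
    using power_mono[of "\<bar>r\<bar>" "1 + \<bar>r\<bar>" m] power_increasing[OF that, of "1 + \<bar>r\<bar>"] by simp
  have "\<bar>r * (15 / 4 - 5 / 4 * (r\<^sup>2 / a) + 1 / 16 * (r\<^sup>2 / a)\<^sup>2)\<bar>
      = \<bar>15 / 4 * r - 5 / 4 / a * r ^ 3 + 1 / 16 / a\<^sup>2 * r ^ 5\<bar>"
    by (simp add: algebra_simps power_divide eval_nat_numeral)
  also have "\<dots> \<le> 15 / 4 * \<bar>r\<bar> + 5 / 4 / a * \<bar>r\<bar> ^ 3 + 1 / 16 / a\<^sup>2 * \<bar>r\<bar> ^ 5"
  proof -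
    have "\<bar>x - y + z\<bar> \<le> \<bar>x\<bar> + \<bar>y\<bar> + \<bar>z\<bar>" for x y z :: real by linarith
    from this[of "15 / 4 * r" "5 / 4 / a * r ^ 3" "1 / 16 / a\<^sup>2 * r ^ 5"] show ?thesis
      using a by (simp add: abs_mult power_abs)
  qed
  also have "\<dots> \<le> 15 / 4 * (1 + \<bar>r\<bar>) ^ 5 + 5 / 4 / a * (1 + \<bar>r\<bar>) ^ 5 + 1 / 16 / a\<^sup>2 * (1 + \<bar>r\<bar>) ^ 5"
    using a r[of 1] r[of 3] r[of 5] by (intro add_mono mult_left_mono) auto
  also have "\<dots> = (15 / 4 + 5 / 4 / a + 1 / 16 / a\<^sup>2) * (1 + \<bar>r\<bar>) ^ 5"
    by (simp add: algebra_simps)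
  finally have "\<bar>r * (15 / 4 - 5 / 4 * (r\<^sup>2 / a) + 1 / 16 * (r\<^sup>2 / a)\<^sup>2)\<bar> * (exp (- (1 / (4 * a)) * r\<^sup>2) / (a ^ 3 * sqrt a))
     \<le> (15 / 4 + 5 / 4 / a + 1 / 16 / a\<^sup>2) * (1 + \<bar>r\<bar>) ^ 5 * (exp (- (1 / (4 * a)) * r\<^sup>2) / (a ^ 3 * sqrt a))"
    using a by (intro mult_right_mono) auto
  moreover have "\<bar>quint1 a r\<bar> = \<bar>r * (15 / 4 - 5 / 4 * (r\<^sup>2 / a) + 1 / 16 * (r\<^sup>2 / a)\<^sup>2)\<bar> * (exp (- (1 / (4 * a)) * r\<^sup>2) / (a ^ 3 * sqrt a))"
    using a by (simp add: quint1_def abs_mult)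
  ultimately show ?thesis by (simp add: mult_ac)
qed

lemma integrable_quint1: "integrable lborel (quint1 a)" if "a > 0"
proof (rule integrable_gauss_le)
  show "1 / (4 * a) > 0" using that by simp
  show "norm (quint1 a r) \<le> (15 / 4 + 5 / 4 / a + 1 / 16 / a\<^sup>2) / (a ^ 3 * sqrt a) *
      ((1 + \<bar>r\<bar>) ^ 5 * exp (- (1 / (4 * a)) * r\<^sup>2))" for r
    using abs_quint1_le[OF that, of r] by simp
qed simp

text \<open>Both time parameters advance by the same \<tau>. The tangential one starts at 1, so only
  the normal factor degenerates as \<epsilon> and \<tau> tend to 0.\<close>

definition probe :: "'n::finite \<Rightarrow> real \<Rightarrow> real \<Rightarrow> real^'n \<Rightarrow> real" where
  "probe k \<epsilon> \<tau> x = (\<Prod>i\<in>UNIV. (if i = k then quint1 (\<epsilon> + \<tau>) (x $ i) else gauss1 (1 + \<tau>) (x $ i)))"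

definition probe_hat :: "'n::finite \<Rightarrow> real \<Rightarrow> real \<Rightarrow> real^'n \<Rightarrow> real" where
  "probe_hat k \<epsilon> \<tau> x = (\<Prod>i\<in>UNIV. (if i = k then (x $ i) ^ 5 * exp (- (\<epsilon> + \<tau>) * (x $ i)\<^sup>2)
      else exp (- (1 + \<tau>) * (x $ i)\<^sup>2)))"

lemma probe_measurable [measurable]:
  fixes k :: "'n::finite" shows "probe k \<epsilon> \<tau> \<in> borel_measurable borel"
proof -
  have "(\<lambda>x::real^'n. if i = k then quint1 (\<epsilon> + \<tau>) (x $ i) else gauss1 (1 + \<tau>) (x $ i)) \<in> borel_measurable borel"
    for i k :: 'n by (cases "i = k") simp_all
  then show ?thesis unfolding probe_def[abs_def] by measurable
qed

lemma probe_hat_measurable [measurable]: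
  fixes k :: "'n::finite" shows "probe_hat k \<epsilon> \<tau> \<in> borel_measurable borel"
proof -
  have "(\<lambda>x::real^'n. if i = k then (x $ i) ^ 5 * exp (- (\<epsilon> + \<tau>) * (x $ i)\<^sup>2)
      else exp (- (1 + \<tau>) * (x $ i)\<^sup>2)) \<in> borel_measurable borel"
    for i k :: 'n by (cases "i = k") simp_all
  then show ?thesis unfolding probe_hat_def[abs_def] by measurable
qed

text \<open>The semigroup law on the Fourier side: advancing \<tau> multiplies by the transform of
  the heat kernel, equally in all coordinates.\<close>

lemma probe_hat_add: "probe_hat k \<epsilon> (\<tau> + t) x = probe_hat k \<epsilon> \<tau> x * exp (- t * (norm x)\<^sup>2)"
proof -
  have "exp (- t * (norm x)\<^sup>2) = (\<Prod>i\<in>UNIV. exp (- t * (x $ i)\<^sup>2))"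
    by (simp add: norm_vec_power2 sum_distrib_left sum_negf[symmetric] exp_sum[symmetric])
  then show ?thesis
    unfolding probe_hat_def
    by (simp flip: prod.distrib) (auto intro!: prod.cong simp: algebra_simps simp flip: exp_add)
qed

lemma exp_inner_prod: "exp (c * of_real (x \<bullet> y)) = (\<Prod>i\<in>UNIV. exp (c * of_real (x $ i * y $ i)))"
  for x y :: "real^'n::finite" and c :: complex
  by (simp add: inner_vec_def sum_distrib_left exp_sum)

lemma integrable_probe:
  assumes "\<epsilon> > 0" "\<tau> \<ge> 0" shows "integrable lborel (probe k \<epsilon> \<tau>)"
proof -
  have "integrable lborel (\<lambda>r. if i = k then quint1 (\<epsilon> + \<tau>) r else gauss1 (1 + \<tau>) r)" for i
    using assms by (cases "i = k") (simp_all add: integrable_quint1 integrable_gauss1)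
  from integrable_prod_vec[OF this] show ?thesis by (simp add: probe_def[abs_def])
qed

lemma
  assumes "a > 0"
  shows integrable_gauss_real: "integrable lborel (\<lambda>r::real. exp (- a * r\<^sup>2))"
    and integrable_gauss_pow5: "integrable lborel (\<lambda>r::real. r ^ 5 * exp (- a * r\<^sup>2))"
proof -
  show "integrable lborel (\<lambda>r::real. exp (- a * r\<^sup>2))"
    by (rule integrable_gauss_le[OF assms, of _ 1 0]) auto
  show "integrable lborel (\<lambda>r::real. r ^ 5 * exp (- a * r\<^sup>2))"
  proof (rule integrable_gauss_le[OF assms, of _ 1 5])
    fix r :: real
    have "\<bar>r\<bar> ^ 5 \<le> (1 + \<bar>r\<bar>) ^ 5" by (intro power_mono) auto
    then show "norm (r ^ 5 * exp (- a * r\<^sup>2)) \<le> 1 * ((1 + \<bar>r\<bar>) ^ 5 * exp (- a * r\<^sup>2))"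
      by (simp add: abs_mult power_abs)
  qed auto
qed

lemma integrable_probe_hat:
  assumes "\<epsilon> > 0" "\<tau> \<ge> 0" shows "integrable lborel (probe_hat k \<epsilon> \<tau>)"
proof -
  have "integrable lborel (\<lambda>r. if i = k then r ^ 5 * exp (- (\<epsilon> + \<tau>) * r\<^sup>2) else exp (- (1 + \<tau>) * r\<^sup>2))" for i
    using integrable_gauss_real[of "1 + \<tau>"] integrable_gauss_pow5[of "\<epsilon> + \<tau>"] assms by (cases "i = k") simp_all
  from integrable_prod_vec[OF this] show ?thesis by (simp add: probe_hat_def[abs_def])
qed

lemma integrable_char_times:
  fixes g :: "real \<Rightarrow> real"
  assumes "integrable lborel g"
  shows "integrable lborel (\<lambda>r. of_real (g r) * exp (\<i> * of_real (r * s)))"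
    "integrable lborel (\<lambda>r. of_real (g r) * exp (- \<i> * of_real (s * r)))"
  by (rule integrable_bounded_times[where B=1, OF assms]; simp)+

lemma probe_fourier:
  assumes "\<epsilon> > 0" "\<tau> \<ge> 0"
  shows "(LINT x|lborel. exp (\<i> * of_real (\<xi> \<bullet> x)) * of_real (probe k \<epsilon> \<tau> x))
    = 4 * \<i> * of_real (sqrt pi) * complex_of_real (probe_hat k \<epsilon> \<tau> \<xi>)"
proof -
  define G where "G = (\<lambda>i r. if i = k then quint1 (\<epsilon> + \<tau>) r else gauss1 (1 + \<tau>) r)"
  have G: "integrable lborel (G i)" for i
    unfolding G_def using assms by (cases "i = k") (simp_all add: integrable_quint1 integrable_gauss1)
  have "exp (\<i> * of_real (\<xi> \<bullet> x)) * of_real (probe k \<epsilon> \<tau> x)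
      = (\<Prod>i\<in>UNIV. of_real (G i (x $ i)) * exp (\<i> * of_real (x $ i * \<xi> $ i)))" for x
    unfolding exp_inner_prod probe_def G_def of_real_prod prod.distrib[symmetric]
    by (rule prod.cong) (auto simp: mult_ac)
  then have "(LINT x|lborel. exp (\<i> * of_real (\<xi> \<bullet> x)) * of_real (probe k \<epsilon> \<tau> x))
      = (\<Prod>i\<in>UNIV. LINT r|lborel. of_real (G i r) * exp (\<i> * of_real (r * \<xi> $ i)))"
    using integral_prod_vec[where f="\<lambda>i r. complex_of_real (G i r) * exp (\<i> * of_real (r * \<xi> $ i))",
        OF integrable_char_times(1)[OF G]] by simp
  also have "\<dots> = (\<Prod>i\<in>UNIV. (if i = k then 4 * \<i> * of_real (sqrt pi) else 1) *
      complex_of_real (if i = k then (\<xi> $ i) ^ 5 * exp (- (\<epsilon> + \<tau>) * (\<xi> $ i)\<^sup>2) else exp (- (1 + \<tau>) * (\<xi> $ i)\<^sup>2)))"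
  proof (rule prod.cong[OF refl])
    fix i
    show "(LINT r|lborel. of_real (G i r) * exp (\<i> * of_real (r * \<xi> $ i))) = (if i = k then 4 * \<i> * of_real (sqrt pi) else 1) *
      complex_of_real (if i = k then (\<xi> $ i) ^ 5 * exp (- (\<epsilon> + \<tau>) * (\<xi> $ i)\<^sup>2) else exp (- (1 + \<tau>) * (\<xi> $ i)\<^sup>2))"
      using quint1_fourier[of "\<epsilon> + \<tau>" "\<xi> $ i"] gauss1_fourier[of "1 + \<tau>" "\<xi> $ i"] assms
      by (cases "i = k") (simp_all only: G_def if_True if_False refl, simp_all)
  qed
  also have "\<dots> = 4 * \<i> * of_real (sqrt pi) * complex_of_real (probe_hat k \<epsilon> \<tau> \<xi>)"
    unfolding prod.distrib prod_if_eq_UNIV probe_hat_def of_real_prod by simp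
  finally show ?thesis .
qed

text \<open>The constant of \<open>quint1_inv_fourier\<close> for the normal coordinate times 2 pi
  for each tangential one.\<close>

definition probe_const :: "'n::finite itself \<Rightarrow> complex" where
  "probe_const _ = - (\<i> * of_real (sqrt pi / 2)) * of_real ((2 * pi) ^ (CARD('n) - 1))"

lemma probe_inv_fourier:
  fixes x :: "real^'n::finite"
  assumes "\<epsilon> > 0" "\<tau> \<ge> 0"
  shows "(LINT \<xi>|lborel. exp (- \<i> * of_real (\<xi> \<bullet> x)) * of_real (probe_hat k \<epsilon> \<tau> \<xi>))
    = probe_const TYPE('n) * complex_of_real (probe k \<epsilon> \<tau> x)"
proof -
  define G where "G = (\<lambda>i r. if i = k then r ^ 5 * exp (- (\<epsilon> + \<tau>) * r\<^sup>2) else exp (- (1 + \<tau>) * r\<^sup>2))"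
  have G: "integrable lborel (G i)" for i
    unfolding G_def using integrable_gauss_real[of "1 + \<tau>"] integrable_gauss_pow5[of "\<epsilon> + \<tau>"] assms
    by (cases "i = k") simp_all
  have "exp (- \<i> * of_real (\<xi> \<bullet> x)) * of_real (probe_hat k \<epsilon> \<tau> \<xi>)
      = (\<Prod>i\<in>UNIV. of_real (G i (\<xi> $ i)) * exp (- \<i> * of_real (x $ i * \<xi> $ i)))" for \<xi>
    unfolding exp_inner_prod probe_hat_def G_def of_real_prod prod.distrib[symmetric]
    by (rule prod.cong) (auto simp: mult_ac)
  then have "(LINT \<xi>|lborel. exp (- \<i> * of_real (\<xi> \<bullet> x)) * of_real (probe_hat k \<epsilon> \<tau> \<xi>))
      = (\<Prod>i\<in>UNIV. LINT r|lborel. of_real (G i r) * exp (- \<i> * of_real (x $ i * r)))"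
    using integral_prod_vec[where f="\<lambda>i r. complex_of_real (G i r) * exp (- \<i> * of_real (x $ i * r))",
        OF integrable_char_times(2)[OF G]] by simp
  also have "\<dots> = (\<Prod>i\<in>UNIV. (if i = k then - (\<i> * of_real (sqrt pi / 2)) else of_real (2 * pi)) *
      complex_of_real (if i = k then quint1 (\<epsilon> + \<tau>) (x $ i) else gauss1 (1 + \<tau>) (x $ i)))"
  proof (rule prod.cong[OF refl])
    fix i
    show "(LINT r|lborel. of_real (G i r) * exp (- \<i> * of_real (x $ i * r))) =
      (if i = k then - (\<i> * of_real (sqrt pi / 2)) else of_real (2 * pi)) *
      complex_of_real (if i = k then quint1 (\<epsilon> + \<tau>) (x $ i) else gauss1 (1 + \<tau>) (x $ i))"
      using quint1_inv_fourier[of "\<epsilon> + \<tau>" "x $ i"] gauss1_inv_fourier[of "1 + \<tau>" "x $ i"] assms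
      by (cases "i = k") (simp_all only: G_def if_True if_False refl, simp_all)
  qed
  also have "\<dots> = probe_const TYPE('n) * complex_of_real (probe k \<epsilon> \<tau> x)"
    unfolding prod.distrib prod_if_eq_UNIV probe_def of_real_prod probe_const_def by simp
  finally show ?thesis .
qed

section \<open>The heat semigroup acting on probes\<close>

lemma heat_kernel_fourier:
  fixes \<xi> :: "real^'n::finite"
  assumes "t > 0"
  shows "(LINT x|lborel. of_real (heat_kernel t x) * exp (\<i> * of_real (\<xi> \<bullet> x))) = complex_of_real (exp (- t * (norm \<xi>)\<^sup>2))"
proof -
  have "of_real (heat_kernel t x) * exp (\<i> * of_real (\<xi> \<bullet> x))
      = (\<Prod>i\<in>UNIV. of_real (gauss1 t (x $ i)) * exp (\<i> * of_real (x $ i * \<xi> $ i)))" for x :: "real^'n"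
    unfolding exp_inner_prod heat_kernel_prod[OF assms] of_real_prod prod.distrib[symmetric]
    by (rule prod.cong) (auto simp: mult_ac)
  then have "(LINT x|lborel. of_real (heat_kernel t x) * exp (\<i> * of_real (\<xi> \<bullet> x)))
      = (\<Prod>i\<in>UNIV. LINT r|lborel. of_real (gauss1 t r) * exp (\<i> * of_real (r * \<xi> $ i)))"
    using integral_prod_vec[where f="\<lambda>i r. complex_of_real (gauss1 t r) * exp (\<i> * of_real (r * \<xi> $ i))",
        OF integrable_char_times(1)[OF integrable_gauss1[OF assms]]] by simp
  also have "\<dots> = (\<Prod>i\<in>UNIV. complex_of_real (exp (- t * (\<xi> $ i)\<^sup>2)))"
    by (simp only: gauss1_fourier[OF assms])
  also have "\<dots> = complex_of_real (exp (- t * (norm \<xi>)\<^sup>2))"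
    by (simp add: norm_vec_power2 sum_distrib_left sum_negf[symmetric] exp_sum)
  finally show ?thesis .
qed

lemma distr_lborel_reflect_at: "distr lborel borel (\<lambda>y. x - y) = (lborel :: 'a::euclidean_space measure)"
proof -
  have "lborel = density (distr lborel borel (\<lambda>y. x + (- 1) *\<^sub>R y)) (\<lambda>_. ennreal (\<bar>- 1 :: real\<bar> ^ DIM('a)))"
    by (rule lborel_affine) simp
  then show ?thesis by (simp add: density_1)
qed

lemma integral_reflect_at:
  fixes f :: "'a::euclidean_space \<Rightarrow> 'b::{banach,second_countable_topology}"
  assumes [measurable]: "f \<in> borel_measurable borel"
  shows "(LINT y|lborel. f (x - y)) = (LINT y|lborel. f y)"
proof -
  have "(LINT y|lborel. f y) = (LINT y|distr lborel borel (\<lambda>y. x - y). f y)"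
    by (simp add: distr_lborel_reflect_at)
  also have "\<dots> = (LINT y|lborel. f (x - y))" by (rule integral_distr) auto
  finally show ?thesis by simp
qed

lemma integrable_reflect_at:
  fixes f :: "'a::euclidean_space \<Rightarrow> 'b::{banach,second_countable_topology}"
  assumes f: "integrable lborel f"
  shows "integrable lborel (\<lambda>y. f (x - y))"
proof -
  have [measurable]: "f \<in> borel_measurable borel" using f by auto
  have "integrable (distr lborel borel (\<lambda>y. x - y)) f" using f by (simp add: distr_lborel_reflect_at)
  then show ?thesis by (subst (asm) integrable_distr_eq) auto
qed

lemma Fubini_bounded_kernel:
  fixes f :: "'a::euclidean_space \<Rightarrow> real" and g :: "'b::euclidean_space \<Rightarrow> real"
    and b :: "'a \<Rightarrow> 'b \<Rightarrow> complex"
  assumes f: "integrable lborel f" and g: "integrable lborel g"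
    and b[measurable]: "(\<lambda>(x, y). b x y) \<in> borel_measurable (borel \<Otimes>\<^sub>M borel)"
    and bd: "\<And>x y. norm (b x y) \<le> B"
  shows "(LINT x|lborel. of_real (f x) * (LINT y|lborel. of_real (g y) * b x y))
    = (LINT y|lborel. of_real (g y) * (LINT x|lborel. of_real (f x) * b x y))"
proof -
  have [measurable]: "f \<in> borel_measurable borel" "g \<in> borel_measurable borel" using f g by auto
  have B: "B \<ge> 0" using order_trans[OF norm_ge_zero bd] .
  let ?F = "\<lambda>x y. of_real (f x) * (of_real (g y) * b x y)"
  have "integrable (lborel \<Otimes>\<^sub>M lborel) (\<lambda>(x, y). ?F x y)"
  proof (rule lborel_pair.Fubini_integrable)
    show "(\<lambda>(x, y). ?F x y) \<in> borel_measurable (lborel \<Otimes>\<^sub>M lborel)" by measurable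
    have y: "integrable lborel (\<lambda>y. of_real (g y) * b x y)" for x
      by (rule integrable_bounded_times[OF g _ bd]) measurable
    show "AE x in lborel. integrable lborel (\<lambda>y. case (x, y) of (x, y) \<Rightarrow> ?F x y)"
      by (intro AE_I2) (auto intro!: integrable_mult_right y)
    show "integrable lborel (\<lambda>x. LINT y|lborel. norm (case (x, y) of (x, y) \<Rightarrow> ?F x y))"
    proof (rule Bochner_Integration.integrable_bound)
      show "integrable lborel (\<lambda>x. f x * (B * (LINT y|lborel. \<bar>g y\<bar>)))" using f by simp
      show "AE x in lborel. norm (LINT y|lborel. norm (case (x, y) of (x, y) \<Rightarrow> ?F x y))
          \<le> norm (f x * (B * (LINT y|lborel. \<bar>g y\<bar>)))"
      proof (rule AE_I2)
        fix x
        have "(LINT y|lborel. norm (?F x y)) \<le> (LINT y|lborel. \<bar>f x\<bar> * (B * \<bar>g y\<bar>))"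
        proof (rule integral_mono)
          show "integrable lborel (\<lambda>y. norm (?F x y))" by (intro integrable_norm integrable_mult_right y)
          show "integrable lborel (\<lambda>y. \<bar>f x\<bar> * (B * \<bar>g y\<bar>))" using g by simp
          show "norm (?F x y) \<le> \<bar>f x\<bar> * (B * \<bar>g y\<bar>)" for y
            using mult_left_mono[OF mult_left_mono[OF bd[of x y], of "\<bar>g y\<bar>"], of "\<bar>f x\<bar>"]
            by (simp add: norm_mult mult_ac)
        qed
        moreover have "0 \<le> (LINT y|lborel. norm (?F x y))" by (intro integral_nonneg_AE) simp
        moreover have "0 \<le> (LINT y|lborel. \<bar>g y\<bar>)" by (intro integral_nonneg_AE) simp
        ultimately show "norm (LINT y|lborel. norm (case (x, y) of (x, y) \<Rightarrow> ?F x y))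
          \<le> norm (f x * (B * (LINT y|lborel. \<bar>g y\<bar>)))"
          using B by (simp add: abs_mult)
      qed
    qed measurable
  qed
  from lborel_pair.Fubini_integral[OF this]
  have "(LINT y|lborel. LINT x|lborel. ?F x y) = (LINT x|lborel. LINT y|lborel. ?F x y)" .
  moreover have "(LINT x|lborel. ?F x y) = of_real (g y) * (LINT x|lborel. of_real (f x) * b x y)" for y
    by (simp only: mult.left_commute[of "complex_of_real (f _)"] integral_mult_right_zero)
  ultimately show ?thesis by (simp only: integral_mult_right_zero)
qed

text \<open>The probe is written as a Fourier integral of \<open>probe_hat\<close>, where the heat
  kernel acts as a multiplier absorbed by \<open>probe_hat_add\<close>. The nonzero factor
  \<open>probe_const\<close> is cancelled at the end.\<close>

lemma heat_probe:
  fixes x :: "real^'n::finite"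
  assumes \<epsilon>: "\<epsilon> > 0" and t: "t > 0"
  shows "(LINT y|lborel. heat_kernel t (x - y) * probe k \<epsilon> 0 y) = probe k \<epsilon> t x"
proof -
  let ?c = "probe_const TYPE('n)"
  have c: "?c \<noteq> 0" by (simp add: probe_const_def)
  have "?c * complex_of_real (LINT y|lborel. heat_kernel t (x - y) * probe k \<epsilon> 0 y)
      = (LINT y|lborel. of_real (heat_kernel t (x - y)) * (?c * of_real (probe k \<epsilon> 0 y)))"
    by (simp add: mult.left_commute flip: integral_complex_of_real)
  also have "\<dots> = (LINT y|lborel. of_real (heat_kernel t (x - y)) *
      (LINT \<xi>|lborel. of_real (probe_hat k \<epsilon> 0 \<xi>) * exp (- \<i> * of_real (\<xi> \<bullet> y))))"
    by (subst probe_inv_fourier[OF \<epsilon> order_refl, symmetric]) (simp add: mult.commute)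
  also have "\<dots> = (LINT \<xi>|lborel. of_real (probe_hat k \<epsilon> 0 \<xi>) *
      (LINT y|lborel. of_real (heat_kernel t (x - y)) * exp (- \<i> * of_real (\<xi> \<bullet> y))))"
  proof (rule Fubini_bounded_kernel[where B=1])
    show "integrable lborel (\<lambda>y. heat_kernel t (x - y))"
      by (intro integrable_reflect_at integrable_heat_kernel t)
    show "integrable lborel (probe_hat k \<epsilon> 0)" by (rule integrable_probe_hat) (use \<epsilon> in auto)
    show "(\<lambda>(y :: real^'n, \<xi>). exp (- \<i> * complex_of_real (\<xi> \<bullet> y))) \<in> borel_measurable (borel \<Otimes>\<^sub>M borel)"
      by measurable
  qed simp
  also have "\<dots> = (LINT \<xi>|lborel. exp (- \<i> * of_real (\<xi> \<bullet> x)) * of_real (probe_hat k \<epsilon> t \<xi>))"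
  proof (rule Bochner_Integration.integral_cong[OF refl])
    fix \<xi> :: "real^'n"
    have "(LINT y|lborel. of_real (heat_kernel t (x - y)) * exp (- \<i> * of_real (\<xi> \<bullet> y)))
      = (LINT y|lborel. exp (- \<i> * of_real (\<xi> \<bullet> x)) * (of_real (heat_kernel t (x - y)) * exp (\<i> * of_real (\<xi> \<bullet> (x - y)))))"
      by (rule Bochner_Integration.integral_cong[OF refl])
         (simp add: inner_diff_right algebra_simps flip: exp_add)
    also have "\<dots> = exp (- \<i> * of_real (\<xi> \<bullet> x)) * (LINT y|lborel. of_real (heat_kernel t y) * exp (\<i> * of_real (\<xi> \<bullet> y)))"
      by (subst integral_mult_right_zero, subst integral_reflect_at) auto
    also have "\<dots> = exp (- \<i> * of_real (\<xi> \<bullet> x)) * of_real (exp (- t * (norm \<xi>)\<^sup>2))"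
      by (subst heat_kernel_fourier[OF t]) simp
    finally show "of_real (probe_hat k \<epsilon> 0 \<xi>) * (LINT y|lborel. of_real (heat_kernel t (x - y)) * exp (- \<i> * of_real (\<xi> \<bullet> y)))
      = exp (- \<i> * of_real (\<xi> \<bullet> x)) * of_real (probe_hat k \<epsilon> t \<xi>)"
      using probe_hat_add[of k \<epsilon> 0 t \<xi>] by (simp add: mult_ac)
  qed
  also have "\<dots> = ?c * complex_of_real (probe k \<epsilon> t x)"
    by (rule probe_inv_fourier) (use \<epsilon> t in auto)
  finally show ?thesis using c by simp
qed

text \<open>The heat kernel is symmetric, so Fubini moves the semigroup from \<open>f\<close>, of
  which only boundedness is assumed, to the probe, where its action is explicit.\<close>

lemma integral_heat_probe:
  fixes f :: "real^'n::finite \<Rightarrow> complex"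
  assumes [measurable]: "f \<in> borel_measurable borel" and bd: "\<And>x. norm (f x) \<le> B"
    and \<epsilon>: "\<epsilon> > 0" and t: "t \<ge> 0"
  shows "(LINT x|lborel. heat t f x * of_real (probe k \<epsilon> 0 x)) = (LINT x|lborel. f x * of_real (probe k \<epsilon> t x))"
proof (cases "t = 0")
  case True
  then show ?thesis by (simp add: heat_def)
next
  case False
  with t have t: "t > 0" by simp
  have B: "B \<ge> 0" using order_trans[OF norm_ge_zero bd] .
  have p: "integrable lborel (probe k \<epsilon> 0)" by (rule integrable_probe) (use \<epsilon> in auto)
  have Ki: "integrable lborel (\<lambda>y. heat_kernel t (x - y))" for x :: "real^'n"
    by (intro integrable_reflect_at integrable_heat_kernel t)
  let ?F = "\<lambda>x y. of_real (probe k \<epsilon> 0 x) * (of_real (heat_kernel t (x - y)) * f y)"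
  have y: "integrable lborel (\<lambda>y. of_real (heat_kernel t (x - y)) * f y)" for x
    by (rule integrable_bounded_times[OF Ki _ bd]) measurable
  have "integrable (lborel \<Otimes>\<^sub>M lborel) (\<lambda>(x, y). ?F x y)"
  proof (rule lborel_pair.Fubini_integrable)
    show "(\<lambda>(x, y). ?F x y) \<in> borel_measurable (lborel \<Otimes>\<^sub>M lborel)" by measurable
    show "AE x in lborel. integrable lborel (\<lambda>y. case (x, y) of (x, y) \<Rightarrow> ?F x y)"
      by (intro AE_I2) (auto intro!: integrable_mult_right y)
    show "integrable lborel (\<lambda>x. LINT y|lborel. norm (case (x, y) of (x, y) \<Rightarrow> ?F x y))"
    proof (rule Bochner_Integration.integrable_bound)
      show "integrable lborel (\<lambda>x. probe k \<epsilon> 0 x * B)" using p by simp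
      show "AE x in lborel. norm (LINT y|lborel. norm (case (x, y) of (x, y) \<Rightarrow> ?F x y)) \<le> norm (probe k \<epsilon> 0 x * B)"
      proof (rule AE_I2)
        fix x
        have "(LINT y|lborel. norm (?F x y)) \<le> (LINT y|lborel. (\<bar>probe k \<epsilon> 0 x\<bar> * B) * heat_kernel t (x - y))"
        proof (rule integral_mono)
          show "integrable lborel (\<lambda>y. norm (?F x y))" by (intro integrable_norm integrable_mult_right y)
          show "integrable lborel (\<lambda>y. (\<bar>probe k \<epsilon> 0 x\<bar> * B) * heat_kernel t (x - y))"
            by (intro integrable_mult_right Ki)
          show "norm (?F x y) \<le> (\<bar>probe k \<epsilon> 0 x\<bar> * B) * heat_kernel t (x - y)" for y
            using mult_left_mono[OF mult_left_mono[OF bd[of y], of "heat_kernel t (x - y)"], of "\<bar>probe k \<epsilon> 0 x\<bar>"]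
              heat_kernel_nonneg[of t "x - y"]
            by (simp add: norm_mult mult_ac)
        qed
        also have "\<dots> = \<bar>probe k \<epsilon> 0 x\<bar> * B"
          by (subst integral_mult_right_zero, subst integral_reflect_at) (simp_all add: integral_heat_kernel t)
        finally show "norm (LINT y|lborel. norm (case (x, y) of (x, y) \<Rightarrow> ?F x y)) \<le> norm (probe k \<epsilon> 0 x * B)"
          using B by (simp add: abs_mult integral_nonneg_AE)
      qed
    qed measurable
  qed
  from lborel_pair.Fubini_integral[OF this]
  have eq: "(LINT y|lborel. LINT x|lborel. ?F x y) = (LINT x|lborel. LINT y|lborel. ?F x y)" .
  have "(LINT x|lborel. heat t f x * of_real (probe k \<epsilon> 0 x)) = (LINT x|lborel. LINT y|lborel. ?F x y)"
    using t by (simp only: integral_mult_right_zero) (simp add: heat_def mult.commute)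
  also have "\<dots> = (LINT y|lborel. f y * of_real (probe k \<epsilon> t y))"
  proof (subst eq[symmetric], rule Bochner_Integration.integral_cong[OF refl])
    fix y :: "real^'n"
    have sym: "heat_kernel t (x - y) = heat_kernel t (y - x)" for x :: "real^'n"
      by (simp add: heat_kernel_def norm_minus_commute)
    have "(LINT x|lborel. ?F x y) = (LINT x|lborel. f y * complex_of_real (heat_kernel t (y - x) * probe k \<epsilon> 0 x))"
      by (rule Bochner_Integration.integral_cong[OF refl]) (simp add: sym mult_ac)
    also have "\<dots> = f y * complex_of_real (LINT x|lborel. heat_kernel t (y - x) * probe k \<epsilon> 0 x)"
      by (subst integral_mult_right_zero, subst integral_complex_of_real) simp
    finally show "(LINT x|lborel. ?F x y) = f y * of_real (probe k \<epsilon> t y)"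
      by (simp add: heat_probe[OF \<epsilon> t])
  qed
  finally show ?thesis .
qed

section \<open>Bessel potentials of the test functions\<close>

text \<open>The integrand of the Gamma function, extended by 0 so that mixtures are integrals over
  the whole line; statements about \<tau> \<le> 0 then become trivial.\<close>

definition gamma_weight :: "real \<Rightarrow> real \<Rightarrow> real" where
  "gamma_weight z \<tau> = (if \<tau> > 0 then \<tau> powr (z - 1) * exp (- \<tau>) else 0)"

lemma gamma_weight_nonneg: "gamma_weight z \<tau> \<ge> 0"
  by (simp add: gamma_weight_def)

lemma gamma_weight_measurable [measurable]: "gamma_weight z \<in> borel_measurable borel"
  unfolding gamma_weight_def[abs_def] by measurable

lemma has_bochner_integral_gamma_weight:
  assumes "z > 0"
  shows "has_bochner_integral lborel (gamma_weight z) (Gamma z)"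
proof (rule has_bochner_integral_nn_integral)
  have "(\<integral>\<^sup>+ t. ennreal (gamma_weight z t) \<partial>lborel) = (\<integral>\<^sup>+ t. ennreal (indicator {0..} t * t powr (z - 1) / exp t) \<partial>lborel)"
    by (rule nn_integral_cong) (auto simp: gamma_weight_def exp_minus field_simps indicator_def)
  then show "(\<integral>\<^sup>+ t. ennreal (gamma_weight z t) \<partial>lborel) = ennreal (Gamma z)"
    using Gamma_conv_nn_integral_real[OF assms] by simp
qed (use assms in \<open>auto simp: gamma_weight_nonneg intro: Gamma_real_pos less_imp_le\<close>)

text \<open>Substitution of (1 + c) \<tau> in the Gamma integral. The Bessel symbol corresponds to
  \<open>c = (norm \<xi>)\<^sup>2\<close>; the negative value c = - 1 / 2 serves as a majorant in
  \<open>integrable_gamma_weight_poly\<close>.\<close>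

lemma has_bochner_integral_gamma_weight_exp:
  assumes z: "z > 0" and c: "c > - 1"
  shows "has_bochner_integral lborel (\<lambda>\<tau>. gamma_weight z \<tau> * exp (- c * \<tau>)) (Gamma z * (1 + c) powr (- z))"
proof -
  have "has_bochner_integral lborel (\<lambda>\<tau>. gamma_weight z (0 + (1 + c) * \<tau>)) (Gamma z /\<^sub>R \<bar>1 + c\<bar>)"
    using has_bochner_integral_gamma_weight[OF z] c
    by (subst (asm) lborel_has_bochner_integral_real_affine_iff[of "1 + c" _ _ 0]) auto
  then have A: "has_bochner_integral lborel (\<lambda>\<tau>. (1 + c) powr (1 - z) * gamma_weight z (0 + (1 + c) * \<tau>))
      ((1 + c) powr (1 - z) * (Gamma z /\<^sub>R \<bar>1 + c\<bar>))"
    by (rule has_bochner_integral_mult_right)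
  have B: "(1 + c) powr (1 - z) * gamma_weight z (0 + (1 + c) * \<tau>) = gamma_weight z \<tau> * exp (- c * \<tau>)" for \<tau>
  proof (cases "\<tau> > 0")
    case True
    have "(1 + c) powr (1 - z) * ((1 + c) * \<tau>) powr (z - 1) = \<tau> powr (z - 1)"
      using True c by (simp add: powr_mult flip: powr_add mult.assoc)
    moreover have "exp (- ((1 + c) * \<tau>)) = exp (- \<tau>) * exp (- c * \<tau>)"
      by (simp add: algebra_simps flip: exp_add)
    ultimately show ?thesis using True c by (simp add: gamma_weight_def flip: mult.assoc)
  qed (use c in \<open>auto simp: gamma_weight_def zero_less_mult_iff\<close>)
  have C: "(1 + c) powr (1 - z) * (Gamma z /\<^sub>R \<bar>1 + c\<bar>) = Gamma z * (1 + c) powr (- z)"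
  proof -
    have "(1 + c) powr (1 - z) = (1 + c) * (1 + c) powr (- z)"
      using c powr_add[of "1 + c" 1 "- z"] by simp
    then show ?thesis using c by simp
  qed
  show ?thesis using A unfolding B C .
qed

lemma integrable_gamma_weight_poly:
  assumes z: "z > 0"
  shows "integrable lborel (\<lambda>\<tau>. gamma_weight z \<tau> * (1 + \<tau>) ^ m)"
proof (rule Bochner_Integration.integrable_bound)
  show "integrable lborel (\<lambda>\<tau>. (fact m * 2 ^ m * exp (1 / 2)) * (gamma_weight z \<tau> * exp (- (- (1 / 2)) * \<tau>)))"
    using has_bochner_integral_gamma_weight_exp[OF z, of "- (1 / 2)"]
    by (intro integrable_mult_right) (simp add: has_bochner_integral_iff)
  show "AE \<tau> in lborel. norm (gamma_weight z \<tau> * (1 + \<tau>) ^ m)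
      \<le> norm ((fact m * 2 ^ m * exp (1 / 2)) * (gamma_weight z \<tau> * exp (- (- (1 / 2)) * \<tau>)))"
  proof (rule AE_I2)
    fix \<tau> :: real
    show "norm (gamma_weight z \<tau> * (1 + \<tau>) ^ m)
      \<le> norm ((fact m * 2 ^ m * exp (1 / 2)) * (gamma_weight z \<tau> * exp (- (- (1 / 2)) * \<tau>)))"
    proof (cases "\<tau> > 0")
      case True
      have "(\<Sum>i\<in>{m}. ((1 + \<tau>) / 2) ^ i /\<^sub>R fact i) \<le> exp ((1 + \<tau>) / 2)"
        unfolding exp_def by (rule sum_le_suminf[OF summable_exp_generic]) (use True in auto)
      then have "(1 + \<tau>) ^ m \<le> fact m * 2 ^ m * exp ((1 + \<tau>) / 2)"
        by (simp add: field_simps power_divide)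
      also have "\<dots> = fact m * 2 ^ m * exp (1 / 2) * exp (\<tau> / 2)"
        by (simp add: add_divide_distrib exp_add)
      finally have "gamma_weight z \<tau> * (1 + \<tau>) ^ m \<le> gamma_weight z \<tau> * (fact m * 2 ^ m * exp (1 / 2) * exp (\<tau> / 2))"
        by (intro mult_left_mono gamma_weight_nonneg)
      then show ?thesis using True gamma_weight_nonneg[of z \<tau>] by (simp add: abs_mult mult_ac)
    qed (simp add: gamma_weight_def)
  qed
qed measurable

section \<open>Scaling of the normal factor\<close>

lemma quint1_scale: "a > 0 \<Longrightarrow> quint1 a (sqrt a * r) = quint1 1 r / a ^ 3"
  by (simp add: quint1_def power_mult_distrib)

lemma integral_quint1_scale:
  fixes F :: "real \<Rightarrow> real \<Rightarrow> real"
  assumes "a > 0"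
  shows "(LINT r|lborel. F r (quint1 a r)) = sqrt a * (LINT r|lborel. F (sqrt a * r) (quint1 1 r / a ^ 3))"
  using assms by (subst lborel_integral_real_affine[where c="sqrt a" and t=0]) (simp_all add: quint1_scale)

lemma integrable_powr_quint1: "integrable lborel (\<lambda>r. \<bar>r\<bar> powr \<beta> * \<bar>quint1 a r\<bar> powr q)"
  if a: "a > 0" and \<beta>: "\<beta> \<ge> 0" and q: "q \<ge> 1"
proof -
  define C where "C = (15 / 4 + 5 / 4 / a + 1 / 16 / a\<^sup>2) / (a ^ 3 * sqrt a)"
  define m where "m = nat \<lceil>\<beta> + 5 * q\<rceil>"
  have C: "C \<ge> 0" using a by (simp add: C_def)
  show ?thesis
  proof (rule integrable_gauss_le[of "1 / (4 * a)" _ "C powr q" m])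
    fix r :: real
    have r: "1 + \<bar>r\<bar> \<ge> 1" by simp
    have "\<bar>quint1 a r\<bar> powr q \<le> (C * ((1 + \<bar>r\<bar>) ^ 5 * exp (- (1 / (4 * a)) * r\<^sup>2))) powr q"
      unfolding C_def using q by (intro powr_mono2 abs_quint1_le a) auto
    also have "\<dots> = C powr q * ((1 + \<bar>r\<bar>) powr (5 * q) * exp (- (1 / (4 * a)) * r\<^sup>2) powr q)"
      using C by (simp add: powr_mult powr_powr mult.commute flip: powr_numeral)
    also have "exp (- (1 / (4 * a)) * r\<^sup>2) powr q \<le> exp (- (1 / (4 * a)) * r\<^sup>2)"
      using q a by (simp add: powr_def) (metis divide_right_mono mult_right_mono[of 1 q "r\<^sup>2"] mult_1 zero_le_power2 less_imp_le mult_nonneg_nonneg zero_le_numeral times_divide_eq_right)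
    finally have 1: "\<bar>quint1 a r\<bar> powr q \<le> C powr q * ((1 + \<bar>r\<bar>) powr (5 * q) * exp (- (1 / (4 * a)) * r\<^sup>2))"
      by (simp add: mult_left_mono)
    have "\<bar>r\<bar> powr \<beta> \<le> (1 + \<bar>r\<bar>) powr \<beta>" using \<beta> by (intro powr_mono2) auto
    from mult_mono[OF this 1]
    have "\<bar>r\<bar> powr \<beta> * \<bar>quint1 a r\<bar> powr q \<le> C powr q * ((1 + \<bar>r\<bar>) powr (\<beta> + 5 * q) * exp (- (1 / (4 * a)) * r\<^sup>2))"
      by (simp add: powr_add mult_ac)
    also have "(1 + \<bar>r\<bar>) powr (\<beta> + 5 * q) \<le> (1 + \<bar>r\<bar>) powr real m"
      unfolding m_def by (intro powr_mono real_nat_ceiling_ge) auto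
    also have "\<dots> = (1 + \<bar>r\<bar>) ^ m" using r by (simp add: powr_realpow)
    finally show "norm (\<bar>r\<bar> powr \<beta> * \<bar>quint1 a r\<bar> powr q) \<le> C powr q * ((1 + \<bar>r\<bar>) ^ m * exp (- (1 / (4 * a)) * r\<^sup>2))"
      by (simp add: mult_left_mono mult_right_mono)
  qed (use a in auto)
qed

text \<open>In the variable r / sqrt a the exponent collects 1 / 2 from the Jacobian, \<beta> / 2
  from the weight and - 3 q from the amplitude of \<open>quint1 a\<close>. The upper bounds for
  pairings with probes take their rates from this identity.\<close>

lemma integral_powr_quint1:
  assumes a: "a > 0"
  shows "(LINT r|lborel. \<bar>r\<bar> powr \<beta> * \<bar>quint1 a r\<bar> powr q)
     = a powr ((\<beta> + 1) / 2 - 3 * q) * (LINT r|lborel. \<bar>r\<bar> powr \<beta> * \<bar>quint1 1 r\<bar> powr q)"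
proof -
  have "(LINT r|lborel. \<bar>r\<bar> powr \<beta> * \<bar>quint1 a r\<bar> powr q)
      = sqrt a * (LINT r|lborel. \<bar>sqrt a * r\<bar> powr \<beta> * \<bar>quint1 1 r / a ^ 3\<bar> powr q)"
    by (rule integral_quint1_scale[OF a, where F="\<lambda>r y. \<bar>r\<bar> powr \<beta> * \<bar>y\<bar> powr q"])
  also have "\<dots> = sqrt a * (LINT r|lborel. a powr (\<beta> / 2 - 3 * q) * (\<bar>r\<bar> powr \<beta> * \<bar>quint1 1 r\<bar> powr q))"
  proof -
    have "\<bar>sqrt a * r\<bar> powr \<beta> * \<bar>quint1 1 r / a ^ 3\<bar> powr q = a powr (\<beta> / 2 - 3 * q) * (\<bar>r\<bar> powr \<beta> * \<bar>quint1 1 r\<bar> powr q)" for r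
    proof -
      have "\<bar>sqrt a * r\<bar> powr \<beta> = a powr (\<beta> / 2) * \<bar>r\<bar> powr \<beta>"
        using a by (simp add: abs_mult powr_mult powr_half_sqrt[symmetric] powr_powr)
      moreover have "\<bar>quint1 1 r / a ^ 3\<bar> powr q = \<bar>quint1 1 r\<bar> powr q * a powr (- 3 * q)"
      proof -
        have e: "(a ^ 3) powr q = a powr (3 * q)" using a by (simp add: powr_powr flip: powr_numeral)
        have p: "\<bar>quint1 1 r / a ^ 3\<bar> = \<bar>quint1 1 r\<bar> / a ^ 3" using a by simp
        have "\<bar>quint1 1 r / a ^ 3\<bar> powr q = \<bar>quint1 1 r\<bar> powr q / a powr (3 * q)"
          unfolding p by (subst powr_divide) (rule arg_cong[OF e])
        also have "\<dots> = \<bar>quint1 1 r\<bar> powr q * a powr (- (3 * q))"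
          by (subst powr_minus) (rule divide_inverse)
        finally show ?thesis by simp
      qed
      moreover have "a powr (\<beta> / 2 - 3 * q) = a powr (\<beta> / 2) * a powr (- 3 * q)"
        by (simp flip: powr_add)
      ultimately show ?thesis by simp
    qed
    then show ?thesis by simp
  qed
  also have "\<dots> = (a powr (1 / 2) * a powr (\<beta> / 2 - 3 * q)) * (LINT r|lborel. \<bar>r\<bar> powr \<beta> * \<bar>quint1 1 r\<bar> powr q)"
    using a by (simp add: powr_half_sqrt)
  also have "a powr (1 / 2) * a powr (\<beta> / 2 - 3 * q) = a powr ((\<beta> + 1) / 2 - 3 * q)"
    unfolding powr_add[symmetric] by (rule arg_cong[where f="(powr) a"]) (simp add: field_simps)
  finally show ?thesis .
qed

section \<open>Differentiation under the integral and Schwartz regularity of Gamma mixtures\<close>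

lemma has_derivative_lebesgue_integral:
  fixes f :: "'v::euclidean_space \<Rightarrow> 'a \<Rightarrow> real" and D :: "'a \<Rightarrow> 'v \<Rightarrow> real"
  assumes int: "\<And>y. integrable M (f y)"
    and der: "\<And>\<tau>. ((\<lambda>y. f y \<tau>) has_derivative D \<tau>) (at x)"
    and meas: "\<And>v. (\<lambda>\<tau>. D \<tau> v) \<in> borel_measurable M"
    and Dle: "\<And>\<tau> v. \<bar>D \<tau> v\<bar> \<le> B \<tau> * norm v"
    and lip: "\<And>y \<tau>. \<bar>f y \<tau> - f x \<tau>\<bar> \<le> B \<tau> * norm (y - x)"
    and B: "integrable M B"
  shows "((\<lambda>y. LINT \<tau>|M. f y \<tau>) has_derivative (\<lambda>v. LINT \<tau>|M. D \<tau> v)) (at x)"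
proof -
  have iD: "integrable M (\<lambda>\<tau>. D \<tau> v)" for v
  proof (rule Bochner_Integration.integrable_bound[OF _ meas])
    show "integrable M (\<lambda>\<tau>. B \<tau> * norm v)" using B by simp
    show "AE \<tau> in M. norm (D \<tau> v) \<le> norm (B \<tau> * norm v)"
      using Dle order_trans[OF _ abs_ge_self] by (intro AE_I2) (simp, blast)
  qed
  have lin: "linear (D \<tau>)" for \<tau> using der has_derivative_linear by blast
  have bl: "bounded_linear (\<lambda>v. LINT \<tau>|M. D \<tau> v)"
    unfolding linear_conv_bounded_linear[symmetric]
    by (rule linearI) (simp_all add: linear_add[OF lin] linear_scale[OF lin] iD)
  \<comment> \<open>The normalised remainder tends to 0 pointwise and is dominated by
    \<open>2 * B \<tau>\<close>, so dominated convergence applies along every sequence tending to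
    \<open>x\<close>.\<close>
  define R where "R = (\<lambda>y \<tau>. (f y \<tau> - f x \<tau> - D \<tau> (y - x)) /\<^sub>R norm (y - x))"
  have "((\<lambda>y. LINT \<tau>|M. R y \<tau>) \<longlongrightarrow> (LINT \<tau>|M. 0)) (at x)"
    unfolding tendsto_at_iff_sequentially o_def
  proof (intro allI impI)
    fix X :: "nat \<Rightarrow> 'v" assume X: "\<forall>i. X i \<in> UNIV - {x}" "X \<longlonglongrightarrow> x"
    show "(\<lambda>i. LINT \<tau>|M. R (X i) \<tau>) \<longlonglongrightarrow> (LINT \<tau>|M. 0)"
    proof (rule integral_dominated_convergence[where w="\<lambda>\<tau>. 2 * B \<tau>"])
      show "(\<lambda>\<tau>. 0) \<in> borel_measurable M" by simp
      show "(\<lambda>\<tau>. R (X i) \<tau>) \<in> borel_measurable M" for i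
        unfolding R_def using int[THEN borel_measurable_integrable] meas by measurable
      show "integrable M (\<lambda>\<tau>. 2 * B \<tau>)" using B by simp
      show "AE \<tau> in M. (\<lambda>i. R (X i) \<tau>) \<longlonglongrightarrow> 0"
      proof (rule AE_I2)
        fix \<tau>
        have "((\<lambda>y. R y \<tau>) \<longlongrightarrow> 0) (at x)"
          using der[of \<tau>] by (simp add: has_derivative_at_within R_def)
        then show "(\<lambda>i. R (X i) \<tau>) \<longlonglongrightarrow> 0"
          using X unfolding tendsto_at_iff_sequentially o_def by blast
      qed
      show "AE \<tau> in M. norm (R (X i) \<tau>) \<le> 2 * B \<tau>" for i
      proof (rule AE_I2)
        fix \<tau>
        have n: "norm (X i - x) > 0" using X by simp
        have "\<bar>f (X i) \<tau> - f x \<tau> - D \<tau> (X i - x)\<bar> \<le> 2 * B \<tau> * norm (X i - x)"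
          using lip[of "X i" \<tau>] Dle[of \<tau> "X i - x"] by linarith
        then show "norm (R (X i) \<tau>) \<le> 2 * B \<tau>"
          using n by (simp add: R_def abs_mult field_simps)
      qed
    qed
  qed
  moreover have "(LINT \<tau>|M. R y \<tau>) = ((LINT \<tau>|M. f y \<tau>) - (LINT \<tau>|M. f x \<tau>) - (LINT \<tau>|M. D \<tau> (y - x))) /\<^sub>R norm (y - x)" for y
    unfolding R_def using int iD by simp
  ultimately show ?thesis
    using bl by (simp add: has_derivative_at_within)
qed

text \<open>
  Closed under the derivative in \<open>r\<close>, with rapidly decreasing members whose constants grow only
  polynomially in \<open>\<tau>\<close>: averaging products of them against \<open>gamma_weight\<close> gives Schwartz functions.
\<close>

inductive_set gauss_family :: "(real \<Rightarrow> real \<Rightarrow> real) set" where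
  base: "a > 0 \<Longrightarrow> \<psi> \<in> borel_measurable borel \<Longrightarrow> \<forall>\<tau>>0. \<bar>\<psi> \<tau>\<bar> \<le> C \<Longrightarrow>
    (\<lambda>\<tau> r. \<psi> \<tau> * r ^ j * exp (- r\<^sup>2 / (4 * (a + \<tau>)))) \<in> gauss_family"
| add: "f \<in> gauss_family \<Longrightarrow> g \<in> gauss_family \<Longrightarrow> (\<lambda>\<tau> r. f \<tau> r + g \<tau> r) \<in> gauss_family"

lemma gauss_family_deriv:
  "f \<in> gauss_family \<Longrightarrow> \<exists>f'\<in>gauss_family. \<forall>\<tau>>0. \<forall>r. (f \<tau> has_real_derivative f' \<tau> r) (at r)"
proof (induction rule: gauss_family.induct)
  case (base a \<psi> C j)
  let ?E = "\<lambda>\<tau> r. exp (- r\<^sup>2 / (4 * (a + \<tau>)))"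
  let ?f' = "\<lambda>\<tau> r. real j * \<psi> \<tau> * r ^ (j - 1) * ?E \<tau> r + (- \<psi> \<tau> / (2 * (a + \<tau>))) * r ^ (j + 1) * ?E \<tau> r"
  have "?f' \<in> gauss_family"
  proof (rule gauss_family.add)
    have "\<bar>real j * \<psi> \<tau>\<bar> \<le> real j * C" if "\<tau> > 0" for \<tau>
      using base(3) that by (simp add: abs_mult mult_left_mono)
    then show "(\<lambda>\<tau> r. real j * \<psi> \<tau> * r ^ (j - 1) * ?E \<tau> r) \<in> gauss_family"
      using base(1,2) by (intro gauss_family.base[where C="real j * C"]) auto
    have "\<bar>- \<psi> \<tau> / (2 * (a + \<tau>))\<bar> \<le> C / (2 * a)" if "\<tau> > 0" for \<tau>
    proof -
      have "\<bar>\<psi> \<tau>\<bar> / (2 * (a + \<tau>)) \<le> C / (2 * a)"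
        using base(1,3) that by (intro frac_le) (auto intro: order_trans[OF abs_ge_zero])
      then show ?thesis using base(1) that by simp
    qed
    then show "(\<lambda>\<tau> r. (- \<psi> \<tau> / (2 * (a + \<tau>))) * r ^ (j + 1) * ?E \<tau> r) \<in> gauss_family"
      using base(1,2) by (intro gauss_family.base[where C="C / (2 * a)"]) auto
  qed
  moreover have "((\<lambda>r. \<psi> \<tau> * r ^ j * ?E \<tau> r) has_real_derivative ?f' \<tau> r) (at r)" if "\<tau> > 0" for \<tau> r
  proof -
    have 1: "((\<lambda>r. \<psi> \<tau> * r ^ j) has_real_derivative \<psi> \<tau> * (real j * r ^ (j - 1))) (at r)"
      by (auto intro!: derivative_eq_intros)
    have 2: "(?E \<tau> has_real_derivative ?E \<tau> r * (- (2 * r) / (4 * (a + \<tau>)))) (at r)"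
      using base(1) that by (auto intro!: derivative_eq_intros)
    show ?thesis
    proof (rule DERIV_cong[OF DERIV_mult[OF 1 2]])
      define c where "c = a + \<tau>"
      have "c \<noteq> 0" using base(1) that by (simp add: c_def)
      then show "\<psi> \<tau> * (real j * r ^ (j - 1)) * ?E \<tau> r + ?E \<tau> r * (- (2 * r) / (4 * (a + \<tau>))) * (\<psi> \<tau> * r ^ j)
          = ?f' \<tau> r"
        unfolding c_def[symmetric] by (simp add: field_simps)
    qed
  qed
  ultimately show ?case by (intro bexI[of _ ?f'] allI impI)
next
  case (add f g)
  then obtain f' g' where "f' \<in> gauss_family" "\<forall>\<tau>>0. \<forall>r. (f \<tau> has_real_derivative f' \<tau> r) (at r)"
    "g' \<in> gauss_family" "\<forall>\<tau>>0. \<forall>r. (g \<tau> has_real_derivative g' \<tau> r) (at r)" by blast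
  then show ?case
    by (intro bexI[of _ "\<lambda>\<tau> r. f' \<tau> r + g' \<tau> r"] allI impI DERIV_add gauss_family.add) auto
qed

lemma gauss_family_measurable: "f \<in> gauss_family \<Longrightarrow> (\<lambda>\<tau>. f \<tau> r) \<in> borel_measurable borel"
proof (induction rule: gauss_family.induct)
  case (base a \<psi> C j)
  then have [measurable]: "\<psi> \<in> borel_measurable borel" by simp
  show ?case by measurable
qed simp

text \<open>The Gaussian widens as \<tau> grows, and \<open>poly_gauss_bounded\<close> turns the
  width into a factor \<open>(a + \<tau>) ^ n\<close>, which the exponential decay of
  \<open>gamma_weight\<close> can absorb.\<close>

lemma gauss_family_bound:
  "f \<in> gauss_family \<Longrightarrow> \<exists>C\<ge>0. \<exists>M. \<forall>\<tau>>0. \<forall>r. (1 + \<bar>r\<bar>) ^ m * \<bar>f \<tau> r\<bar> \<le> C * (1 + \<tau>) ^ M"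
proof (induction rule: gauss_family.induct)
  case (base a \<psi> C j)
  define n where "n = m + j"
  define D where "D = \<bar>C\<bar> * (2 ^ n * exp (1 / (4 * a)) * fact n * 4 ^ n * (a + 1) ^ n)"
  have "(1 + \<bar>r\<bar>) ^ m * \<bar>\<psi> \<tau> * r ^ j * exp (- r\<^sup>2 / (4 * (a + \<tau>)))\<bar> \<le> D * (1 + \<tau>) ^ n" if \<tau>: "\<tau> > 0" for \<tau> r
  proof -
    define b where "b = 1 / (4 * (a + \<tau>))"
    have b: "b > 0" using base(1) \<tau> by (simp add: b_def)
    have E: "exp (- r\<^sup>2 / (4 * (a + \<tau>))) = exp (- b * r\<^sup>2)" by (simp add: b_def)
    have "\<bar>r\<bar> ^ j \<le> (1 + \<bar>r\<bar>) ^ j" by (intro power_mono) auto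
    then have "\<bar>\<psi> \<tau>\<bar> * ((1 + \<bar>r\<bar>) ^ m * \<bar>r\<bar> ^ j * exp (- b * r\<^sup>2)) \<le> \<bar>C\<bar> * ((1 + \<bar>r\<bar>) ^ m * (1 + \<bar>r\<bar>) ^ j * exp (- b * r\<^sup>2))"
      using base(3) \<tau> by (intro mult_mono) (auto intro: order_trans[OF _ abs_ge_self] mult_left_mono)
    also have "\<dots> \<le> \<bar>C\<bar> * (2 ^ n * exp (1 / (4 * a)) * fact n * 4 ^ n * ((a + 1) * (1 + \<tau>)) ^ n)"
    proof (intro mult_left_mono)
      have "(1 + \<bar>r\<bar>) ^ m * (1 + \<bar>r\<bar>) ^ j * exp (- b * r\<^sup>2) \<le> 2 ^ n * exp b * fact n / b ^ n"
        using poly_gauss_bounded[OF b, of r n] by (simp add: n_def power_add)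
      also have "\<dots> = 2 ^ n * exp b * fact n * 4 ^ n * (a + \<tau>) ^ n"
        using base(1) \<tau> by (simp add: b_def power_divide power_mult_distrib del: distrib_left_numeral)
      also have "\<dots> \<le> 2 ^ n * exp (1 / (4 * a)) * fact n * 4 ^ n * ((a + 1) * (1 + \<tau>)) ^ n"
      proof (intro mult_mono power_mono order_refl)
        show "exp b \<le> exp (1 / (4 * a))"
          using base(1) \<tau> by (auto simp: b_def intro!: divide_left_mono)
        show "a + \<tau> \<le> (a + 1) * (1 + \<tau>)" using base(1) \<tau> by (simp add: algebra_simps)
      qed (use base(1) \<tau> in auto)
      finally show "(1 + \<bar>r\<bar>) ^ m * (1 + \<bar>r\<bar>) ^ j * exp (- b * r\<^sup>2)
         \<le> 2 ^ n * exp (1 / (4 * a)) * fact n * 4 ^ n * ((a + 1) * (1 + \<tau>)) ^ n" .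
    qed simp
    finally show ?thesis
      unfolding E D_def power_mult_distrib by (simp add: abs_mult power_abs mult_ac)
  qed
  moreover have "D \<ge> 0" using base(1) by (simp add: D_def)
  ultimately show ?case by blast
next
  case (add f g)
  then obtain C M C' M' where fg: "C \<ge> 0" "\<And>\<tau> r. \<tau> > 0 \<Longrightarrow> (1 + \<bar>r\<bar>) ^ m * \<bar>f \<tau> r\<bar> \<le> C * (1 + \<tau>) ^ M"
    "C' \<ge> 0" "\<And>\<tau> r. \<tau> > 0 \<Longrightarrow> (1 + \<bar>r\<bar>) ^ m * \<bar>g \<tau> r\<bar> \<le> C' * (1 + \<tau>) ^ M'" by blast
  have "(1 + \<bar>r\<bar>) ^ m * \<bar>f \<tau> r + g \<tau> r\<bar> \<le> (C + C') * (1 + \<tau>) ^ (max M M')" if \<tau>: "\<tau> > 0" for \<tau> r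
  proof -
    have "(1 + \<bar>r\<bar>) ^ m * \<bar>f \<tau> r + g \<tau> r\<bar> \<le> (1 + \<bar>r\<bar>) ^ m * (\<bar>f \<tau> r\<bar> + \<bar>g \<tau> r\<bar>)"
      by (intro mult_left_mono) auto
    also have "\<dots> \<le> C * (1 + \<tau>) ^ M + C' * (1 + \<tau>) ^ M'"
      using fg(2,4)[OF \<tau>] by (simp add: distrib_left add_mono)
    also have "\<dots> \<le> C * (1 + \<tau>) ^ max M M' + C' * (1 + \<tau>) ^ max M M'"
      using fg(1,3) \<tau> by (intro add_mono mult_left_mono power_increasing) auto
    finally show ?thesis by (simp add: distrib_right)
  qed
  then show ?case using fg(1,3) by (intro exI[of _ "C + C'"] conjI exI[of _ "max M M'"]) auto
qed

text \<open>Since \<open>1 + norm x\<close> is at most the product of the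
  \<open>1 + \<bar>x $ i\<bar>\<close>, the polynomial weight factorises along with the
  product.\<close>

lemma prod_gauss_family_bound:
  fixes h :: "'n::finite \<Rightarrow> real \<Rightarrow> real \<Rightarrow> real"
  assumes "\<And>i. h i \<in> gauss_family"
  obtains C M where "C \<ge> 0"
    "\<And>\<tau> (x::real^'n). \<tau> > 0 \<Longrightarrow> (1 + norm x) ^ m * \<bar>\<Prod>i\<in>UNIV. h i \<tau> (x $ i)\<bar> \<le> C * (1 + \<tau>) ^ M"
proof -
  have "\<forall>i. \<exists>C\<ge>0. \<exists>M. \<forall>\<tau>>0. \<forall>r. (1 + \<bar>r\<bar>) ^ m * \<bar>h i \<tau> r\<bar> \<le> C * (1 + \<tau>) ^ M"
    using gauss_family_bound[OF assms] by blast
  then obtain C M where CM: "\<And>i. C i \<ge> 0"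
    "\<And>i \<tau> r. \<tau> > 0 \<Longrightarrow> (1 + \<bar>r\<bar>) ^ m * \<bar>h i \<tau> r\<bar> \<le> C i * (1 + \<tau>) ^ M i" by metis
  show ?thesis
  proof
    show "(\<Prod>i\<in>UNIV. C i) \<ge> 0" by (intro prod_nonneg CM)
    fix \<tau> :: real and x :: "real^'n" assume \<tau>: "\<tau> > 0"
    have "1 + norm x \<le> 1 + (\<Sum>i\<in>UNIV. \<bar>x $ i\<bar>)" by (simp add: norm_le_l1_cart)
    also have "\<dots> \<le> (\<Prod>i\<in>UNIV. 1 + \<bar>x $ i\<bar>)"
    proof -
      have "1 + (\<Sum>i\<in>A. \<bar>x $ i\<bar>) \<le> (\<Prod>i\<in>A. 1 + \<bar>x $ i\<bar>)" if "finite A" for A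
        using that
      proof induction
        case (insert i A)
        have "0 \<le> \<bar>x $ i\<bar> * (\<Sum>i\<in>A. \<bar>x $ i\<bar>)" by (intro mult_nonneg_nonneg sum_nonneg) auto
        then have "1 + (\<bar>x $ i\<bar> + (\<Sum>i\<in>A. \<bar>x $ i\<bar>)) \<le> (1 + \<bar>x $ i\<bar>) * (1 + (\<Sum>i\<in>A. \<bar>x $ i\<bar>))"
          by (simp add: algebra_simps)
        also have "\<dots> \<le> (1 + \<bar>x $ i\<bar>) * (\<Prod>i\<in>A. 1 + \<bar>x $ i\<bar>)"
          using insert.IH by (intro mult_left_mono) auto
        finally show ?case using insert.hyps by simp
      qed simp
      then show ?thesis by simp
    qed
    finally have "(1 + norm x) ^ m \<le> (\<Prod>i\<in>UNIV. 1 + \<bar>x $ i\<bar>) ^ m" by (intro power_mono) auto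
    then have "(1 + norm x) ^ m * \<bar>\<Prod>i\<in>UNIV. h i \<tau> (x $ i)\<bar> \<le> (\<Prod>i\<in>UNIV. 1 + \<bar>x $ i\<bar>) ^ m * \<bar>\<Prod>i\<in>UNIV. h i \<tau> (x $ i)\<bar>"
      by (intro mult_right_mono) auto
    also have "\<dots> = (\<Prod>i\<in>UNIV. (1 + \<bar>x $ i\<bar>) ^ m * \<bar>h i \<tau> (x $ i)\<bar>)"
      by (simp add: prod.distrib prod_power_distrib abs_prod)
    also have "\<dots> \<le> (\<Prod>i\<in>UNIV. C i * (1 + \<tau>) ^ M i)"
      by (intro prod_mono) (use CM(2)[OF \<tau>] in auto)
    also have "\<dots> = (\<Prod>i\<in>UNIV. C i) * (1 + \<tau>) ^ (\<Sum>i\<in>UNIV. M i)"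
      by (simp add: prod.distrib power_sum)
    finally show "(1 + norm x) ^ m * \<bar>\<Prod>i\<in>UNIV. h i \<tau> (x $ i)\<bar> \<le> (\<Prod>i\<in>UNIV. C i) * (1 + \<tau>) ^ (\<Sum>i\<in>UNIV. M i)" .
  qed
qed

text \<open>All factors share the same \<tau>, so the mixture of products is not itself a product;
  its derivatives have to be taken under the integral.\<close>

definition gamma_mix :: "real \<Rightarrow> ('n::finite \<Rightarrow> real \<Rightarrow> real \<Rightarrow> real) \<Rightarrow> real^'n \<Rightarrow> real" where
  "gamma_mix z h x = (LINT \<tau>|lborel. gamma_weight z \<tau> * (\<Prod>i\<in>UNIV. h i \<tau> (x $ i)))"

context
  fixes z :: real assumes z: "z > 0"
begin

text \<open>An integrable majorant independent of \<open>x\<close>; it yields integrability, decay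
  of every polynomial order and the domination required for derivatives.\<close>

lemma gamma_mix_integrand_bound:
  fixes h :: "'n::finite \<Rightarrow> real \<Rightarrow> real \<Rightarrow> real"
  assumes "\<And>i. h i \<in> gauss_family"
  obtains B where "integrable lborel B" "\<And>\<tau>. B \<tau> \<ge> 0"
    "\<And>\<tau> (x::real^'n). (1 + norm x) ^ m * \<bar>gamma_weight z \<tau> * (\<Prod>i\<in>UNIV. h i \<tau> (x $ i))\<bar> \<le> B \<tau>"
proof -
  obtain C M where CM: "C \<ge> 0"
    "\<And>\<tau> (x::real^'n). \<tau> > 0 \<Longrightarrow> (1 + norm x) ^ m * \<bar>\<Prod>i\<in>UNIV. h i \<tau> (x $ i)\<bar> \<le> C * (1 + \<tau>) ^ M"
    using prod_gauss_family_bound[of h m, OF assms] by blast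
  show ?thesis
  proof
    show "integrable lborel (\<lambda>\<tau>. C * (gamma_weight z \<tau> * (1 + \<tau>) ^ M))"
      by (intro integrable_mult_right integrable_gamma_weight_poly z)
    show "0 \<le> C * (gamma_weight z \<tau> * (1 + \<tau>) ^ M)" for \<tau>
      using CM(1) by (cases "\<tau> > 0") (auto simp: gamma_weight_def)
    show "(1 + norm x) ^ m * \<bar>gamma_weight z \<tau> * (\<Prod>i\<in>UNIV. h i \<tau> (x $ i))\<bar> \<le> C * (gamma_weight z \<tau> * (1 + \<tau>) ^ M)"
      for \<tau> and x :: "real^'n"
    proof (cases "\<tau> > 0")
      case True
      from mult_left_mono[OF CM(2)[OF True, of x] gamma_weight_nonneg[of z \<tau>]] show ?thesis
        using gamma_weight_nonneg[of z \<tau>] by (simp add: abs_mult mult_ac)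
    qed (simp add: gamma_weight_def)
  qed
qed

lemma integrable_gamma_mix:
  fixes h :: "'n::finite \<Rightarrow> real \<Rightarrow> real \<Rightarrow> real" and x :: "real^'n"
  assumes h: "\<And>i. h i \<in> gauss_family"
  shows "integrable lborel (\<lambda>\<tau>. gamma_weight z \<tau> * (\<Prod>i\<in>UNIV. h i \<tau> (x $ i)))"
proof -
  have [measurable]: "(\<lambda>\<tau>. h i \<tau> r) \<in> borel_measurable borel" for i r
    by (rule gauss_family_measurable[OF h])
  obtain B where B: "integrable lborel B" "\<And>\<tau>. B \<tau> \<ge> 0"
    "\<And>\<tau> (x::real^'n). (1 + norm x) ^ 0 * \<bar>gamma_weight z \<tau> * (\<Prod>i\<in>UNIV. h i \<tau> (x $ i))\<bar> \<le> B \<tau>"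
    using gamma_mix_integrand_bound[of h 0, OF h] by blast
  show ?thesis
    by (rule Bochner_Integration.integrable_bound[OF B(1)]) (use B(2) B(3)[of x] in auto)
qed

lemma gamma_mix_decay:
  fixes h :: "'n::finite \<Rightarrow> real \<Rightarrow> real \<Rightarrow> real"
  assumes h: "\<And>i. h i \<in> gauss_family"
  shows "\<exists>C. \<forall>x. (1 + norm x) ^ m * \<bar>gamma_mix z h x\<bar> \<le> C"
proof -
  obtain B where B: "integrable lborel B" "\<And>\<tau>. B \<tau> \<ge> 0"
    "\<And>\<tau> (x::real^'n). (1 + norm x) ^ m * \<bar>gamma_weight z \<tau> * (\<Prod>i\<in>UNIV. h i \<tau> (x $ i))\<bar> \<le> B \<tau>"
    using gamma_mix_integrand_bound[of h m, OF h] by blast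
  have "(1 + norm x) ^ m * \<bar>gamma_mix z h x\<bar> \<le> (LINT \<tau>|lborel. B \<tau>)" for x
  proof -
    have "(1 + norm x) ^ m * \<bar>gamma_mix z h x\<bar>
        = norm (LINT \<tau>|lborel. (1 + norm x) ^ m * (gamma_weight z \<tau> * (\<Prod>i\<in>UNIV. h i \<tau> (x $ i))))"
      unfolding gamma_mix_def by (simp add: abs_mult)
    also have "\<dots> \<le> (LINT \<tau>|lborel. B \<tau>)"
      by (rule Bochner_Integration.integral_norm_bound_integral)
         (use B(1) B(3)[of x] in \<open>auto simp: abs_mult intro!: integrable_mult_right integrable_gamma_mix h\<close>)
    finally show ?thesis .
  qed
  then show ?thesis by blast
qed

lemma has_derivative_gamma_mix:
  fixes h h' :: "'n::finite \<Rightarrow> real \<Rightarrow> real \<Rightarrow> real"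
  assumes h: "\<And>i. h i \<in> gauss_family" "\<And>i. h' i \<in> gauss_family"
    and der: "\<And>i \<tau> r. \<tau> > 0 \<Longrightarrow> (h i \<tau> has_real_derivative h' i \<tau> r) (at r)"
  shows "(gamma_mix z h has_derivative (\<lambda>v. \<Sum>i\<in>UNIV. v $ i * gamma_mix z (h(i := h' i)) x)) (at x)"
proof -
  define P where "P = (\<lambda>i \<tau> (x::real^'n). gamma_weight z \<tau> * (\<Prod>j\<in>UNIV. (h(i := h' i)) j \<tau> (x $ j)))"
  have hb: "(h(i := h' i)) j \<in> gauss_family" for i j using h by simp
  have "\<forall>i. \<exists>B. integrable lborel B \<and> (\<forall>\<tau>. B \<tau> \<ge> 0) \<and> (\<forall>\<tau> x. \<bar>P i \<tau> x\<bar> \<le> B \<tau>)"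
  proof
    fix i
    obtain B where "integrable lborel B" "\<And>\<tau>. B \<tau> \<ge> 0"
      "\<And>\<tau> (x::real^'n). (1 + norm x) ^ 0 * \<bar>gamma_weight z \<tau> * (\<Prod>j\<in>UNIV. (h(i := h' i)) j \<tau> (x $ j))\<bar> \<le> B \<tau>"
      using gamma_mix_integrand_bound[of "h(i := h' i)" 0, OF hb] by blast
    then show "\<exists>B. integrable lborel B \<and> (\<forall>\<tau>. B \<tau> \<ge> 0) \<and> (\<forall>\<tau> x. \<bar>P i \<tau> x\<bar> \<le> B \<tau>)"
      unfolding P_def by (intro exI[of _ B]) simp
  qed
  then obtain B where B: "\<And>i. integrable lborel (B i)" "\<And>i \<tau>. B i \<tau> \<ge> 0" "\<And>i \<tau> x. \<bar>P i \<tau> x\<bar> \<le> B i \<tau>"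
    by metis
  define D where "D = (\<lambda>\<tau> x v. \<Sum>i\<in>UNIV. v $ i * P i \<tau> x)"
  have iP: "integrable lborel (\<lambda>\<tau>. P i \<tau> x)" for i x
    unfolding P_def by (rule integrable_gamma_mix[OF hb])
  have Dle: "\<bar>D \<tau> x v\<bar> \<le> (\<Sum>i\<in>UNIV. B i \<tau>) * norm v" for \<tau> x v
  proof -
    have "\<bar>D \<tau> x v\<bar> \<le> (\<Sum>i\<in>UNIV. norm v * B i \<tau>)"
      unfolding D_def by (intro order_trans[OF sum_abs] sum_mono)
        (use B(2,3) component_le_norm_cart in \<open>auto simp: abs_mult intro!: mult_mono\<close>)
    then show ?thesis by (simp add: sum_distrib_left mult.commute)
  qed
  have derD: "((\<lambda>y. gamma_weight z \<tau> * (\<Prod>i\<in>UNIV. h i \<tau> (y $ i))) has_derivative D \<tau> x) (at x)" for \<tau> and x :: "real^'n"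
  proof (cases "\<tau> > 0")
    case True
    have "((\<lambda>y. \<Prod>i\<in>UNIV. h i \<tau> (y $ i)) has_derivative
       (\<lambda>v. \<Sum>i\<in>UNIV. v $ i * (\<Prod>j\<in>UNIV. ((\<lambda>i. h i \<tau>)(i := h' i \<tau>)) j (x $ j)))) (at x)"
      by (rule has_derivative_prod_vec[of "\<lambda>i. h i \<tau>" "\<lambda>i. h' i \<tau>"]) (rule der[OF True])
    from has_derivative_mult_right[OF this, of "gamma_weight z \<tau>"]
    have "((\<lambda>y. gamma_weight z \<tau> * (\<Prod>i\<in>UNIV. h i \<tau> (y $ i))) has_derivative
       (\<lambda>v. gamma_weight z \<tau> * (\<Sum>i\<in>UNIV. v $ i * (\<Prod>j\<in>UNIV. ((\<lambda>i. h i \<tau>)(i := h' i \<tau>)) j (x $ j))))) (at x)" .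
    moreover have "(\<lambda>v. gamma_weight z \<tau> * (\<Sum>i\<in>UNIV. v $ i * (\<Prod>j\<in>UNIV. ((\<lambda>i. h i \<tau>)(i := h' i \<tau>)) j (x $ j)))) = D \<tau> x"
      unfolding D_def P_def sum_distrib_left
      by (rule ext, rule sum.cong[OF refl], subst mult.left_commute) (auto intro!: prod.cong arg_cong2[where f="(*)"])
    ultimately show ?thesis by simp
  next
    \<comment> \<open>The families are differentiable only for positive \<tau>; elsewhere the weight
      vanishes and both sides are 0.\<close>
    case False
    then have "D \<tau> x = (\<lambda>v. 0)" by (simp add: D_def P_def gamma_weight_def)
    then show ?thesis using False by (simp add: gamma_weight_def)
  qed
  have "((\<lambda>y. LINT \<tau>|lborel. gamma_weight z \<tau> * (\<Prod>i\<in>UNIV. h i \<tau> (y $ i))) has_derivative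
      (\<lambda>v. LINT \<tau>|lborel. D \<tau> x v)) (at x)"
  proof (rule has_derivative_lebesgue_integral[where B="\<lambda>\<tau>. \<Sum>i\<in>UNIV. B i \<tau>"])
    show "integrable lborel (\<lambda>\<tau>. gamma_weight z \<tau> * (\<Prod>i\<in>UNIV. h i \<tau> (y $ i)))" for y
      by (rule integrable_gamma_mix[OF h(1)])
    show "(\<lambda>\<tau>. D \<tau> x v) \<in> borel_measurable lborel" for v
      unfolding D_def using iP[THEN borel_measurable_integrable] by measurable
    show "integrable lborel (\<lambda>\<tau>. \<Sum>i\<in>UNIV. B i \<tau>)" using B(1) by simp
    show "\<bar>gamma_weight z \<tau> * (\<Prod>i\<in>UNIV. h i \<tau> (y $ i)) - gamma_weight z \<tau> * (\<Prod>i\<in>UNIV. h i \<tau> (x $ i))\<bar>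
       \<le> (\<Sum>i\<in>UNIV. B i \<tau>) * norm (y - x)" for y \<tau>
    proof -
      have "onorm (D \<tau> u) \<le> (\<Sum>i\<in>UNIV. B i \<tau>)" for u
        by (rule onorm_bound) (use B(2) Dle in \<open>auto intro: sum_nonneg\<close>)
      from differentiable_bound[OF convex_UNIV derD this, of x y] show ?thesis
        by (simp add: norm_minus_commute)
    qed
  qed (rule derD Dle)+
  moreover have "(LINT \<tau>|lborel. D \<tau> x v) = (\<Sum>i\<in>UNIV. v $ i * gamma_mix z (h(i := h' i)) x)" for v
    unfolding D_def using iP[of _ x] by (simp add: gamma_mix_def P_def)
  ultimately show ?thesis by (simp add: gamma_mix_def[abs_def])
qed

text \<open>Membership in \<open>sobolev\<close> speaks about Schwartz functions only, so the Bessel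
  potential of the probe must be shown to be an admissible test function.\<close>

lemma gamma_mix_schwartz:
  fixes h :: "'n::finite \<Rightarrow> real \<Rightarrow> real \<Rightarrow> real"
  assumes h: "\<And>i. h i \<in> gauss_family"
  shows "(\<lambda>x. complex_of_real (gamma_mix z h x)) \<in> schwartz"
proof -
  define P where "P = {\<lambda>x :: real^'n. complex_of_real (gamma_mix z h x) | h. \<forall>i. h i \<in> gauss_family}"
  have der: "f differentiable_on UNIV \<and> partial_deriv k f \<in> P" if fP: "f \<in> P" for f k
  proof -
    obtain h where f: "f = (\<lambda>x. complex_of_real (gamma_mix z h x))" "\<And>i. h i \<in> gauss_family"
      using fP unfolding P_def by blast
    have "\<forall>i. \<exists>h'\<in>gauss_family. \<forall>\<tau>>0. \<forall>r. (h i \<tau> has_real_derivative h' \<tau> r) (at r)"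
      using gauss_family_deriv[OF f(2)] by blast
    then obtain h' where h': "\<And>i. h' i \<in> gauss_family"
      "\<And>i \<tau> r. \<tau> > 0 \<Longrightarrow> (h i \<tau> has_real_derivative h' i \<tau> r) (at r)"
      by metis
    define D where "D = (\<lambda>(x::real^'n) v. complex_of_real (\<Sum>i\<in>UNIV. v $ i * gamma_mix z (h(i := h' i)) x))"
    have der: "(f has_derivative D x) (at x)" for x
      unfolding f(1) D_def by (intro has_derivative_of_real has_derivative_gamma_mix f(2) h')
    have "D x (axis k 1) = complex_of_real (gamma_mix z (h(k := h' k)) x)" for x
    proof -
      have "(\<Sum>i\<in>UNIV. (axis k 1 :: real^'n) $ i * gamma_mix z (h(i := h' i)) x)
         = (\<Sum>i\<in>UNIV. if i = k then gamma_mix z (h(k := h' k)) x else 0)"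
        by (rule sum.cong) (auto simp: axis_def)
      also have "\<dots> = gamma_mix z (h(k := h' k)) x"
        by (simp only: sum.delta[OF finite] UNIV_I if_True)
      finally show ?thesis unfolding D_def by (rule arg_cong)
    qed
    then have "partial_deriv k f = (\<lambda>x. complex_of_real (gamma_mix z (h(k := h' k)) x))"
      using partial_deriv_eq[OF der] by simp
    moreover have "(\<lambda>x. complex_of_real (gamma_mix z (h(k := h' k)) x)) \<in> P"
      unfolding P_def using f(2) h'(1) by (intro CollectI exI[of _ "h(k := h' k)"]) simp
    moreover have "f differentiable_on UNIV"
      using der by (auto simp: differentiable_on_def differentiable_def)
    ultimately show ?thesis by simp
  qed
  let ?f = "\<lambda>x :: real^'n. complex_of_real (gamma_mix z h x)"
  have fP: "?f \<in> P" unfolding P_def using h by blast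
  have "smooth ?f" by (rule smooth_if_closed_class(1)[OF fP]) (simp_all only: der)
  moreover have "bdd_above (range (\<lambda>x. (1 + norm x) ^ m * norm (partial_derivs is ?f x)))" for m "is"
  proof -
    have "partial_derivs is ?f \<in> P" by (rule smooth_if_closed_class(2)[OF fP]) (simp_all only: der)
    then obtain h where "partial_derivs is ?f = (\<lambda>x. complex_of_real (gamma_mix z h x))" "\<And>i. h i \<in> gauss_family"
      unfolding P_def by blast
    then show ?thesis using gamma_mix_decay[of h m] by (auto simp: bdd_above_def)
  qed
  ultimately show ?thesis by (simp add: schwartz_def)
qed

end

section \<open>Norms and Bessel potentials of the probes\<close>

definition probe_family :: "'n \<Rightarrow> real \<Rightarrow> 'n \<Rightarrow> real \<Rightarrow> real \<Rightarrow> real" where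
  "probe_family k \<epsilon> = (\<lambda>i \<tau> r. if i = k then quint1 (\<epsilon> + \<tau>) r else gauss1 (1 + \<tau>) r)"

text \<open>A positive \<epsilon> keeps the coefficients, negative powers of \<epsilon> + \<tau>,
  bounded for \<tau> > 0. The bounds deteriorate as \<epsilon> tends to 0, but they matter only for
  membership.\<close>

lemma quint1_family:
  assumes \<epsilon>: "\<epsilon> > 0"
  shows "(\<lambda>\<tau>. quint1 (\<epsilon> + \<tau>)) \<in> gauss_family"
proof -
  define \<psi> where "\<psi> = (\<lambda>m \<tau>. 1 / ((\<epsilon> + \<tau>) ^ (3 + m) * sqrt (\<epsilon> + \<tau>)))"
  let ?f = "\<lambda>c m j \<tau> r. (c * \<psi> m \<tau>) * r ^ j * exp (- r\<^sup>2 / (4 * (\<epsilon> + \<tau>)))"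
  have "(\<lambda>\<tau> r. ?f c m j \<tau> r) \<in> gauss_family" for c :: real and m j :: nat
  proof (rule gauss_family.base[OF \<epsilon>, where C="\<bar>c\<bar> * (1 / (\<epsilon> ^ (3 + m) * sqrt \<epsilon>))"])
    show "(\<lambda>\<tau>. c * \<psi> m \<tau>) \<in> borel_measurable borel" unfolding \<psi>_def by measurable
    have "\<psi> m \<tau> \<le> 1 / (\<epsilon> ^ (3 + m) * sqrt \<epsilon>)" "0 \<le> \<psi> m \<tau>" if "\<tau> > 0" for \<tau>
      unfolding \<psi>_def using \<epsilon> that
      by (auto intro!: divide_left_mono mult_mono power_mono mult_pos_pos simp del: power_Suc)
    then show "\<forall>\<tau>>0. \<bar>c * \<psi> m \<tau>\<bar> \<le> \<bar>c\<bar> * (1 / (\<epsilon> ^ (3 + m) * sqrt \<epsilon>))"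
      unfolding abs_mult by (intro allI impI mult_left_mono) (simp_all only: abs_of_nonneg abs_ge_zero)
  qed
  then have "(\<lambda>\<tau> r. (?f (15 / 4) 0 1 \<tau> r + ?f (- 5 / 4) 1 3 \<tau> r) + ?f (1 / 16) 2 5 \<tau> r) \<in> gauss_family"
    by (intro gauss_family.add)
  moreover have "(\<lambda>\<tau> r. (?f (15 / 4) 0 1 \<tau> r + ?f (- 5 / 4) 1 3 \<tau> r) + ?f (1 / 16) 2 5 \<tau> r) = (\<lambda>\<tau>. quint1 (\<epsilon> + \<tau>))"
  proof (intro ext)
    fix \<tau> r
    obtain c where c: "c = \<epsilon> + \<tau>" by blast
    show "(?f (15 / 4) 0 1 \<tau> r + ?f (- 5 / 4) 1 3 \<tau> r) + ?f (1 / 16) 2 5 \<tau> r = quint1 (\<epsilon> + \<tau>) r"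
      unfolding \<psi>_def quint1_def c[symmetric]
      by (cases "c = 0") (simp_all add: field_simps eval_nat_numeral)
  qed
  ultimately show ?thesis by simp
qed

lemma gauss1_family: "(\<lambda>\<tau>. gauss1 (1 + \<tau>)) \<in> gauss_family"
proof -
  have "(\<lambda>\<tau> r. (1 / sqrt (4 * pi * (1 + \<tau>))) * r ^ 0 * exp (- r\<^sup>2 / (4 * (1 + \<tau>)))) \<in> gauss_family"
  proof (rule gauss_family.base[where C="1 / sqrt (4 * pi)"])
    show "\<forall>\<tau>>0. \<bar>1 / sqrt (4 * pi * (1 + \<tau>))\<bar> \<le> 1 / sqrt (4 * pi)"
      by (auto intro!: divide_left_mono)
  qed auto
  then show ?thesis by (simp add: gauss1_def[abs_def])
qed

lemma probe_family_gauss_family: "\<epsilon> > 0 \<Longrightarrow> probe_family k \<epsilon> i \<in> gauss_family"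
  using quint1_family[of \<epsilon>] gauss1_family by (cases "i = k") (simp_all add: probe_family_def)

lemma probe_eq_prod_family: "probe k \<epsilon> \<tau> x = (\<Prod>i\<in>UNIV. probe_family k \<epsilon> i \<tau> (x $ i))"
  unfolding probe_def probe_family_def by simp

lemma probe_pair_measurable [measurable]:
  fixes k :: "'n::finite"
  shows "(\<lambda>p. probe k \<epsilon> (fst p) (snd p)) \<in> borel_measurable (borel \<Otimes>\<^sub>M borel)"
proof -
  have "(\<lambda>p :: real \<times> (real^'n). if i = k then quint1 (\<epsilon> + fst p) (snd p $ i) else gauss1 (1 + fst p) (snd p $ i))
      \<in> borel_measurable (borel \<Otimes>\<^sub>M borel)" for i
  proof -
    have [measurable]: "(\<lambda>x::real^'n. x $ i) \<in> borel_measurable borel"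
      by (intro borel_measurable_continuous_onI continuous_intros)
    have q: "(\<lambda>p :: real \<times> (real^'n). quint1 (\<epsilon> + fst p) (snd p $ i)) \<in> borel_measurable (borel \<Otimes>\<^sub>M borel)"
      unfolding quint1_def by measurable
    have "(\<lambda>p :: real \<times> (real^'n). gauss1 (1 + fst p) (snd p $ i)) \<in> borel_measurable (borel \<Otimes>\<^sub>M borel)"
      unfolding gauss1_def by measurable
    with q show ?thesis by (cases "i = k") simp_all
  qed
  then show ?thesis unfolding probe_def by measurable
qed

abbreviation quint1_moment :: "real \<Rightarrow> real \<Rightarrow> real" where
  "quint1_moment \<beta> q \<equiv> LINT r|lborel. \<bar>r\<bar> powr \<beta> * \<bar>quint1 1 r\<bar> powr q"

lemma quint1_moment_nonneg: "quint1_moment \<beta> q \<ge> 0"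
  by (intro integral_nonneg_AE) simp

lemma gauss1_le_1: "gauss1 (1 + \<tau>) r \<le> 1" if "\<tau> \<ge> 0"
proof -
  have "sqrt 1 \<le> sqrt (4 * pi * (1 + \<tau>))"
    using that pi_ge_two mult_mono[of 1 "4 * pi" 1 "1 + \<tau>"] by (intro real_sqrt_le_mono) auto
  then have 1: "1 \<le> sqrt (4 * pi * (1 + \<tau>))" by (simp only: real_sqrt_one)
  have "exp (- r\<^sup>2 / (4 * (1 + \<tau>))) \<le> 1" using that by simp
  with 1 have "exp (- r\<^sup>2 / (4 * (1 + \<tau>))) \<le> sqrt (4 * pi * (1 + \<tau>))" by linarith
  then show ?thesis unfolding gauss1_def using 1 by (subst divide_le_eq_1_pos) linarith+
qed

text \<open>The tangential factors lie between 0 and 1, so their powers of order \<open>q\<close>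
  are dominated by the factors themselves, which have integral 1. The dependence on \<epsilon> and
  \<tau> is therefore that of the normal factor.\<close>

lemma
  fixes k :: "'n::finite"
  assumes \<epsilon>: "\<epsilon> > 0" and \<tau>: "\<tau> \<ge> 0" and q: "q \<ge> 1"
  shows integrable_probe_powr: "integrable lborel (\<lambda>x. \<bar>probe k \<epsilon> \<tau> x\<bar> powr q)"
    and integral_probe_powr_le: "(LINT x|lborel. \<bar>probe k \<epsilon> \<tau> x\<bar> powr q) \<le> (\<epsilon> + \<tau>) powr (1 / 2 - 3 * q) * quint1_moment 0 q"
proof -
  define F where "F = (\<lambda>i r. \<bar>probe_family k \<epsilon> i \<tau> r\<bar> powr q)"
  \<comment> \<open>Here \<open>0 powr 0 = 0\<close>, so at the origin the identity relies on the
    vanishing of \<open>quint1\<close>.\<close>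
  have p0: "\<bar>r\<bar> powr 0 * \<bar>quint1 a r\<bar> powr q = \<bar>quint1 a r\<bar> powr q" for a r
    by (cases "r = 0") (simp_all add: quint1_def)
  have Fk: "integrable lborel (F k)" "(LINT r|lborel. F k r) = (\<epsilon> + \<tau>) powr (1 / 2 - 3 * q) * quint1_moment 0 q"
    using integrable_powr_quint1[of "\<epsilon> + \<tau>" 0 q, OF _ order_refl q] integral_powr_quint1[of "\<epsilon> + \<tau>" 0 q] \<epsilon> \<tau>
    unfolding F_def probe_family_def p0 by simp_all
  have Fle: "F i r \<le> gauss1 (1 + \<tau>) r" "0 \<le> F i r" if "i \<noteq> k" for i r
  proof -
    have g: "0 \<le> gauss1 (1 + \<tau>) r" "gauss1 (1 + \<tau>) r \<le> 1"
      using \<tau> by (simp_all add: gauss1_nonneg gauss1_le_1)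
    have "gauss1 (1 + \<tau>) r powr q \<le> gauss1 (1 + \<tau>) r powr 1"
      using g q by (intro powr_mono') auto
    then show "F i r \<le> gauss1 (1 + \<tau>) r" using that g by (simp add: F_def probe_family_def)
    show "0 \<le> F i r" by (simp add: F_def)
  qed
  have Fm: "F i \<in> borel_measurable borel" if "i \<noteq> k" for i
    using that unfolding F_def probe_family_def by simp
  have Fi: "integrable lborel (F i)" if "i \<noteq> k" for i
    by (rule Bochner_Integration.integrable_bound[OF integrable_gauss1[of "1 + \<tau>"]])
       (use that Fm \<tau> Fle[OF that] in \<open>auto simp: gauss1_nonneg\<close>)
  have F: "integrable lborel (F i)" for i using Fk Fi by (cases "i = k") auto
  have eq: "\<bar>probe k \<epsilon> \<tau> x\<bar> powr q = (\<Prod>i\<in>UNIV. F i (x $ i))" for x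
    by (simp add: probe_eq_prod_family F_def abs_prod prod_powr_distrib)
  show "integrable lborel (\<lambda>x. \<bar>probe k \<epsilon> \<tau> x\<bar> powr q)"
    unfolding eq by (rule integrable_prod_vec[OF F])
  have "(LINT x|lborel. \<bar>probe k \<epsilon> \<tau> x\<bar> powr q) = (\<Prod>i\<in>UNIV. LINT r|lborel. F i r)"
    unfolding eq by (rule integral_prod_vec[OF F])
  also have "\<dots> = (LINT r|lborel. F k r) * (\<Prod>i\<in>UNIV - {k}. LINT r|lborel. F i r)"
    by (rule prod.remove) auto
  also have "\<dots> \<le> (LINT r|lborel. F k r) * 1"
  proof (intro mult_left_mono prod_le_1)
    fix i assume i: "i \<in> UNIV - {k}"
    have "(LINT r|lborel. F i r) \<le> (LINT r|lborel. gauss1 (1 + \<tau>) r)"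
      by (rule integral_mono) (use F \<tau> i Fle in \<open>auto intro: integrable_gauss1\<close>)
    then show "0 \<le> (LINT r|lborel. F i r) \<and> (LINT r|lborel. F i r) \<le> 1"
      using \<tau> by (simp add: integral_gauss1 integral_nonneg_AE F_def)
  qed (simp add: integral_nonneg_AE F_def)
  finally show "(LINT x|lborel. \<bar>probe k \<epsilon> \<tau> x\<bar> powr q) \<le> (\<epsilon> + \<tau>) powr (1 / 2 - 3 * q) * quint1_moment 0 q"
    by (simp add: Fk(2))
qed

text \<open>Uniform in \<tau> but not in \<epsilon>, which suffices to apply Fubini at fixed
  \<epsilon>.\<close>

lemma integral_abs_probe_le:
  fixes k :: "'n::finite"
  assumes \<epsilon>: "\<epsilon> > 0" and \<tau>: "\<tau> \<ge> 0"
  shows "(LINT x|lborel. \<bar>probe k \<epsilon> \<tau> x\<bar>) \<le> \<epsilon> powr (- (5 / 2)) * quint1_moment 0 1"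
proof -
  have "(LINT x|lborel. \<bar>probe k \<epsilon> \<tau> x\<bar>) \<le> (\<epsilon> + \<tau>) powr (- (5 / 2)) * quint1_moment 0 1"
    using integral_probe_powr_le[OF assms order_refl, of k] by simp
  also have "\<dots> \<le> \<epsilon> powr (- (5 / 2)) * quint1_moment 0 1"
    using assms by (intro mult_right_mono powr_mono2' quint1_moment_nonneg[of 0 1, simplified]) auto
  finally show ?thesis .
qed

context
  fixes k :: "'n::finite" and z \<epsilon> :: real
  assumes z: "z > 0" and \<epsilon>: "\<epsilon> > 0"
begin

lemma integrable_gamma_weight_probe:
  "integrable (lborel \<Otimes>\<^sub>M lborel) (\<lambda>(\<tau>, x). gamma_weight z \<tau> * probe k \<epsilon> \<tau> x)"
proof (rule lborel_pair.Fubini_integrable)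
  show "(\<lambda>(\<tau>, x). gamma_weight z \<tau> * probe k \<epsilon> \<tau> x) \<in> borel_measurable (lborel \<Otimes>\<^sub>M lborel)"
    unfolding case_prod_unfold by measurable
  have i: "integrable lborel (\<lambda>x. gamma_weight z \<tau> * probe k \<epsilon> \<tau> x)" for \<tau>
    using integrable_probe[OF \<epsilon>, of \<tau> k] by (cases "\<tau> > 0") (auto simp: gamma_weight_def)
  then show "AE \<tau> in lborel. integrable lborel (\<lambda>x. case (\<tau>, x) of (\<tau>, x) \<Rightarrow> gamma_weight z \<tau> * probe k \<epsilon> \<tau> x)"
    by simp
  show "integrable lborel (\<lambda>\<tau>. LINT x|lborel. norm (case (\<tau>, x) of (\<tau>, x) \<Rightarrow> gamma_weight z \<tau> * probe k \<epsilon> \<tau> x))"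
  proof (rule Bochner_Integration.integrable_bound)
    show "integrable lborel (\<lambda>\<tau>. gamma_weight z \<tau> * (\<epsilon> powr (- (5 / 2)) * quint1_moment 0 1))"
      using has_bochner_integral_gamma_weight[OF z] by (simp add: has_bochner_integral_iff)
    show "AE \<tau> in lborel. norm (LINT x|lborel. norm (case (\<tau>, x) of (\<tau>, x) \<Rightarrow> gamma_weight z \<tau> * probe k \<epsilon> \<tau> x))
        \<le> norm (gamma_weight z \<tau> * (\<epsilon> powr (- (5 / 2)) * quint1_moment 0 1))"
    proof (rule AE_I2)
      fix \<tau>
      have "(LINT x|lborel. norm (gamma_weight z \<tau> * probe k \<epsilon> \<tau> x)) = gamma_weight z \<tau> * (LINT x|lborel. \<bar>probe k \<epsilon> \<tau> x\<bar>)"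
        using gamma_weight_nonneg[of z \<tau>] by (simp add: abs_mult)
      also have "\<dots> \<le> gamma_weight z \<tau> * (\<epsilon> powr (- (5 / 2)) * quint1_moment 0 1)"
        using integral_abs_probe_le[OF \<epsilon>, of \<tau> k] gamma_weight_nonneg[of z \<tau>]
        by (cases "\<tau> > 0") (auto simp: gamma_weight_def intro!: mult_left_mono)
      finally show "norm (LINT x|lborel. norm (case (\<tau>, x) of (\<tau>, x) \<Rightarrow> gamma_weight z \<tau> * probe k \<epsilon> \<tau> x))
        \<le> norm (gamma_weight z \<tau> * (\<epsilon> powr (- (5 / 2)) * quint1_moment 0 1))"
        by (simp add: integral_nonneg_AE order_trans[OF _ abs_ge_self])
    qed
  qed (unfold case_prod_unfold, measurable)
qed

text \<open>The inverse transform is exchanged with the mixture; every probe contributes the same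
  \<open>probe_hat k \<epsilon> 0\<close> times an exponential, and the exponentials mix to the
  reciprocal of the Bessel symbol. The transforms appear in the order in which the distributional
  operators reach the test function.\<close>

lemma fourier_bessel_gamma_mix:
  "fourier (\<lambda>\<xi>. bessel_symbol (2 * z) \<xi> * inv_fourier (\<lambda>x. complex_of_real (gamma_mix z (probe_family k \<epsilon>) x)) \<xi>) x
    = of_real (Gamma z) * of_real (probe k \<epsilon> 0 x)"
proof -
  let ?N = "complex_of_real ((2 * pi) ^ CARD('n))"
  have inv: "inv_fourier (\<lambda>x. complex_of_real (gamma_mix z (probe_family k \<epsilon>) x)) \<xi>
     = 4 * \<i> * of_real (sqrt pi) / ?N * of_real (probe_hat k \<epsilon> 0 \<xi> * (Gamma z * (1 + (norm \<xi>)\<^sup>2) powr (- z)))" for \<xi> :: "real^'n"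
  proof -
    let ?F = "\<lambda>\<tau> x. exp (\<i> * of_real (\<xi> \<bullet> x)) * complex_of_real (gamma_weight z \<tau> * probe k \<epsilon> \<tau> x)"
    have "integrable (lborel \<Otimes>\<^sub>M lborel) (\<lambda>(\<tau>, x). ?F \<tau> x)"
      by (rule Bochner_Integration.integrable_bound[OF integrable_gamma_weight_probe])
         (unfold case_prod_unfold, measurable, simp add: norm_mult)
    from lborel_pair.Fubini_integral[OF this]
    have "(LINT x|lborel. LINT \<tau>|lborel. ?F \<tau> x) = (LINT \<tau>|lborel. LINT x|lborel. ?F \<tau> x)" .
    also have "(LINT \<tau>|lborel. LINT x|lborel. ?F \<tau> x) = (LINT \<tau>|lborel. 4 * \<i> * of_real (sqrt pi) *
        of_real (probe_hat k \<epsilon> 0 \<xi> * (gamma_weight z \<tau> * exp (- (norm \<xi>)\<^sup>2 * \<tau>))))"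
    proof (rule Bochner_Integration.integral_cong[OF refl])
      fix \<tau>
      show "(LINT x|lborel. ?F \<tau> x) = 4 * \<i> * of_real (sqrt pi) *
        of_real (probe_hat k \<epsilon> 0 \<xi> * (gamma_weight z \<tau> * exp (- (norm \<xi>)\<^sup>2 * \<tau>)))"
      proof (cases "\<tau> > 0")
        case True
        have "(LINT x|lborel. ?F \<tau> x) = (LINT x|lborel. of_real (gamma_weight z \<tau>) * (exp (\<i> * of_real (\<xi> \<bullet> x)) * of_real (probe k \<epsilon> \<tau> x)))"
          by (simp add: mult_ac)
        also have "\<dots> = of_real (gamma_weight z \<tau>) * (4 * \<i> * of_real (sqrt pi) * complex_of_real (probe_hat k \<epsilon> \<tau> \<xi>))"
          by (subst integral_mult_right_zero, subst probe_fourier[OF \<epsilon>]) (use True in auto)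
        finally show ?thesis
          using probe_hat_add[of k \<epsilon> 0 \<tau> \<xi>] by (simp add: mult_ac)
      qed (simp add: gamma_weight_def)
    qed
    also have "\<dots> = 4 * \<i> * of_real (sqrt pi) * of_real (probe_hat k \<epsilon> 0 \<xi> * (LINT \<tau>|lborel. gamma_weight z \<tau> * exp (- (norm \<xi>)\<^sup>2 * \<tau>)))"
      by (simp only: integral_mult_right_zero integral_complex_of_real)
    also have "(LINT \<tau>|lborel. gamma_weight z \<tau> * exp (- (norm \<xi>)\<^sup>2 * \<tau>)) = Gamma z * (1 + (norm \<xi>)\<^sup>2) powr (- z)"
      using zero_le_power2[of "norm \<xi>"] by (intro has_bochner_integral_integral_eq has_bochner_integral_gamma_weight_exp z) linarith
    also have "(LINT x|lborel. LINT \<tau>|lborel. ?F \<tau> x) =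
        (LINT x|lborel. exp (\<i> * of_real (\<xi> \<bullet> x)) * complex_of_real (gamma_mix z (probe_family k \<epsilon>) x))"
      by (simp only: integral_mult_right_zero integral_complex_of_real gamma_mix_def probe_eq_prod_family)
    finally show ?thesis by (simp add: inv_fourier_def)
  qed
  have "bessel_symbol (2 * z) \<xi> * inv_fourier (\<lambda>x. complex_of_real (gamma_mix z (probe_family k \<epsilon>) x)) \<xi>
      = of_real (Gamma z) * (4 * \<i> * of_real (sqrt pi) / ?N) * of_real (probe_hat k \<epsilon> 0 \<xi>)" for \<xi> :: "real^'n"
  proof -
    have "1 + (norm \<xi>)\<^sup>2 > 0" using zero_le_power2[of "norm \<xi>"] by linarith
    then have "(1 + (norm \<xi>)\<^sup>2) powr z * (1 + (norm \<xi>)\<^sup>2) powr (- z) = 1"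
      by (simp add: powr_minus)
    then have "complex_of_real ((1 + (norm \<xi>)\<^sup>2) powr z) * complex_of_real ((1 + (norm \<xi>)\<^sup>2) powr (- z)) = 1"
      by (simp flip: of_real_mult)
    then show ?thesis unfolding inv bessel_symbol_def by (simp add: mult_ac)
  qed
  then have "fourier (\<lambda>\<xi>. bessel_symbol (2 * z) \<xi> * inv_fourier (\<lambda>x. complex_of_real (gamma_mix z (probe_family k \<epsilon>) x)) \<xi>) x
    = (LINT \<xi>|lborel. (of_real (Gamma z) * (4 * \<i> * of_real (sqrt pi) / ?N)) * (exp (- \<i> * of_real (\<xi> \<bullet> x)) * of_real (probe_hat k \<epsilon> 0 \<xi>)))"
    by (simp add: fourier_def mult_ac)
  also have "\<dots> = (of_real (Gamma z) * (4 * \<i> * of_real (sqrt pi) / ?N)) * (probe_const TYPE('n) * complex_of_real (probe k \<epsilon> 0 x))"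
    by (subst integral_mult_right_zero, subst probe_inv_fourier[OF \<epsilon> order_refl]) simp
  also have "\<dots> = of_real (Gamma z) * ((4 * \<i> * of_real (sqrt pi) / ?N) * probe_const TYPE('n)) * complex_of_real (probe k \<epsilon> 0 x)"
    by (simp only: mult.assoc)
  \<comment> \<open>The scalar constants multiply to 2 pi, the one factor that
    \<open>probe_const\<close> lacks for the full power \<open>(2 * pi) ^ CARD('n)\<close>.\<close>
  also have "(4 * \<i> * of_real (sqrt pi) / ?N) * probe_const TYPE('n) = 1"
  proof -
    have "(2 * pi) ^ CARD('n) = 2 * pi * (2 * pi) ^ (CARD('n) - 1)"
      by (simp add: power_eq_if)
    moreover have "complex_of_real (sqrt pi) * of_real (sqrt pi) = of_real pi"
      by (simp flip: of_real_mult)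
    ultimately show ?thesis by (simp add: probe_const_def field_simps power_mult_distrib)
  qed
  finally show ?thesis by simp
qed

end

section \<open>Pairing a Sobolev function with the probes\<close>

lemma young_dual:
  fixes x y p q :: real
  assumes "x \<ge> 0" "y \<ge> 0" "p > 1" "q = p / (p - 1)"
  shows "x * y \<le> x powr p + y powr q"
proof (cases "x = 0 \<or> y = 0")
  case False
  with assms have xy: "x > 0" "y > 0" by auto
  show ?thesis
  \<comment> \<open>Without the factors 1 / p and 1 / q Young's inequality is elementary: on each
    side of the curve y = x^(p-1) one of the two powers alone dominates the product.\<close>
  proof (cases "y \<le> x powr (p - 1)")
    case True
    have "x * y \<le> x * x powr (p - 1)" using True xy by (intro mult_left_mono) auto
    also have "\<dots> = x powr p" using xy powr_add[of x 1 "p - 1"] by simp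
    finally show ?thesis using powr_ge_zero[of y q] by linarith
  next
    case False
    have "x = (x powr (p - 1)) powr (1 / (p - 1))" using xy assms by (simp add: powr_powr)
    also have "\<dots> \<le> y powr (1 / (p - 1))" using False assms by (intro powr_mono2) auto
    finally have "x * y \<le> y powr (1 / (p - 1)) * y" using xy by (intro mult_right_mono) auto
    also have "\<dots> = y powr q"
    proof -
      have "1 / (p - 1) + 1 = q" using assms by (simp add: field_simps)
      then show ?thesis using xy powr_add[of y "1 / (p - 1)" 1] by simp
    qed
    finally show ?thesis using powr_ge_zero[of x p] by linarith
  qed
qed (use assms in auto)

text \<open>Operators on distributions act on the test function by duality, so testing with the
  Gamma mixture places the Bessel operator on it and leaves \<open>u\<close> paired with a multiple
  of the probe itself.\<close>

lemma sobolev_probe_identity: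
  fixes k :: "'n::finite"
  assumes g: "\<And>\<phi>. \<phi> \<in> schwartz \<Longrightarrow>
      inv_fourier_dist (mult_dist (bessel_symbol s) (fourier_dist (dist_of_fun u))) \<phi> = dist_of_fun g \<phi>"
    and s: "s > 0" and \<epsilon>: "\<epsilon> > 0"
  shows "of_real (Gamma (s / 2)) * (LINT x|lborel. u x * of_real (probe k \<epsilon> 0 x))
    = (LINT x|lborel. g x * of_real (gamma_mix (s / 2) (probe_family k \<epsilon>) x))"
proof -
  define z where "z = s / 2"
  have z: "z > 0" "s = 2 * z" using s by (auto simp: z_def)
  let ?\<phi> = "\<lambda>x. complex_of_real (gamma_mix z (probe_family k \<epsilon>) x)"
  have "?\<phi> \<in> schwartz"
    by (rule gamma_mix_schwartz[OF z(1)]) (rule probe_family_gauss_family[OF \<epsilon>])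
  from g[OF this]
  have "(LINT x|lborel. u x * fourier (\<lambda>\<xi>. bessel_symbol (2 * z) \<xi> * inv_fourier ?\<phi> \<xi>) x) = (LINT x|lborel. g x * ?\<phi> x)"
    by (simp add: inv_fourier_dist_def mult_dist_def fourier_dist_def dist_of_fun_def z(2))
  then have "(LINT x|lborel. of_real (Gamma z) * (u x * of_real (probe k \<epsilon> 0 x))) = (LINT x|lborel. g x * ?\<phi> x)"
    by (simp only: fourier_bessel_gamma_mix[OF z(1) \<epsilon>] mult.left_commute)
  then show ?thesis by (simp only: z_def integral_mult_right_zero)
qed

text \<open>Since 1 / q = 1 - 1 / p, the exponent \<open>1 / (2 * q) - 3\<close> equals - 5 / 2 - 1
  / (2 p). Replacing \<epsilon> + \<tau> by \<tau> is allowed because the exponent is negative, and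
  it makes the bound uniform in \<epsilon>.\<close>

lemma nn_integral_Lp_probe_le:
  fixes k :: "'n::finite" and g :: "real^'n \<Rightarrow> complex"
  assumes p: "p > 1" and q: "q = p / (p - 1)" and g: "g \<in> Lp_fun p" and \<epsilon>: "\<epsilon> > 0" and \<tau>: "\<tau> > 0"
  shows "(\<integral>\<^sup>+ x. ennreal (norm (g x) * \<bar>probe k \<epsilon> \<tau> x\<bar>) \<partial>lborel)
     \<le> ennreal ((1 + quint1_moment 0 q) * ((LINT x|lborel. norm (g x) powr p) + 1) * \<tau> powr (1 / (2 * q) - 3))"
proof -
  have [measurable]: "g \<in> borel_measurable borel" and gi: "integrable lborel (\<lambda>x. norm (g x) powr p)"
    using g by (auto simp: Lp_fun_def)
  \<comment> \<open>Adding 1 ensures \<open>c \<ge> 1\<close> whatever the moment, and then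
    \<open>c powr (- q)\<close> times the moment is at most 1.\<close>
  define c where "c = 1 + quint1_moment 0 q"
  define G where "G = (LINT x|lborel. norm (g x) powr p)"
  have c: "c \<ge> 1" using quint1_moment_nonneg[of 0 q] by (simp add: c_def)
  have G: "G \<ge> 0" unfolding G_def by (intro integral_nonneg_AE) simp
  have q1: "q > 1" using p by (simp add: q field_simps)
  define \<kappa> where "\<kappa> = c * (\<epsilon> + \<tau>) powr (1 / (2 * q) - 3)"
  have \<kappa>: "\<kappa> > 0" using c \<epsilon> \<tau> by (simp add: \<kappa>_def)
  have q': "q \<ge> 1" "\<tau> \<ge> 0" using q1 \<tau> by auto
  note iK = integrable_probe_powr[OF \<epsilon> q'(2) q'(1), of k]
  \<comment> \<open>\<open>\<kappa>\<close> bounds the norm of the probe in the dual exponent; scaling by it turns Young's inequality into Hoelder's.\<close>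
  have "(\<integral>\<^sup>+ x. ennreal (norm (g x) * \<bar>probe k \<epsilon> \<tau> x\<bar>) \<partial>lborel)
     \<le> (\<integral>\<^sup>+ x. ennreal (\<kappa> * (norm (g x) powr p + \<kappa> powr (- q) * \<bar>probe k \<epsilon> \<tau> x\<bar> powr q)) \<partial>lborel)"
  proof (rule nn_integral_mono, rule ennreal_leI)
    fix x
    have "norm (g x) * (\<bar>probe k \<epsilon> \<tau> x\<bar> / \<kappa>) \<le> norm (g x) powr p + (\<bar>probe k \<epsilon> \<tau> x\<bar> / \<kappa>) powr q"
      by (rule young_dual) (use p q \<kappa> in auto)
    also have "(\<bar>probe k \<epsilon> \<tau> x\<bar> / \<kappa>) powr q = \<kappa> powr (- q) * \<bar>probe k \<epsilon> \<tau> x\<bar> powr q"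
      by (simp only: powr_divide) (simp add: powr_minus divide_inverse)
    finally have "\<kappa> * (norm (g x) * (\<bar>probe k \<epsilon> \<tau> x\<bar> / \<kappa>)) \<le> \<kappa> * (norm (g x) powr p + \<kappa> powr (- q) * \<bar>probe k \<epsilon> \<tau> x\<bar> powr q)"
      using \<kappa> by (intro mult_left_mono) auto
    then show "norm (g x) * \<bar>probe k \<epsilon> \<tau> x\<bar> \<le> \<kappa> * (norm (g x) powr p + \<kappa> powr (- q) * \<bar>probe k \<epsilon> \<tau> x\<bar> powr q)"
      using \<kappa> by simp
  qed
  also have "\<dots> = ennreal (LINT x|lborel. \<kappa> * (norm (g x) powr p + \<kappa> powr (- q) * \<bar>probe k \<epsilon> \<tau> x\<bar> powr q))"
    by (rule nn_integral_eq_integral) (use \<kappa> gi iK in auto)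
  also have "(LINT x|lborel. \<kappa> * (norm (g x) powr p + \<kappa> powr (- q) * \<bar>probe k \<epsilon> \<tau> x\<bar> powr q))
      = \<kappa> * (G + \<kappa> powr (- q) * (LINT x|lborel. \<bar>probe k \<epsilon> \<tau> x\<bar> powr q))"
    using gi iK by (simp add: G_def)
  also have "\<dots> \<le> \<kappa> * (G + 1)"
  proof -
    have "\<kappa> powr (- q) * (LINT x|lborel. \<bar>probe k \<epsilon> \<tau> x\<bar> powr q)
        \<le> \<kappa> powr (- q) * ((\<epsilon> + \<tau>) powr (1 / 2 - 3 * q) * quint1_moment 0 q)"
      by (intro mult_left_mono integral_probe_powr_le[OF \<epsilon> q'(2) q'(1)]) simp
    also have kq: "\<kappa> powr (- q) = c powr (- q) * (\<epsilon> + \<tau>) powr (- (1 / 2 - 3 * q))"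
    proof -
      have "(1 / (2 * q) - 3) * (- q) = - (1 / 2 - 3 * q)" using q1 by (simp add: field_simps)
      then show ?thesis unfolding \<kappa>_def powr_mult powr_powr by (simp only:)
    qed
    also have "c powr (- q) * (\<epsilon> + \<tau>) powr (- (1 / 2 - 3 * q)) * ((\<epsilon> + \<tau>) powr (1 / 2 - 3 * q) * quint1_moment 0 q)
        = c powr (- q) * quint1_moment 0 q * ((\<epsilon> + \<tau>) powr (- (1 / 2 - 3 * q)) * (\<epsilon> + \<tau>) powr (1 / 2 - 3 * q))"
      by (simp only: mult_ac)
    also have "(\<epsilon> + \<tau>) powr (- (1 / 2 - 3 * q)) * (\<epsilon> + \<tau>) powr (1 / 2 - 3 * q) = 1"
      using \<epsilon> \<tau> by (simp flip: powr_add)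
    also have "c powr (- q) * quint1_moment 0 q * 1 \<le> c powr (- 1) * c"
    proof -
      obtain m where m: "m = quint1_moment 0 q" by blast
      have "m \<ge> 0" "c = 1 + m" using quint1_moment_nonneg[of 0 q] by (simp_all only: m c_def)
      then show ?thesis
        unfolding m[symmetric] mult_1_right using c q1 by (intro mult_mono powr_mono) auto
    qed
    also have "\<dots> = 1" using c by (simp add: powr_minus)
    finally have "\<kappa> powr (- q) * (LINT x|lborel. \<bar>probe k \<epsilon> \<tau> x\<bar> powr q) \<le> 1"
      unfolding kq .
    then show ?thesis using \<kappa> by (intro mult_left_mono) auto
  qed
  also have "\<kappa> * (G + 1) \<le> (c * \<tau> powr (1 / (2 * q) - 3)) * (G + 1)"
  proof -
    have "1 / (2 * q) - 3 \<le> 0" using q1 by (simp add: field_simps)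
    then have "(\<epsilon> + \<tau>) powr (1 / (2 * q) - 3) \<le> \<tau> powr (1 / (2 * q) - 3)"
      using \<epsilon> \<tau> by (intro powr_mono2') auto
    then show ?thesis unfolding \<kappa>_def using c G by (intro mult_right_mono mult_left_mono) auto
  qed
  finally show ?thesis by (simp add: c_def G_def mult_ac ennreal_leI)
qed

lemma sobolev_probe_bounded:
  fixes u :: "real^'n::finite \<Rightarrow> complex" and k :: 'n
  assumes u: "dist_of_fun u \<in> sobolev s p" and p: "p > 1" and s: "s > 5 + 1 / p"
  obtains C where "\<And>\<epsilon>. \<epsilon> > 0 \<Longrightarrow> norm (LINT x|lborel. u x * of_real (probe k \<epsilon> 0 x)) \<le> C"
proof -
  obtain g where g: "g \<in> Lp_fun p" and eq: "\<And>\<phi>. \<phi> \<in> schwartz \<Longrightarrow>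
      inv_fourier_dist (mult_dist (bessel_symbol s) (fourier_dist (dist_of_fun u))) \<phi> = dist_of_fun g \<phi>"
    using u unfolding sobolev_def by blast
  have [measurable]: "g \<in> borel_measurable borel" using g by (simp add: Lp_fun_def)
  define q where "q = p / (p - 1)"
  define z where "z = s / 2"
  \<comment> \<open>The Gamma parameter left after the estimate of the probe norm: it equals s / 2 -
    (5 + 1 / p) / 2, so positivity of \<open>z'\<close> is the threshold on
    \<open>s\<close>.\<close>
  define z' where "z' = z + (1 / (2 * q) - 3)"
  have "1 / p > 0" using p by simp
  then have s0: "s > 0" using s by linarith
  have z: "z > 0" using s0 by (simp add: z_def)
  have "z' = s / 2 - (5 + 1 / p) / 2" using p by (simp add: z'_def z_def q_def field_simps)
  then have z': "z' > 0" using s by simp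
  define D where "D = (1 + quint1_moment 0 q) * ((LINT x|lborel. norm (g x) powr p) + 1)"
  have D: "D \<ge> 0"
    unfolding D_def using quint1_moment_nonneg[of 0 q]
    by (intro mult_nonneg_nonneg add_nonneg_nonneg integral_nonneg_AE) auto
  define C where "C = D * Gamma z' / Gamma z"
  have \<Gamma>: "Gamma z > 0" "Gamma z' > 0" using z z' by (auto intro: Gamma_real_pos)
  have "norm (LINT x|lborel. u x * of_real (probe k \<epsilon> 0 x)) \<le> C" if \<epsilon>: "\<epsilon> > 0" for \<epsilon>
  proof -
    let ?\<phi> = "gamma_mix z (probe_family k \<epsilon>)"
    have \<phi>: "ennreal \<bar>?\<phi> x\<bar> \<le> (\<integral>\<^sup>+ \<tau>. ennreal (gamma_weight z \<tau> * \<bar>probe k \<epsilon> \<tau> x\<bar>) \<partial>lborel)" for x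
    proof -
      have "integrable lborel (\<lambda>\<tau>. gamma_weight z \<tau> * probe k \<epsilon> \<tau> x)"
        unfolding probe_eq_prod_family by (rule integrable_gamma_mix[OF z probe_family_gauss_family[OF \<epsilon>]])
      from integral_norm_bound_ennreal[OF this] show ?thesis
        by (simp add: gamma_mix_def probe_eq_prod_family abs_mult gamma_weight_nonneg)
    qed
    \<comment> \<open>The integral of a non-integrable function is 0, so the inequality holds before
      any integrability is established; from here on everything is nonnegative and Tonelli
      applies.\<close>
    have "ennreal (norm (LINT x|lborel. g x * of_real (?\<phi> x))) \<le> (\<integral>\<^sup>+ x. ennreal (norm (g x * of_real (?\<phi> x))) \<partial>lborel)"
      by (cases "integrable lborel (\<lambda>x. g x * of_real (?\<phi> x))")
         (auto intro: integral_norm_bound_ennreal simp: not_integrable_integral_eq)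
    also have "\<dots> \<le> (\<integral>\<^sup>+ x. \<integral>\<^sup>+ \<tau>. ennreal (norm (g x) * (gamma_weight z \<tau> * \<bar>probe k \<epsilon> \<tau> x\<bar>)) \<partial>lborel \<partial>lborel)"
    proof (rule nn_integral_mono)
      fix x
      have [measurable]: "(\<lambda>\<tau>. probe k \<epsilon> \<tau> x) \<in> borel_measurable borel"
        using measurable_compose[OF _ probe_pair_measurable, of "\<lambda>\<tau>. (\<tau>, x)" borel] by simp
      have "ennreal (norm (g x * of_real (?\<phi> x))) = ennreal (norm (g x)) * ennreal \<bar>?\<phi> x\<bar>"
        by (simp add: norm_mult ennreal_mult)
      also have "\<dots> \<le> ennreal (norm (g x)) * (\<integral>\<^sup>+ \<tau>. ennreal (gamma_weight z \<tau> * \<bar>probe k \<epsilon> \<tau> x\<bar>) \<partial>lborel)"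
        by (intro mult_left_mono \<phi>) simp
      also have "\<dots> = (\<integral>\<^sup>+ \<tau>. ennreal (norm (g x) * (gamma_weight z \<tau> * \<bar>probe k \<epsilon> \<tau> x\<bar>)) \<partial>lborel)"
        by (subst nn_integral_cmult[symmetric]) (auto simp: ennreal_mult' gamma_weight_nonneg)
      finally show "ennreal (norm (g x * of_real (?\<phi> x))) \<le> (\<integral>\<^sup>+ \<tau>. ennreal (norm (g x) * (gamma_weight z \<tau> * \<bar>probe k \<epsilon> \<tau> x\<bar>)) \<partial>lborel)" .
    qed
    also have "\<dots> = (\<integral>\<^sup>+ \<tau>. \<integral>\<^sup>+ x. ennreal (norm (g x) * (gamma_weight z \<tau> * \<bar>probe k \<epsilon> \<tau> x\<bar>)) \<partial>lborel \<partial>lborel)"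
    proof (rule lborel_pair.Fubini')
      have "(\<lambda>p. ennreal (norm (g (snd p)) * (gamma_weight z (fst p) * \<bar>probe k \<epsilon> (fst p) (snd p)\<bar>)))
          \<in> borel_measurable (borel \<Otimes>\<^sub>M borel)" by measurable
      then show "(\<lambda>(\<tau>, x). ennreal (norm (g x) * (gamma_weight z \<tau> * \<bar>probe k \<epsilon> \<tau> x\<bar>))) \<in> borel_measurable (lborel \<Otimes>\<^sub>M lborel)"
        by (simp add: case_prod_unfold)
    qed
    also have "\<dots> \<le> (\<integral>\<^sup>+ \<tau>. ennreal (D * gamma_weight z' \<tau>) \<partial>lborel)"
    proof (rule nn_integral_mono)
      fix \<tau>
      show "(\<integral>\<^sup>+ x. ennreal (norm (g x) * (gamma_weight z \<tau> * \<bar>probe k \<epsilon> \<tau> x\<bar>)) \<partial>lborel) \<le> ennreal (D * gamma_weight z' \<tau>)"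
      proof (cases "\<tau> > 0")
        case True
        have "(\<integral>\<^sup>+ x. ennreal (norm (g x) * (gamma_weight z \<tau> * \<bar>probe k \<epsilon> \<tau> x\<bar>)) \<partial>lborel)
            = (\<integral>\<^sup>+ x. ennreal (gamma_weight z \<tau>) * ennreal (norm (g x) * \<bar>probe k \<epsilon> \<tau> x\<bar>) \<partial>lborel)"
          by (rule nn_integral_cong) (simp add: gamma_weight_nonneg mult_ac flip: ennreal_mult)
        also have "\<dots> = ennreal (gamma_weight z \<tau>) * (\<integral>\<^sup>+ x. ennreal (norm (g x) * \<bar>probe k \<epsilon> \<tau> x\<bar>) \<partial>lborel)"
          by (rule nn_integral_cmult) measurable
        also have "\<dots> \<le> ennreal (gamma_weight z \<tau>) * ennreal (D * \<tau> powr (1 / (2 * q) - 3))"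
          unfolding D_def by (intro mult_left_mono nn_integral_Lp_probe_le[OF p q_def g \<epsilon> True]) simp
        also have "\<dots> = ennreal (gamma_weight z \<tau> * (D * \<tau> powr (1 / (2 * q) - 3)))"
          using D by (simp add: gamma_weight_nonneg ennreal_mult)
        also have "gamma_weight z \<tau> * (D * \<tau> powr (1 / (2 * q) - 3)) = D * gamma_weight z' \<tau>"
        proof -
          have "z' - 1 = (z - 1) + (1 / (2 * q) - 3)" by (simp add: z'_def)
          then have "\<tau> powr (z' - 1) = \<tau> powr (z - 1) * \<tau> powr (1 / (2 * q) - 3)" by (simp only: powr_add)
          then show ?thesis using True by (simp add: gamma_weight_def)
        qed
        finally show ?thesis .
      qed (simp add: gamma_weight_def)
    qed
    also have "\<dots> = ennreal (D * Gamma z')"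
      using has_bochner_integral_gamma_weight[OF z'] D
      by (subst nn_integral_eq_integral) (auto simp: has_bochner_integral_iff gamma_weight_nonneg)
    finally have "norm (LINT x|lborel. g x * of_real (?\<phi> x)) \<le> D * Gamma z'"
      using D \<Gamma> by (simp add: ennreal_le_iff)
    then have "Gamma z * norm (LINT x|lborel. u x * of_real (probe k \<epsilon> 0 x)) \<le> D * Gamma z'"
    proof -
      have "norm (LINT x|lborel. g x * of_real (?\<phi> x)) = norm (complex_of_real (Gamma z) * (LINT x|lborel. u x * of_real (probe k \<epsilon> 0 x)))"
        unfolding z_def by (rule arg_cong[OF sobolev_probe_identity[OF eq s0 \<epsilon>, of k], symmetric])
      also have "\<dots> = Gamma z * norm (LINT x|lborel. u x * of_real (probe k \<epsilon> 0 x))"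
        unfolding norm_mult norm_of_real abs_of_pos[OF \<Gamma>(1)] ..
      finally show ?thesis using \<open>norm (LINT x|lborel. g x * of_real (?\<phi> x)) \<le> D * Gamma z'\<close> by simp
    qed
    then show ?thesis using \<Gamma> by (simp add: C_def field_simps)
  qed
  then show ?thesis by (rule that)
qed

section \<open>The heat semigroup on odd functions\<close>

lemma DERIV_abs_powr_power:
  fixes \<alpha> x :: real
  assumes \<alpha>: "\<alpha> > 0"
  shows "((\<lambda>r. \<bar>r\<bar> powr \<alpha> * r ^ Suc (Suc j)) has_real_derivative (\<alpha> + real (Suc (Suc j))) * (\<bar>x\<bar> powr \<alpha> * x ^ Suc j)) (at x)"
proof -
  consider "x > 0" | "x < 0" | "x = 0" by linarith
  then show ?thesis
  proof cases
    case 1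
    have "((\<lambda>r. r powr \<alpha> * r ^ Suc (Suc j)) has_real_derivative (\<alpha> + real (Suc (Suc j))) * (x powr \<alpha> * x ^ Suc j)) (at x)"
    proof -
      have "x powr (\<alpha> - 1) * x = x powr \<alpha>" using 1 powr_add[of x "\<alpha> - 1" 1] by simp
      then have "\<alpha> * x powr (\<alpha> - 1) * x ^ Suc (Suc j) = \<alpha> * (x powr \<alpha> * x ^ Suc j)"
        by (simp add: mult_ac)
      then show ?thesis
        using 1 by (auto intro!: derivative_eq_intros simp del: power_Suc of_nat_Suc) (simp add: algebra_simps)
    qed
    from has_field_derivative_transform_within_open[OF this open_greaterThan, of 0] 1 show ?thesis by simp
  next
    case 2
    have "((\<lambda>r. (- r) powr \<alpha> * r ^ Suc (Suc j)) has_real_derivative (\<alpha> + real (Suc (Suc j))) * ((- x) powr \<alpha> * x ^ Suc j)) (at x)"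
    proof -
      have "(- x) powr (\<alpha> - 1) * x = - ((- x) powr \<alpha>)" using 2 powr_add[of "- x" "\<alpha> - 1" 1] by simp
      then have "\<alpha> * (- x) powr (\<alpha> - 1) * x ^ Suc (Suc j) = - (\<alpha> * ((- x) powr \<alpha> * x ^ Suc j))"
        by (simp add: mult.assoc[symmetric]) (simp add: mult_ac)
      then show ?thesis
        using 2 by (auto intro!: derivative_eq_intros simp del: power_Suc of_nat_Suc) (simp add: algebra_simps)
    qed
    from has_field_derivative_transform_within_open[OF this open_lessThan, of 0] 2 show ?thesis by simp
  next
    case 3
    \<comment> \<open>At the origin the difference quotient is itself a function of this form,
      continuous with value 0 there.\<close>
    have c: "continuous_on UNIV (\<lambda>h::real. \<bar>h\<bar> powr \<alpha> * h ^ Suc j)"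
      using \<alpha> by (intro continuous_intros continuous_on_powr') auto
    have "((\<lambda>h. \<bar>h\<bar> powr \<alpha> * h ^ Suc j) \<longlongrightarrow> \<bar>0\<bar> powr \<alpha> * 0 ^ Suc j) (at (0::real))"
      using c unfolding continuous_on_def by blast
    moreover have "\<forall>\<^sub>F h in at (0::real). \<bar>h\<bar> powr \<alpha> * h ^ Suc j = (\<bar>0 + h\<bar> powr \<alpha> * (0 + h) ^ Suc (Suc j) - \<bar>0\<bar> powr \<alpha> * 0 ^ Suc (Suc j)) / h"
      by (simp add: eventually_at_filter)
    ultimately have "((\<lambda>h. (\<bar>0 + h\<bar> powr \<alpha> * (0 + h) ^ Suc (Suc j) - \<bar>0\<bar> powr \<alpha> * 0 ^ Suc (Suc j)) / h) \<longlongrightarrow> \<bar>0\<bar> powr \<alpha> * 0 ^ Suc j) (at (0::real))"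
      by (rule Lim_transform_eventually)
    then show ?thesis using 3 by (simp add: DERIV_def)
  qed
qed

definition gauss_moment :: "real \<Rightarrow> nat \<Rightarrow> real" where
  "gauss_moment \<alpha> j = (LINT r|lborel. \<bar>r\<bar> powr \<alpha> * r ^ j * exp (- (1 / 4) * r\<^sup>2))"

lemma abs_powr_power_le:
  fixes \<alpha> r :: real
  assumes "\<alpha> \<ge> 0"
  shows "\<bar>r\<bar> powr \<alpha> * \<bar>r\<bar> ^ j \<le> (1 + \<bar>r\<bar>) ^ (nat \<lceil>\<alpha>\<rceil> + j)"
proof -
  have "\<bar>r\<bar> powr \<alpha> \<le> (1 + \<bar>r\<bar>) powr \<alpha>" using assms by (intro powr_mono2) auto
  also have "\<dots> \<le> (1 + \<bar>r\<bar>) powr real (nat \<lceil>\<alpha>\<rceil>)" by (intro powr_mono real_nat_ceiling_ge) auto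
  also have "\<dots> = (1 + \<bar>r\<bar>) ^ nat \<lceil>\<alpha>\<rceil>" by (simp add: powr_realpow)
  finally have "\<bar>r\<bar> powr \<alpha> * \<bar>r\<bar> ^ j \<le> (1 + \<bar>r\<bar>) ^ nat \<lceil>\<alpha>\<rceil> * (1 + \<bar>r\<bar>) ^ j"
    by (intro mult_mono power_mono) auto
  then show ?thesis by (simp add: power_add)
qed

lemma norm_gauss_moment_integrand:
  fixes \<alpha> r :: real
  assumes "\<alpha> \<ge> 0"
  shows "norm (\<bar>r\<bar> powr \<alpha> * r ^ j * exp (- (1 / 4) * r\<^sup>2)) \<le> 1 * ((1 + \<bar>r\<bar>) ^ (nat \<lceil>\<alpha>\<rceil> + j) * exp (- (1 / 4) * r\<^sup>2))"
  using abs_powr_power_le[OF assms, of r j] by (simp add: abs_mult power_abs)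

lemma integrable_gauss_moment:
  fixes \<alpha> :: real
  assumes "\<alpha> \<ge> 0"
  shows "integrable lborel (\<lambda>r::real. \<bar>r\<bar> powr \<alpha> * r ^ j * exp (- (1 / 4) * r\<^sup>2))"
  by (rule integrable_gauss_le[OF _ _ norm_gauss_moment_integrand[OF assms]]) auto

text \<open>Integration by parts for \<open>\<bar>r\<bar> powr \<alpha> * r ^ (j + 2)\<close> times
  the Gaussian. It expresses all the moments occurring in \<open>quint1\<close> by the one of order
  2.\<close>

lemma gauss_moment_rec:
  assumes \<alpha>: "\<alpha> > 0"
  shows "gauss_moment \<alpha> (j + 3) = 2 * (\<alpha> + real j + 2) * gauss_moment \<alpha> (j + 1)"
proof -
  define f where "f = (\<lambda>r::real. (\<alpha> + real (Suc (Suc j))) * (\<bar>r\<bar> powr \<alpha> * r ^ Suc j * exp (- (1 / 4) * r\<^sup>2))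
      - 1 / 2 * (\<bar>r\<bar> powr \<alpha> * r ^ (j + 3) * exp (- (1 / 4) * r\<^sup>2)))"
  have \<alpha>0: "\<alpha> \<ge> 0" using \<alpha> by simp
  have "(LINT r|lborel. f r) = 0"
  proof (rule integral_real_line_derivative)
    let ?F = "\<lambda>r::real. \<bar>r\<bar> powr \<alpha> * r ^ Suc (Suc j) * exp (- (1 / 4) * r\<^sup>2)"
    show "(?F has_vector_derivative f x) (at x)" for x
    proof -
      have E: "((\<lambda>r. exp (- (1 / 4) * r\<^sup>2)) has_real_derivative (exp (- (1 / 4) * x\<^sup>2) * (- (1 / 2) * x))) (at x)"
        by (auto intro!: derivative_eq_intros)
      have "(?F has_real_derivative f x) (at x)"
        by (rule DERIV_cong[OF DERIV_mult[OF DERIV_abs_powr_power[OF \<alpha>, of j x] E]])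
           (simp add: f_def algebra_simps power_add eval_nat_numeral)
      then show ?thesis by (simp add: has_real_derivative_iff_has_vector_derivative)
    qed
    show "continuous_on UNIV f"
      unfolding f_def using \<alpha> by (intro continuous_intros continuous_on_powr') auto
    show "integrable lborel f"
      unfolding f_def by (intro Bochner_Integration.integrable_diff integrable_mult_right integrable_gauss_moment \<alpha>0)
    show "(?F \<longlongrightarrow> 0) at_top" "(?F \<longlongrightarrow> 0) at_bot"
      by (rule tendsto_0_poly_gauss[OF _ norm_gauss_moment_integrand[OF \<alpha>0, where j="Suc (Suc j)"]]; simp)+
  qed
  moreover have "(LINT r|lborel. f r) = (\<alpha> + real (Suc (Suc j))) * gauss_moment \<alpha> (Suc j) - 1 / 2 * gauss_moment \<alpha> (j + 3)"
    unfolding f_def gauss_moment_def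
    by (simp only: Bochner_Integration.integral_diff integral_mult_right_zero integrable_gauss_moment[OF \<alpha>0] integrable_mult_right)
  ultimately show ?thesis by (simp add: algebra_simps)
qed

lemma gauss_moment_2_pos:
  assumes "\<alpha> > 0"
  shows "gauss_moment \<alpha> 2 > 0"
proof -
  have \<alpha>0: "\<alpha> \<ge> 0" using assms by simp
  define c where "c = exp (- (1 :: real))"
  have "0 < c * 1" by (simp add: c_def)
  also have "c * 1 = (LINT r|lborel. c * indicator {1..2::real} r)" by simp
  also have "\<dots> \<le> gauss_moment \<alpha> 2"
    unfolding gauss_moment_def
  proof (rule integral_mono)
    show "integrable lborel (\<lambda>r. c * indicator {1..2::real} r)" by simp
    show "c * indicator {1..2} r \<le> \<bar>r\<bar> powr \<alpha> * r\<^sup>2 * exp (- (1 / 4) * r\<^sup>2)" for r :: real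
    proof (cases "r \<in> {1..2}")
      case True
      have "r\<^sup>2 \<le> 2\<^sup>2" using True by (intro power_mono) auto
      then have "c \<le> exp (- (1 / 4) * r\<^sup>2)" by (simp add: c_def)
      moreover have "1 * 1 \<le> \<bar>r\<bar> powr \<alpha> * r\<^sup>2"
        using True \<alpha>0 by (intro mult_mono) (auto intro: ge_one_powr_ge_zero one_le_power)
      ultimately have "1 * c \<le> (\<bar>r\<bar> powr \<alpha> * r\<^sup>2) * exp (- (1 / 4) * r\<^sup>2)"
        by (intro mult_mono) (auto simp: c_def)
      then show ?thesis using True by simp
    qed simp
  qed (rule integrable_gauss_moment[OF \<alpha>0])
  finally show ?thesis .
qed

text \<open>The zeros at \<alpha> = 0 and \<alpha> = 2 are no accident: there
  \<open>\<bar>r\<bar> powr \<alpha> * r\<close> is, up to the value at 0, the polynomial r or r^3,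
  which a fifth derivative annihilates. Between them the sign is fixed, and this drives the whole
  argument.\<close>

definition quint_const :: "real \<Rightarrow> real" where
  "quint_const \<alpha> = gauss_moment \<alpha> 2 * \<alpha> * (2 - \<alpha>) / 4"

lemma quint_const_pos: "0 < \<alpha> \<Longrightarrow> \<alpha> < 2 \<Longrightarrow> quint_const \<alpha> > 0"
  using gauss_moment_2_pos[of \<alpha>] by (simp add: quint_const_def)

text \<open>At scale 1 the moment recurrence reduces the polynomial in \<open>quint1\<close> to
  \<alpha> (\<alpha> - 2) / 4 times the moment of order 2. The power of \<open>a\<close> follows by
  scaling: 1 / 2 for the Jacobian, (\<alpha> + 1) / 2 for the function and - 3 for the
  amplitude.\<close>

lemma integral_quint1_odd_power:
  assumes \<alpha>: "\<alpha> > 0" and a: "a > 0"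
  shows "(LINT r|lborel. \<bar>r\<bar> powr \<alpha> * r * quint1 a r) = - quint_const \<alpha> * a powr (\<alpha> / 2 - 2)"
proof -
  have \<alpha>0: "\<alpha> \<ge> 0" using \<alpha> by simp
  let ?g = "\<lambda>j (r::real). \<bar>r\<bar> powr \<alpha> * r ^ j * exp (- (1 / 4) * r\<^sup>2)"
  have "\<bar>r\<bar> powr \<alpha> * r * quint1 1 r = 15 / 4 * ?g 2 r - 5 / 4 * ?g 4 r + 1 / 16 * ?g 6 r" for r
    by (simp add: quint1_def algebra_simps eval_nat_numeral)
  then have "(LINT r|lborel. \<bar>r\<bar> powr \<alpha> * r * quint1 1 r) = 15 / 4 * gauss_moment \<alpha> 2 - 5 / 4 * gauss_moment \<alpha> 4 + 1 / 16 * gauss_moment \<alpha> 6"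
    unfolding gauss_moment_def
    by (simp only: Bochner_Integration.integral_add Bochner_Integration.integral_diff integral_mult_right_zero
        integrable_gauss_moment[OF \<alpha>0] integrable_mult_right Bochner_Integration.integrable_diff)
  moreover have "gauss_moment \<alpha> 4 = 2 * (\<alpha> + 3) * gauss_moment \<alpha> 2"
    using gauss_moment_rec[OF \<alpha>, of 1] by (simp add: numeral_2_eq_2 add.commute)
  moreover have "gauss_moment \<alpha> 6 = 2 * (\<alpha> + 5) * gauss_moment \<alpha> 4"
    using gauss_moment_rec[OF \<alpha>, of 3] by (simp add: add.commute)
  ultimately have 1: "(LINT r|lborel. \<bar>r\<bar> powr \<alpha> * r * quint1 1 r) = - quint_const \<alpha>"
    by (simp add: quint_const_def algebra_simps) (simp add: field_simps)
  have "(LINT r|lborel. \<bar>r\<bar> powr \<alpha> * r * quint1 a r)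
      = sqrt a * (LINT r|lborel. \<bar>sqrt a * r\<bar> powr \<alpha> * (sqrt a * r) * (quint1 1 r / a ^ 3))"
    by (rule integral_quint1_scale[OF a, where F="\<lambda>r y. \<bar>r\<bar> powr \<alpha> * r * y"])
  also have "\<dots> = sqrt a * (LINT r|lborel. (a powr (\<alpha> / 2) * sqrt a / a ^ 3) * (\<bar>r\<bar> powr \<alpha> * r * quint1 1 r))"
  proof -
    have "\<bar>sqrt a * r\<bar> powr \<alpha> * (sqrt a * r) * (quint1 1 r / a ^ 3)
      = (a powr (\<alpha> / 2) * sqrt a / a ^ 3) * (\<bar>r\<bar> powr \<alpha> * r * quint1 1 r)" for r
    proof -
      have "\<bar>sqrt a * r\<bar> powr \<alpha> = a powr (\<alpha> / 2) * \<bar>r\<bar> powr \<alpha>"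
        using a by (simp add: abs_mult powr_mult powr_half_sqrt[symmetric] powr_powr)
      then show ?thesis by simp
    qed
    then show ?thesis by (simp only:)
  qed
  also have "sqrt a * (LINT r|lborel. (a powr (\<alpha> / 2) * sqrt a / a ^ 3) * (\<bar>r\<bar> powr \<alpha> * r * quint1 1 r))
      = (sqrt a * sqrt a) * a powr (\<alpha> / 2) / a ^ 3 * - quint_const \<alpha>"
    by (subst integral_mult_right_zero) (simp add: 1)
  also have "(sqrt a * sqrt a) * a powr (\<alpha> / 2) / a ^ 3 = a powr (\<alpha> / 2 - 2)"
  proof -
    have "a powr (\<alpha> / 2) = a powr (\<alpha> / 2 - 2) * a\<^sup>2"
      using a powr_add[of a "\<alpha> / 2 - 2" 2] by (simp add: powr_numeral)
    then show ?thesis using a by (simp add: eval_nat_numeral)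
  qed
  finally show ?thesis by simp
qed

section \<open>Linear vanishing of heat flows at the hyperplane\<close>

lemma integral_translate:
  fixes f :: "'a::euclidean_space \<Rightarrow> 'b::{banach,second_countable_topology}"
  assumes [measurable]: "f \<in> borel_measurable borel"
  shows "(LINT y|lborel. f (c + y)) = (LINT y|lborel. f y)"
  using integral_reflect_at[of f c] integral_reflect_at[of "\<lambda>y. f (c - y)" 0] by simp

lemma integrable_translate:
  fixes f :: "'a::euclidean_space \<Rightarrow> 'b::{banach,second_countable_topology}"
  assumes f: "integrable lborel f"
  shows "integrable lborel (\<lambda>y. f (c + y))"
  using integrable_reflect_at[OF integrable_reflect_at[OF f, of c], of 0] by simp

lemma exp_diff_le: "\<bar>exp (- a) - exp (- b)\<bar> \<le> \<bar>a - b\<bar> * (exp (- a) + exp (- b))" for a b :: real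
proof -
  have *: "\<bar>exp (- a) - exp (- b)\<bar> \<le> \<bar>a - b\<bar> * (exp (- a) + exp (- b))" if "a \<le> b" for a b :: real
  proof -
    have "exp (- a) - exp (- b) = exp (- a) * (1 - exp (- (b - a)))"
      by (simp add: algebra_simps flip: exp_add)
    also have "\<dots> \<le> exp (- a) * (b - a)"
    proof (rule mult_left_mono)
      show "1 - exp (- (b - a)) \<le> b - a" using exp_ge_add_one_self[of "- (b - a)"] by linarith
    qed simp
    also have "\<dots> \<le> \<bar>a - b\<bar> * (exp (- a) + exp (- b))" using that by (simp add: algebra_simps)
    finally show ?thesis using that by simp
  qed
  show ?thesis using *[of a b] *[of b a] by (cases "a \<le> b") (auto simp: abs_minus_commute add.commute)
qed

text \<open>The exponents differ by s (s + 2 x_k) / 4. Since \<open>\<bar>s\<bar> \<le> 1\<close>,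
  the second factor is controlled at either endpoint, and the bound separates into one function
  evaluated at both points; by translation invariance the two parts have the same integral.\<close>

lemma heat_kernel_shift_le:
  fixes x :: "real^'n::finite"
  assumes s: "\<bar>s\<bar> \<le> 1"
  shows "\<bar>heat_kernel 1 (s *\<^sub>R axis k 1 + x) - heat_kernel 1 x\<bar>
    \<le> \<bar>s\<bar> / 4 * ((2 * norm (s *\<^sub>R axis k 1 + x) + 1) * heat_kernel 1 (s *\<^sub>R axis k 1 + x) + (2 * norm x + 1) * heat_kernel 1 x)"
proof -
  define y where "y = s *\<^sub>R axis k 1 + x"
  define C where "C = (4 * pi) powr (- real CARD('n) / 2)"
  have K: "heat_kernel 1 v = C * exp (- ((norm v)\<^sup>2 / 4))" for v :: "real^'n"
    by (simp add: heat_kernel_def C_def)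
  have C: "C \<ge> 0" by (simp add: C_def)
  have "(norm y)\<^sup>2 = s\<^sup>2 + 2 * s * (x $ k) + (norm x)\<^sup>2"
    unfolding power2_norm_eq_inner y_def
    by (simp add: inner_simps inner_axis inner_axis' inner_commute power2_eq_square algebra_simps)
  then have d: "(norm y)\<^sup>2 / 4 - (norm x)\<^sup>2 / 4 = s / 4 * (s + 2 * (x $ k))"
    by (simp add: field_simps power2_eq_square)
  have yk: "y $ k = s + x $ k" by (simp add: y_def axis_def)
  have 1: "\<bar>s + 2 * (x $ k)\<bar> \<le> 2 * norm x + 1"
    using component_le_norm_cart[of x k] s by linarith
  have 2: "\<bar>s + 2 * (x $ k)\<bar> \<le> 2 * norm y + 1"
    using component_le_norm_cart[of y k] s unfolding yk by linarith
  have "\<bar>heat_kernel 1 y - heat_kernel 1 x\<bar> = C * \<bar>exp (- ((norm y)\<^sup>2 / 4)) - exp (- ((norm x)\<^sup>2 / 4))\<bar>"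
    using C by (simp add: K abs_mult flip: right_diff_distrib)
  also have "\<dots> \<le> C * (\<bar>(norm y)\<^sup>2 / 4 - (norm x)\<^sup>2 / 4\<bar> * (exp (- ((norm y)\<^sup>2 / 4)) + exp (- ((norm x)\<^sup>2 / 4))))"
    by (intro mult_left_mono exp_diff_le C)
  also have "\<dots> = \<bar>s\<bar> / 4 * (\<bar>s + 2 * (x $ k)\<bar> * heat_kernel 1 y + \<bar>s + 2 * (x $ k)\<bar> * heat_kernel 1 x)"
  proof -
    obtain A where A: "A = \<bar>s + 2 * (x $ k)\<bar>" by blast
    have e: "\<bar>s / 4 * (s + 2 * (x $ k))\<bar> = \<bar>s\<bar> / 4 * A" by (simp add: abs_mult A)
    show ?thesis unfolding d e K A[symmetric] by (simp add: algebra_simps)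
  qed
  also have "\<dots> \<le> \<bar>s\<bar> / 4 * ((2 * norm y + 1) * heat_kernel 1 y + (2 * norm x + 1) * heat_kernel 1 x)"
    by (intro mult_left_mono add_mono mult_right_mono 1 2 heat_kernel_nonneg) auto
  finally show ?thesis by (simp add: y_def)
qed

text \<open>
  An odd function has a heat flow vanishing at the projection of \<open>x\<close> to the hyperplane, and moving \<open>x\<close>
  there shifts the kernel by \<open>x $ k / sqrt t\<close>.
\<close>

lemma heat_odd_le:
  fixes h :: "(real^'n::finite) \<Rightarrow>\<^sub>C complex"
  assumes h: "h \<in> C0_odd k" and t: "t > 0"
  shows "norm (heat t h x) \<le> (1 + heat_moment TYPE('n)) * norm h * (\<bar>x $ k\<bar> / sqrt t)"
proof -
  define M where "M = heat_moment TYPE('n)"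
  have M: "M \<ge> 0" unfolding M_def by (rule heat_moment_nonneg)
  define s where "s = x $ k / sqrt t"
  have st: "sqrt t > 0" using t by simp
  have s_abs: "\<bar>s\<bar> = \<bar>x $ k\<bar> / sqrt t" using t by (simp add: s_def)
  show ?thesis
  \<comment> \<open>For larger shifts the claim is weaker than the sup norm bound.\<close>
  proof (cases "\<bar>s\<bar> \<le> 1")
    case False
    have "norm (heat t h x) \<le> norm h * 1"
      using norm_heat_le[of h "norm h" t x] t by (simp add: norm_bounded)
    also have "\<dots> \<le> norm h * \<bar>s\<bar>" using False by (intro mult_left_mono) auto
    also have "\<dots> \<le> (1 + M) * (norm h * \<bar>s\<bar>)" using M by (simp add: algebra_simps)
    finally show ?thesis by (simp add: s_abs M_def mult.assoc)
  next
    case True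
    define y where "y = x - (x $ k) *\<^sub>R axis k 1"
    define e where "e = s *\<^sub>R (axis k 1 :: real^'n)"
    have "reflect k y = y" by (simp add: vec_eq_iff y_def axis_def)
    then have "heat t h y = - heat t h y"
      using heat_odd[of h k t y] h t by (simp add: C0_odd_def)
    then have hy: "heat t h y = 0" by simp
    have xe: "x - sqrt t *\<^sub>R (e + w) = y - sqrt t *\<^sub>R w" for w
      using st by (simp add: y_def e_def s_def algebra_simps)
    let ?G = "\<lambda>w. of_real (heat_kernel 1 (e + w)) * h (y - sqrt t *\<^sub>R w)"
    let ?H = "\<lambda>w. of_real (heat_kernel 1 w) * h (y - sqrt t *\<^sub>R w)"
    have k1: "integrable lborel (heat_kernel 1 :: real^'n \<Rightarrow> real)" by (rule integrable_heat_kernel) simp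
    have k2: "integrable lborel (\<lambda>w::real^'n. (2 * norm w + 1) * heat_kernel 1 w)"
      using k1 integrable_norm_heat_kernel[where 'n='n] by (simp add: distrib_right mult.assoc)
    have iG: "integrable lborel ?G"
      by (rule integrable_bounded_times[OF integrable_translate[OF k1], where B="norm h"]) (auto intro: norm_bounded)
    have iH: "integrable lborel ?H"
      by (rule integrable_bounded_times[OF k1, where B="norm h"]) (auto intro: norm_bounded)
    have "heat t h x = (LINT z|lborel. of_real (heat_kernel 1 z) * h (x - sqrt t *\<^sub>R z))"
      using t by (intro heat_eq_integral_kernel1) auto
    also have "\<dots> = (LINT w|lborel. of_real (heat_kernel 1 (e + w)) * h (x - sqrt t *\<^sub>R (e + w)))"
      by (rule integral_translate[symmetric]) measurable
    also have "\<dots> = (LINT w|lborel. ?G w)" by (simp only: xe)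
    finally have "heat t h x = (LINT w|lborel. ?G w)" .
    moreover have "heat t h y = (LINT w|lborel. ?H w)"
      using t by (intro heat_eq_integral_kernel1) auto
    ultimately have "heat t h x = (LINT w|lborel. ?G w - ?H w)"
      using hy iG iH by simp
    also have "norm \<dots> \<le> (LINT w|lborel. norm h * (\<bar>s\<bar> / 4 * ((2 * norm (e + w) + 1) * heat_kernel 1 (e + w) + (2 * norm w + 1) * heat_kernel 1 w)))"
    proof (rule Bochner_Integration.integral_norm_bound_integral)
      show "integrable lborel (\<lambda>w. ?G w - ?H w)" using iG iH by simp
      show "integrable lborel (\<lambda>w. norm h * (\<bar>s\<bar> / 4 * ((2 * norm (e + w) + 1) * heat_kernel 1 (e + w) + (2 * norm w + 1) * heat_kernel 1 w)))"
        by (intro integrable_mult_right Bochner_Integration.integrable_add integrable_translate[OF k2] k2)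
      fix w
      have "norm (?G w - ?H w) = \<bar>heat_kernel 1 (e + w) - heat_kernel 1 w\<bar> * norm (h (y - sqrt t *\<^sub>R w))"
        by (metis left_diff_distrib norm_mult norm_of_real of_real_diff)
      also have "\<dots> \<le> (\<bar>s\<bar> / 4 * ((2 * norm (e + w) + 1) * heat_kernel 1 (e + w) + (2 * norm w + 1) * heat_kernel 1 w)) * norm h"
        unfolding e_def
        by (intro mult_mono heat_kernel_shift_le True norm_bounded mult_nonneg_nonneg add_nonneg_nonneg heat_kernel_nonneg) auto
      finally show "norm (?G w - ?H w) \<le> norm h * (\<bar>s\<bar> / 4 * ((2 * norm (e + w) + 1) * heat_kernel 1 (e + w) + (2 * norm w + 1) * heat_kernel 1 w))"
        by (simp add: mult.commute)
    qed
    also have "\<dots> = norm h * (\<bar>s\<bar> / 4 * ((2 * M + 1) + (2 * M + 1)))"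
    proof -
      have I: "(LINT w|(lborel::(real^'n) measure). (2 * norm w + 1) * heat_kernel 1 w) = 2 * M + 1"
        using k1 integrable_norm_heat_kernel[where 'n='n]
        by (simp add: distrib_right mult.assoc integral_heat_kernel M_def)
      have "(LINT w|lborel. (2 * norm (e + w) + 1) * heat_kernel 1 (e + w)) = 2 * M + 1"
        using integral_translate[of "\<lambda>w::real^'n. (2 * norm w + 1) * heat_kernel 1 w" e] I by simp
      then show ?thesis
        by (simp only: integral_mult_right_zero Bochner_Integration.integral_add[OF integrable_translate[OF k2] k2] I)
    qed
    also have "\<dots> \<le> (1 + M) * norm h * \<bar>s\<bar>"
    proof -
      have "0 \<le> norm h * \<bar>s\<bar>" by simp
      then show ?thesis by (simp add: algebra_simps)
    qed
    finally show ?thesis by (simp add: s_abs M_def)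
  qed
qed

lemma has_integral_inverse_sqrt:
  assumes "t \<ge> 0"
  shows "((\<lambda>\<sigma>. 1 / sqrt (t - \<sigma>)) has_integral 2 * sqrt t) {0..t}"
proof -
  have "((\<lambda>\<sigma>. 1 / sqrt (t - \<sigma>)) has_integral (- 2 * sqrt (t - t) - (- 2 * sqrt (t - 0)))) {0..t}"
  proof (rule fundamental_theorem_of_calculus_interior[OF assms])
    show "continuous_on {0..t} (\<lambda>\<sigma>. - 2 * sqrt (t - \<sigma>))" by (intro continuous_intros)
    show "((\<lambda>\<sigma>. - 2 * sqrt (t - \<sigma>)) has_vector_derivative 1 / sqrt (t - x)) (at x)" if "x \<in> {0<..<t}" for x
      using that by (auto intro!: derivative_eq_intros simp: field_simps simp flip: has_real_derivative_iff_has_vector_derivative)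
  qed
  then show ?thesis by simp
qed

text \<open>Each heat flow contributes \<open>\<bar>x $ k\<bar> / sqrt (t - \<sigma>)\<close>; the
  singularity is integrable and produces the factor \<open>2 * sqrt t\<close>.\<close>

lemma conv_heat_odd_le:
  fixes F :: "real \<Rightarrow> (real^'n::finite) \<Rightarrow>\<^sub>C complex"
  assumes F: "continuous_on {0..t} F" "\<And>\<sigma>. \<sigma> \<in> {0..t} \<Longrightarrow> F \<sigma> \<in> C0_odd k"
    and B: "\<And>\<sigma>. \<sigma> \<in> {0..t} \<Longrightarrow> norm (F \<sigma>) \<le> B" and t: "t \<ge> 0"
  shows "norm (conv_heat F t x) \<le> 2 * (1 + heat_moment TYPE('n)) * B * sqrt t * \<bar>x $ k\<bar>"
proof -
  define K where "K = (1 + heat_moment TYPE('n)) * B * \<bar>x $ k\<bar>"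
  have FC: "F \<sigma> \<in> C0" if "\<sigma> \<in> {0..t}" for \<sigma> using F(2)[OF that] C0_odd_subset by blast
  \<comment> \<open>At \<open>\<sigma> = t\<close> the quotient \<open>1 / sqrt 0\<close> is 0 and
    would not be a majorant; the value \<open>B\<close> at this single point does not affect the
    integral.\<close>
  define b where "b = (\<lambda>\<sigma>. if \<sigma> = t then B else K * (1 / sqrt (t - \<sigma>)))"
  have hb: "(b has_integral K * (2 * sqrt t)) {0..t}"
    by (rule has_integral_spike_finite[OF _ _ has_integral_mult_right[OF has_integral_inverse_sqrt[OF t]], of "{t}"])
       (auto simp: b_def)
  have "(\<lambda>\<sigma>. heatop (t - \<sigma>) (F \<sigma>)) integrable_on {0..t}"
    by (intro integrable_continuous_real continuous_on_conv_heat_integrand[OF F(1) FC]) auto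
  from integrable_linear[OF this bounded_linear_apply_bcontfun, of x]
  have int: "(\<lambda>\<sigma>. heatop (t - \<sigma>) (F \<sigma>) x) integrable_on {0..t}" by (simp add: o_def)
  have "conv_heat F t x = integral {0..t} (\<lambda>\<sigma>. heat (t - \<sigma>) (F \<sigma>) x)"
    by (rule apply_conv_heat[OF F(1)]) (auto intro: FC)
  also have "\<dots> = integral {0..t} (\<lambda>\<sigma>. heatop (t - \<sigma>) (F \<sigma>) x)"
    by (rule Henstock_Kurzweil_Integration.integral_cong) (simp add: apply_heatop FC)
  also have "norm \<dots> \<le> integral {0..t} b"
  proof (rule Henstock_Kurzweil_Integration.integral_norm_bound_integral[OF int])
    show "b integrable_on {0..t}" using hb by blast
    fix \<sigma> assume \<sigma>: "\<sigma> \<in> {0..t}"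
    show "norm (heatop (t - \<sigma>) (F \<sigma>) x) \<le> b \<sigma>"
    proof (cases "\<sigma> = t")
      case True
      have "norm (F t x) \<le> B" using norm_bounded[of "F t" x] B[of t] t by simp
      then show ?thesis using FC[OF \<sigma>] by (simp add: b_def True heatop_0)
    next
      case False
      have "norm (heat (t - \<sigma>) (F \<sigma>) x) \<le> (1 + heat_moment TYPE('n)) * norm (F \<sigma>) * (\<bar>x $ k\<bar> / sqrt (t - \<sigma>))"
        using \<sigma> False by (intro heat_odd_le F(2)) auto
      also have "\<dots> \<le> (1 + heat_moment TYPE('n)) * B * (\<bar>x $ k\<bar> / sqrt (t - \<sigma>))"
        using \<sigma> heat_moment_nonneg[where 'n='n] by (intro mult_right_mono mult_left_mono B) auto
      finally show ?thesis using False \<sigma> by (simp add: b_def K_def apply_heatop FC)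
    qed
  qed
  also have "integral {0..t} b = K * (2 * sqrt t)" using hb by (rule integral_unique)
  finally show ?thesis by (simp add: K_def mult_ac)
qed

section \<open>The initial value\<close>

text \<open>The standard even bump exp (- 1 / (1 - r^2)) on the interval from -1 to 1.\<close>

definition bump :: "real \<Rightarrow> real" where
  "bump r = bmp 0 (1 - r\<^sup>2)"

lemma bump_bumps: "bump \<in> bumps" "(\<lambda>r. r * bump r) \<in> bumps"
  using bumps.base[of 1 0 0] bumps.base[of 1 1 0] by (simp_all add: bump_def[abs_def])

lemma bump_nonneg: "bump r \<ge> 0" and bump_le_1: "bump r \<le> 1"
  by (auto simp: bump_def bmp_def)

lemma bump_even: "bump (- r) = bump r"
  by (simp add: bump_def)

lemma bump_measurable [measurable]: "bump \<in> borel_measurable borel"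
  by (intro borel_measurable_continuous_onI bumps_continuous bump_bumps)

lemma bump_ge: "\<bar>r\<bar> \<le> 1 / 2 \<Longrightarrow> bump r \<ge> exp (- 2)"
proof -
  assume "\<bar>r\<bar> \<le> 1 / 2"
  then have "r\<^sup>2 \<le> (1 / 2)\<^sup>2" by (metis abs_ge_zero power2_abs power_mono)
  then have r: "1 - r\<^sup>2 \<ge> 1 / 2" by (simp add: power2_eq_square)
  then have "1 / (1 - r\<^sup>2) \<le> 1 / (1 / 2)" by (intro divide_left_mono) auto
  then show ?thesis using r by (simp add: bump_def bmp_def)
qed

text \<open>The power is Lipschitz on the range of \<open>bump\<close>, which lies between 0 and 1.
  Freezing the bump at 0 thus costs one power of \<open>\<bar>r\<bar>\<close>, that is a factor sqrt
  a against \<open>quint1 a\<close>.\<close>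

lemma bump_powr_lipschitz:
  assumes "\<alpha> > 0"
  obtains L where "L \<ge> 0" "\<And>r. \<bar>bump r powr (\<alpha> + 1) - bump 0 powr (\<alpha> + 1)\<bar> \<le> L * \<bar>r\<bar>"
proof -
  obtain f' where f': "f' \<in> bumps" "\<And>r. (bump has_real_derivative f' r) (at r)"
    using bumps_deriv[OF bump_bumps(1)] by blast
  obtain B where B: "B \<ge> 0" "\<And>r. \<bar>f' r\<bar> \<le> B" using bumps_bounded[OF f'(1)] by blast
  have 1: "\<bar>bump r - bump 0\<bar> \<le> B * \<bar>r\<bar>" for r
    using field_differentiable_bound[of UNIV bump f' B r 0] f'(2) B by simp
  have *: "\<bar>x powr (\<alpha> + 1) - y powr (\<alpha> + 1)\<bar> \<le> (\<alpha> + 1) * \<bar>x - y\<bar>" if "0 \<le> y" "y \<le> x" "x \<le> 1" for x y :: real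
  proof -
    have "x powr (\<alpha> + 1) - y powr (\<alpha> + 1) \<le> (\<alpha> + 1) * x powr \<alpha> * (x - y)"
      using that assms by (intro powr_diff_le) auto
    also have "\<dots> \<le> (\<alpha> + 1) * 1 * (x - y)"
      using that assms by (intro mult_right_mono mult_left_mono powr_le1) auto
    finally have "x powr (\<alpha> + 1) - y powr (\<alpha> + 1) \<le> (\<alpha> + 1) * (x - y)" by simp
    moreover have "y powr (\<alpha> + 1) \<le> x powr (\<alpha> + 1)" using that assms by (intro powr_mono2) auto
    ultimately show ?thesis using that by simp
  qed
  show ?thesis
  proof
    show "(\<alpha> + 1) * B \<ge> 0" using assms B by simp
    fix r
    have "\<bar>bump r powr (\<alpha> + 1) - bump 0 powr (\<alpha> + 1)\<bar> \<le> (\<alpha> + 1) * \<bar>bump r - bump 0\<bar>"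
      using *[of "bump 0" "bump r"] *[of "bump r" "bump 0"] bump_nonneg bump_le_1
      by (cases "bump 0 \<le> bump r") (auto simp: abs_minus_commute)
    also have "\<dots> \<le> (\<alpha> + 1) * (B * \<bar>r\<bar>)" using assms 1 by (intro mult_left_mono) auto
    finally show "\<bar>bump r powr (\<alpha> + 1) - bump 0 powr (\<alpha> + 1)\<bar> \<le> (\<alpha> + 1) * B * \<bar>r\<bar>" by simp
  qed
qed

text \<open>Stated as a product of members of \<open>bumps\<close> so that the lemmas on products
  apply directly; the working form is \<open>datum_eq\<close>.\<close>

definition datum :: "'n \<Rightarrow> real^'n::finite \<Rightarrow> real" where
  "datum k x = (\<Prod>i\<in>UNIV. (if i = k then \<lambda>r. r * bump r else bump) (x $ i))"

lemma datum_factors: "(if i = k then \<lambda>r. r * bump r else bump) \<in> bumps"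
  using bump_bumps by simp

lemma datum_eq: "datum k x = x $ k * (\<Prod>i\<in>UNIV. bump (x $ i))"
proof -
  have "datum k x = (\<Prod>i\<in>UNIV. (if i = k then x $ k else 1) * bump (x $ i))"
    unfolding datum_def by (rule prod.cong) auto
  then show ?thesis by (simp only: prod.distrib prod_if_eq_UNIV) simp
qed

lemma abs_datum_le: "\<bar>datum k x\<bar> \<le> \<bar>x $ k\<bar>"
proof -
  have "(\<Prod>i\<in>UNIV. bump (x $ i)) \<le> 1" "0 \<le> (\<Prod>i\<in>UNIV. bump (x $ i))"
    by (auto intro!: prod_le_1 prod_nonneg simp: bump_nonneg bump_le_1)
  then show ?thesis unfolding datum_eq by (simp add: abs_mult mult_left_le)
qed

lemma datum_reflect: "datum k (reflect k x) = - datum k x"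
proof -
  have "bump (reflect k x $ i) = bump (x $ i)" for i by (simp add: bump_even)
  then show ?thesis by (simp only: datum_eq) simp
qed

lemma datum_measurable [measurable]:
  fixes k :: "'n::finite" shows "datum k \<in> borel_measurable borel"
  unfolding datum_eq[abs_def] by measurable

section \<open>The nonlinearity at the initial value, paired with the probes\<close>

lemma abs_powr_datum:
  assumes "\<alpha> > 0"
  shows "\<bar>datum k x\<bar> powr \<alpha> * datum k x = \<bar>x $ k\<bar> powr \<alpha> * (x $ k) * (\<Prod>i\<in>UNIV. bump (x $ i) powr (\<alpha> + 1))"
proof -
  define P where "P = (\<Prod>i\<in>UNIV. bump (x $ i))"
  have P: "P \<ge> 0" unfolding P_def by (intro prod_nonneg) (simp add: bump_nonneg)
  have "(\<Prod>i\<in>UNIV. bump (x $ i) powr (\<alpha> + 1)) = P powr (\<alpha> + 1)"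
    unfolding P_def by (rule prod_powr_distrib[symmetric])
  also have "\<dots> = P powr \<alpha> * P" using P assms by (cases "P = 0") (auto simp: powr_add)
  finally show ?thesis
    using P by (simp add: datum_eq abs_mult powr_mult flip: P_def)
qed

text \<open>The tangential factors need a positive lower bound independent of \<tau>. On
  \<open>\<bar>r\<bar> \<le> 1 / 2\<close> both the bump and the Gaussian are bounded below, and
  \<open>8 * pi\<close> comes from 1 + \<tau> \<le> 2.\<close>

lemma bump_gauss_lower:
  assumes \<alpha>: "\<alpha> > 0" and \<tau>: "0 \<le> \<tau>" "\<tau> \<le> 1"
  shows "exp (- 2) powr (\<alpha> + 1) * exp (- 1) / sqrt (8 * pi) \<le> (LINT r|lborel. bump r powr (\<alpha> + 1) * gauss1 (1 + \<tau>) r)"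
    and "integrable lborel (\<lambda>r. bump r powr (\<alpha> + 1) * gauss1 (1 + \<tau>) r)"
proof -
  define c where "c = exp (- 2) powr (\<alpha> + 1) * exp (- 1) / sqrt (8 * pi)"
  have b1: "bump r powr (\<alpha> + 1) \<le> 1" for r
    using bump_nonneg bump_le_1 \<alpha> by (intro powr_le1) auto
  show int: "integrable lborel (\<lambda>r. bump r powr (\<alpha> + 1) * gauss1 (1 + \<tau>) r)"
    by (rule Bochner_Integration.integrable_bound[OF integrable_gauss1[of "1 + \<tau>"]])
       (use \<tau> b1 in \<open>auto simp: abs_mult intro!: mult_left_le_one_le\<close>)
  have "c = (LINT r|lborel. c * indicator {-1/2..1/2::real} r)" by simp
  also have "\<dots> \<le> (LINT r|lborel. bump r powr (\<alpha> + 1) * gauss1 (1 + \<tau>) r)"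
  proof (rule integral_mono[OF _ int])
    show "integrable lborel (\<lambda>r. c * indicator {-1/2..1/2::real} r)" by simp
    fix r :: real
    show "c * indicator {-1/2..1/2} r \<le> bump r powr (\<alpha> + 1) * gauss1 (1 + \<tau>) r"
    proof (cases "r \<in> {-1/2..1/2}")
      case True
      then have r: "\<bar>r\<bar> \<le> 1 / 2" by auto
      have "\<bar>r\<bar> ^ 2 \<le> 1 ^ 2" using r by (intro power_mono) auto
      then have "r\<^sup>2 / (4 * (1 + \<tau>)) \<le> 1 / 1" using \<tau> by (intro frac_le) auto
      then have "exp (- 1) / sqrt (8 * pi) \<le> gauss1 (1 + \<tau>) r"
        unfolding gauss1_def using \<tau> by (intro frac_le) auto
      moreover have "exp (- 2) powr (\<alpha> + 1) \<le> bump r powr (\<alpha> + 1)"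
        using \<alpha> bump_ge[OF r] by (intro powr_mono2) auto
      ultimately have "exp (- 2) powr (\<alpha> + 1) * (exp (- 1) / sqrt (8 * pi)) \<le> bump r powr (\<alpha> + 1) * gauss1 (1 + \<tau>) r"
        by (intro mult_mono) auto
      then show ?thesis using True by (simp add: c_def)
    qed (use \<tau> in \<open>simp add: gauss1_nonneg\<close>)
  qed
  finally show "exp (- 2) powr (\<alpha> + 1) * exp (- 1) / sqrt (8 * pi) \<le> (LINT r|lborel. bump r powr (\<alpha> + 1) * gauss1 (1 + \<tau>) r)"
    unfolding c_def .
qed

text \<open>The bump is replaced by its value at 0, which gives the exact integral
  \<open>integral_quint1_odd_power\<close>. The correction carries an extra factor sqrt a and is
  absorbed for small \<open>a\<close>.\<close>

lemma integral_bump_quint1_le: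
  assumes \<alpha>: "0 < \<alpha>" "\<alpha> < 2"
  obtains c a0 where "c > 0" "a0 > 0"
    "\<And>a. 0 < a \<Longrightarrow> a \<le> a0 \<Longrightarrow> (LINT r|lborel. \<bar>r\<bar> powr \<alpha> * r * bump r powr (\<alpha> + 1) * quint1 a r) \<le> - c * a powr (\<alpha> / 2 - 2)"
    "\<And>a. 0 < a \<Longrightarrow> integrable lborel (\<lambda>r. \<bar>r\<bar> powr \<alpha> * r * bump r powr (\<alpha> + 1) * quint1 a r)"
proof -
  obtain L where L: "L \<ge> 0" "\<And>r. \<bar>bump r powr (\<alpha> + 1) - bump 0 powr (\<alpha> + 1)\<bar> \<le> L * \<bar>r\<bar>"
    using bump_powr_lipschitz[OF \<alpha>(1)] by blast
  define b where "b = bump 0 powr (\<alpha> + 1)"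
  define D where "D = quint1_moment (\<alpha> + 2) 1"
  \<comment> \<open>Half of the leading coefficient, the other half being reserved for the
    correction; \<open>a0\<close> is chosen so that \<open>L * D * sqrt a \<le> c\<close> for
    \<open>a \<le> a0\<close>.\<close>
  define c where "c = b * quint_const \<alpha> / 2"
  define a0 where "a0 = (c / (L * D + 1))\<^sup>2"
  have D: "D \<ge> 0" unfolding D_def by (rule quint1_moment_nonneg)
  have LD: "L * D \<ge> 0" using L D by simp
  have "b > 0" unfolding b_def using bump_ge[of 0] by (smt (verit) exp_gt_zero powr_gt_zero abs_zero zero_le_divide_1_iff)
  then have c: "c > 0" using quint_const_pos[OF \<alpha>] by (simp add: c_def)
  have a0: "a0 > 0" using c LD by (simp add: a0_def)
  have pw: "\<bar>r\<bar> powr (\<alpha> + real m) = \<bar>r\<bar> powr \<alpha> * \<bar>r\<bar> ^ m" for r :: real and m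
    using \<alpha> by (cases "r = 0") (auto simp: powr_add powr_realpow)
  have i1: "integrable lborel (\<lambda>r. \<bar>r\<bar> powr (\<alpha> + 1) * \<bar>quint1 a r\<bar>)" if "a > 0" for a
    using integrable_powr_quint1[OF that, of "\<alpha> + 1" 1] \<alpha> by simp
  have i2: "integrable lborel (\<lambda>r. \<bar>r\<bar> powr (\<alpha> + 2) * \<bar>quint1 a r\<bar>)" if "a > 0" for a
    using integrable_powr_quint1[OF that, of "\<alpha> + 2" 1] \<alpha> by simp
  have int: "integrable lborel (\<lambda>r. \<bar>r\<bar> powr \<alpha> * r * h r * quint1 a r)"
    if "a > 0" and [measurable]: "h \<in> borel_measurable borel" and h: "\<And>r. \<bar>h r\<bar> \<le> 1" for a h
  proof (rule Bochner_Integration.integrable_bound[OF i1[OF \<open>a > 0\<close>]])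
    show "AE r in lborel. norm (\<bar>r\<bar> powr \<alpha> * r * h r * quint1 a r) \<le> norm (\<bar>r\<bar> powr (\<alpha> + 1) * \<bar>quint1 a r\<bar>)"
    proof (rule AE_I2)
      fix r
      have "\<bar>r\<bar> powr \<alpha> * \<bar>r\<bar> * \<bar>h r\<bar> * \<bar>quint1 a r\<bar> \<le> \<bar>r\<bar> powr \<alpha> * \<bar>r\<bar> * 1 * \<bar>quint1 a r\<bar>"
        by (intro mult_right_mono mult_left_mono h) auto
      then show "norm (\<bar>r\<bar> powr \<alpha> * r * h r * quint1 a r) \<le> norm (\<bar>r\<bar> powr (\<alpha> + 1) * \<bar>quint1 a r\<bar>)"
        using pw[of r 1] by (simp add: abs_mult)
    qed
  qed measurable
  have bm[measurable]: "(\<lambda>r. bump r powr (\<alpha> + 1)) \<in> borel_measurable borel" by measurable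
  have b1: "\<bar>bump r powr (\<alpha> + 1)\<bar> \<le> 1" for r
    using bump_nonneg[of r] bump_le_1[of r] \<alpha> by (simp add: powr_le1)
  show ?thesis
  proof
    show "integrable lborel (\<lambda>r. \<bar>r\<bar> powr \<alpha> * r * bump r powr (\<alpha> + 1) * quint1 a r)" if "0 < a" for a
      by (rule int[OF that bm b1])
    fix a assume a: "0 < a" "a \<le> a0"
    let ?f = "\<lambda>r. \<bar>r\<bar> powr \<alpha> * r * bump r powr (\<alpha> + 1) * quint1 a r"
    let ?g = "\<lambda>r. \<bar>r\<bar> powr \<alpha> * r * quint1 a r"
    have ig: "integrable lborel ?g" using int[OF a(1), of "\<lambda>_. 1"] by simp
    have "(LINT r|lborel. ?f r) - b * (LINT r|lborel. ?g r) = (LINT r|lborel. ?f r - b * ?g r)"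
      using int[OF a(1) bm b1] ig by simp
    also have "\<dots> \<le> (LINT r|lborel. L * (\<bar>r\<bar> powr (\<alpha> + 2) * \<bar>quint1 a r\<bar>))"
    proof (rule integral_mono)
      show "integrable lborel (\<lambda>r. ?f r - b * ?g r)" using int[OF a(1) bm b1] ig by simp
      show "integrable lborel (\<lambda>r. L * (\<bar>r\<bar> powr (\<alpha> + 2) * \<bar>quint1 a r\<bar>))" using i2[OF a(1)] by simp
      fix r
      have "?f r - b * ?g r = (bump r powr (\<alpha> + 1) - b) * (\<bar>r\<bar> powr \<alpha> * r * quint1 a r)"
        by (simp add: algebra_simps)
      also have "\<dots> \<le> \<bar>bump r powr (\<alpha> + 1) - b\<bar> * (\<bar>r\<bar> powr \<alpha> * \<bar>r\<bar> * \<bar>quint1 a r\<bar>)"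
        by (rule order_trans[OF abs_ge_self]) (simp add: abs_mult)
      also have "\<dots> \<le> (L * \<bar>r\<bar>) * (\<bar>r\<bar> powr \<alpha> * \<bar>r\<bar> * \<bar>quint1 a r\<bar>)"
        unfolding b_def by (intro mult_right_mono L) auto
      also have "\<dots> = L * (\<bar>r\<bar> powr (\<alpha> + 2) * \<bar>quint1 a r\<bar>)"
        using pw[of r 2] by (simp add: power2_eq_square)
      finally show "?f r - b * ?g r \<le> L * (\<bar>r\<bar> powr (\<alpha> + 2) * \<bar>quint1 a r\<bar>)" .
    qed
    also have "\<dots> = L * (a powr ((\<alpha> + 2 + 1) / 2 - 3 * 1) * D)"
      using integral_powr_quint1[OF a(1), of "\<alpha> + 2" 1] by (simp add: D_def)
    also have "a powr ((\<alpha> + 2 + 1) / 2 - 3 * 1) = a powr (\<alpha> / 2 - 2) * sqrt a"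
    proof -
      have "(\<alpha> + 2 + 1) / 2 - 3 * 1 = (\<alpha> / 2 - 2) + 1 / 2" by (simp add: field_simps)
      then show ?thesis using a by (simp only: powr_add) (simp add: powr_half_sqrt)
    qed
    also have "L * (a powr (\<alpha> / 2 - 2) * sqrt a * D) \<le> c * a powr (\<alpha> / 2 - 2)"
    proof -
      have "sqrt a \<le> sqrt a0" using a by simp
      also have "\<dots> = c / (L * D + 1)" using c LD by (simp add: a0_def)
      finally have "(L * D) * sqrt a \<le> (L * D) * (c / (L * D + 1))" using LD by (intro mult_left_mono)
      also have "\<dots> \<le> c" using c LD by (simp add: field_simps)
      finally have "((L * D) * sqrt a) * a powr (\<alpha> / 2 - 2) \<le> c * a powr (\<alpha> / 2 - 2)"
        by (intro mult_right_mono) auto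
      then show ?thesis by (simp add: mult_ac)
    qed
    finally have "(LINT r|lborel. ?f r) \<le> b * (LINT r|lborel. ?g r) + c * a powr (\<alpha> / 2 - 2)" by simp
    also have "\<dots> = - c * a powr (\<alpha> / 2 - 2)"
      unfolding integral_quint1_odd_power[OF \<alpha>(1) a(1)] c_def by (simp add: field_simps)
    finally show "(LINT r|lborel. ?f r) \<le> - c * a powr (\<alpha> / 2 - 2)" .
  qed (fact c a0)+
qed

text \<open>The integral factorises into a negative normal factor and positive tangential factors.
  An upper bound therefore requires the tangential factors from below.\<close>

lemma integral_datum_probe_le:
  fixes k :: "'n::finite"
  assumes \<alpha>: "0 < \<alpha>" "\<alpha> < 2"
  obtains c a0 where "c > 0" "a0 > 0"
    "\<And>\<epsilon> \<tau>. \<epsilon> > 0 \<Longrightarrow> \<tau> \<ge> 0 \<Longrightarrow> \<epsilon> + \<tau> \<le> a0 \<Longrightarrow>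
      (LINT x|lborel. \<bar>datum k x\<bar> powr \<alpha> * datum k x * probe k \<epsilon> \<tau> x) \<le> - c * (\<epsilon> + \<tau>) powr (\<alpha> / 2 - 2)"
proof -
  obtain c a0 where c: "c > 0" "a0 > 0"
    "\<And>a. 0 < a \<Longrightarrow> a \<le> a0 \<Longrightarrow> (LINT r|lborel. \<bar>r\<bar> powr \<alpha> * r * bump r powr (\<alpha> + 1) * quint1 a r) \<le> - c * a powr (\<alpha> / 2 - 2)"
    "\<And>a. 0 < a \<Longrightarrow> integrable lborel (\<lambda>r. \<bar>r\<bar> powr \<alpha> * r * bump r powr (\<alpha> + 1) * quint1 a r)"
    using integral_bump_quint1_le[OF \<alpha>] by blast
  define b where "b = exp (- 2) powr (\<alpha> + 1) * exp (- 1) / sqrt (8 * pi)"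
  have b: "b > 0" by (simp add: b_def)
  show ?thesis
  proof
    \<comment> \<open>The cap by 1 provides \<open>\<tau> \<le> 1\<close> for
      \<open>bump_gauss_lower\<close>.\<close>
    show "c * b ^ (CARD('n) - 1) > 0" "min a0 1 > 0" using c b by auto
    fix \<epsilon> \<tau> :: real assume \<epsilon>: "\<epsilon> > 0" and \<tau>: "\<tau> \<ge> 0" and le: "\<epsilon> + \<tau> \<le> min a0 1"
    define G where "G = (\<lambda>i r. if i = k then \<bar>r\<bar> powr \<alpha> * r * bump r powr (\<alpha> + 1) * quint1 (\<epsilon> + \<tau>) r
        else bump r powr (\<alpha> + 1) * gauss1 (1 + \<tau>) r)"
    have \<tau>1: "\<tau> \<le> 1" using le \<epsilon> by linarith
    have G: "integrable lborel (G i)" for i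
      using c(4)[of "\<epsilon> + \<tau>"] bump_gauss_lower(2)[OF \<alpha>(1) \<tau> \<tau>1] \<epsilon> \<tau> by (cases "i = k") (simp_all add: G_def)
    have "\<bar>datum k x\<bar> powr \<alpha> * datum k x * probe k \<epsilon> \<tau> x = (\<Prod>i\<in>UNIV. G i (x $ i))" for x
    proof -
      have "(\<Prod>i\<in>UNIV. G i (x $ i)) = (\<Prod>i\<in>UNIV. (if i = k then \<bar>x $ k\<bar> powr \<alpha> * (x $ k) else 1) *
          (bump (x $ i) powr (\<alpha> + 1) * (if i = k then quint1 (\<epsilon> + \<tau>) (x $ i) else gauss1 (1 + \<tau>) (x $ i))))"
        by (rule prod.cong) (auto simp: G_def)
      also have "\<dots> = \<bar>x $ k\<bar> powr \<alpha> * (x $ k) * ((\<Prod>i\<in>UNIV. bump (x $ i) powr (\<alpha> + 1)) * probe k \<epsilon> \<tau> x)"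
        by (simp only: prod.distrib prod_if_eq_UNIV probe_def) simp
      finally show ?thesis by (simp only: abs_powr_datum[OF \<alpha>(1)] mult.assoc)
    qed
    then have "(LINT x|lborel. \<bar>datum k x\<bar> powr \<alpha> * datum k x * probe k \<epsilon> \<tau> x) = (\<Prod>i\<in>UNIV. LINT r|lborel. G i r)"
      using integral_prod_vec[OF G] by simp
    also have "\<dots> = (\<Prod>i\<in>UNIV. if i = k then LINT r|lborel. \<bar>r\<bar> powr \<alpha> * r * bump r powr (\<alpha> + 1) * quint1 (\<epsilon> + \<tau>) r
        else LINT r|lborel. bump r powr (\<alpha> + 1) * gauss1 (1 + \<tau>) r)"
      by (rule prod.cong) (auto simp: G_def)
    also have "\<dots> = (LINT r|lborel. \<bar>r\<bar> powr \<alpha> * r * bump r powr (\<alpha> + 1) * quint1 (\<epsilon> + \<tau>) r) *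
        (LINT r|lborel. bump r powr (\<alpha> + 1) * gauss1 (1 + \<tau>) r) ^ (CARD('n) - 1)"
      by (rule prod_if_eq_UNIV)
    also have "\<dots> \<le> (- c * (\<epsilon> + \<tau>) powr (\<alpha> / 2 - 2)) * (LINT r|lborel. bump r powr (\<alpha> + 1) * gauss1 (1 + \<tau>) r) ^ (CARD('n) - 1)"
      using c(3)[of "\<epsilon> + \<tau>"] \<epsilon> \<tau> le
      by (intro mult_right_mono zero_le_power integral_nonneg_AE) (auto simp: gauss1_nonneg)
    also have "\<dots> \<le> (- c * (\<epsilon> + \<tau>) powr (\<alpha> / 2 - 2)) * b ^ (CARD('n) - 1)"
      using c(1) b bump_gauss_lower(1)[OF \<alpha>(1) \<tau> \<tau>1]
      by (intro mult_left_mono_neg power_mono) (auto simp: b_def)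
    finally show "(LINT x|lborel. \<bar>datum k x\<bar> powr \<alpha> * datum k x * probe k \<epsilon> \<tau> x) \<le> - (c * b ^ (CARD('n) - 1)) * (\<epsilon> + \<tau>) powr (\<alpha> / 2 - 2)"
      by (simp add: mult_ac)
  qed
qed

section \<open>Perturbation of the initial value\<close>

lemma integral_powr_probe:
  fixes k :: "'n::finite"
  assumes \<epsilon>: "\<epsilon> > 0" and \<tau>: "\<tau> \<ge> 0" and \<beta>: "\<beta> \<ge> 0"
  shows "integrable lborel (\<lambda>x. \<bar>x $ k\<bar> powr \<beta> * \<bar>probe k \<epsilon> \<tau> x\<bar>)"
    and "(LINT x|lborel. \<bar>x $ k\<bar> powr \<beta> * \<bar>probe k \<epsilon> \<tau> x\<bar>) = (\<epsilon> + \<tau>) powr ((\<beta> + 1) / 2 - 3) * quint1_moment \<beta> 1"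
proof -
  define G where "G = (\<lambda>i r. if i = k then \<bar>r\<bar> powr \<beta> * \<bar>quint1 (\<epsilon> + \<tau>) r\<bar> else gauss1 (1 + \<tau>) r)"
  have G: "integrable lborel (G i)" for i
    using integrable_powr_quint1[of "\<epsilon> + \<tau>" \<beta> 1] assms by (cases "i = k") (simp_all add: G_def integrable_gauss1)
  have eq: "\<bar>x $ k\<bar> powr \<beta> * \<bar>probe k \<epsilon> \<tau> x\<bar> = (\<Prod>i\<in>UNIV. G i (x $ i))" for x
  proof -
    have "(\<Prod>i\<in>UNIV. G i (x $ i)) = (\<Prod>i\<in>UNIV. (if i = k then \<bar>x $ k\<bar> powr \<beta> else 1) *
        \<bar>if i = k then quint1 (\<epsilon> + \<tau>) (x $ i) else gauss1 (1 + \<tau>) (x $ i)\<bar>)"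
      by (rule prod.cong) (use \<tau> in \<open>auto simp: G_def gauss1_nonneg\<close>)
    also have "\<dots> = \<bar>x $ k\<bar> powr \<beta> * \<bar>probe k \<epsilon> \<tau> x\<bar>"
      by (simp only: prod.distrib prod_if_eq_UNIV probe_def abs_prod) simp
    finally show ?thesis by simp
  qed
  show "integrable lborel (\<lambda>x. \<bar>x $ k\<bar> powr \<beta> * \<bar>probe k \<epsilon> \<tau> x\<bar>)"
    unfolding eq by (rule integrable_prod_vec[OF G])
  have "(LINT x|lborel. \<bar>x $ k\<bar> powr \<beta> * \<bar>probe k \<epsilon> \<tau> x\<bar>) = (\<Prod>i\<in>UNIV. LINT r|lborel. G i r)"
    unfolding eq by (rule integral_prod_vec[OF G])
  also have "\<dots> = (\<Prod>i\<in>UNIV. if i = k then (LINT r|lborel. \<bar>r\<bar> powr \<beta> * \<bar>quint1 (\<epsilon> + \<tau>) r\<bar>) else 1)"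
    by (rule prod.cong) (use \<tau> in \<open>auto simp: G_def integral_gauss1\<close>)
  also have "\<dots> = (LINT r|lborel. \<bar>r\<bar> powr \<beta> * \<bar>quint1 (\<epsilon> + \<tau>) r\<bar>)"
    by (simp only: prod_if_eq_UNIV power_one mult_1_right)
  also have "\<dots> = (\<epsilon> + \<tau>) powr ((\<beta> + 1) / 2 - 3) * quint1_moment \<beta> 1"
    using integral_powr_quint1[of "\<epsilon> + \<tau>" \<beta> 1] \<epsilon> \<tau> by simp
  finally show "(LINT x|lborel. \<bar>x $ k\<bar> powr \<beta> * \<bar>probe k \<epsilon> \<tau> x\<bar>) = (\<epsilon> + \<tau>) powr ((\<beta> + 1) / 2 - 3) * quint1_moment \<beta> 1" .
qed

text \<open>For \<beta> = \<alpha> + 1 the rate is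
  \<open>(\<epsilon> + \<tau>) powr (\<alpha> / 2 - 2)\<close>, that of the main term, so the
  comparison is decided by the size of \<open>E\<close> alone.\<close>

lemma integral_probe_diff_le:
  fixes k :: "'n::finite" and f g :: "real^'n \<Rightarrow> complex"
  assumes [measurable]: "f \<in> borel_measurable borel" "g \<in> borel_measurable borel"
    and bd: "\<And>x. norm (f x) \<le> B" "\<And>x. norm (g x) \<le> B"
    and le: "\<And>x. norm (f x - g x) \<le> E * \<bar>x $ k\<bar> powr \<beta>"
    and \<epsilon>: "\<epsilon> > 0" and \<tau>: "\<tau> \<ge> 0" and \<beta>: "\<beta> \<ge> 0"
  shows "norm ((LINT x|lborel. f x * of_real (probe k \<epsilon> \<tau> x)) - (LINT x|lborel. g x * of_real (probe k \<epsilon> \<tau> x)))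
    \<le> E * ((\<epsilon> + \<tau>) powr ((\<beta> + 1) / 2 - 3) * quint1_moment \<beta> 1)"
proof -
  have i: "integrable lborel (\<lambda>x. h x * of_real (probe k \<epsilon> \<tau> x))"
    if "h \<in> borel_measurable borel" "\<And>x. norm (h x) \<le> B" for h :: "real^'n \<Rightarrow> complex"
    using integrable_bounded_times[OF integrable_probe[OF \<epsilon> \<tau>, of k], of h B] that by (simp add: mult.commute)
  note ifg = i[OF assms(1) bd(1)] i[OF assms(2) bd(2)]
  have "(LINT x|lborel. f x * of_real (probe k \<epsilon> \<tau> x)) - (LINT x|lborel. g x * of_real (probe k \<epsilon> \<tau> x))
     = (LINT x|lborel. (f x - g x) * of_real (probe k \<epsilon> \<tau> x))"
    using ifg by (simp add: left_diff_distrib)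
  also have "norm \<dots> \<le> (LINT x|lborel. E * (\<bar>x $ k\<bar> powr \<beta> * \<bar>probe k \<epsilon> \<tau> x\<bar>))"
  proof (rule Bochner_Integration.integral_norm_bound_integral)
    show "integrable lborel (\<lambda>x. (f x - g x) * of_real (probe k \<epsilon> \<tau> x))"
      using ifg by (simp add: left_diff_distrib)
    show "integrable lborel (\<lambda>x. E * (\<bar>x $ k\<bar> powr \<beta> * \<bar>probe k \<epsilon> \<tau> x\<bar>))"
      by (intro integrable_mult_right integral_powr_probe \<epsilon> \<tau> \<beta>)
    show "norm ((f x - g x) * of_real (probe k \<epsilon> \<tau> x)) \<le> E * (\<bar>x $ k\<bar> powr \<beta> * \<bar>probe k \<epsilon> \<tau> x\<bar>)" for x
      using mult_right_mono[OF le[of x], of "\<bar>probe k \<epsilon> \<tau> x\<bar>"] by (simp add: norm_mult mult.assoc)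
  qed
  finally show ?thesis by (simp add: integral_powr_probe(2)[OF \<epsilon> \<tau> \<beta>])
qed

text \<open>Let \<open>y\<close> be the projection of \<open>x\<close> to the hyperplane, where
  \<open>w\<close> and its heat flow vanish by oddness. The function \<open>g\<close>, a translate
  of \<open>w\<close> plus a constant, has heat flow \<open>w x\<close> at \<open>x\<close>; hence
  the error is the average of a mixed second difference of \<open>w\<close> with increments
  \<open>x $ k\<close> and \<open>sqrt t\<close> times the displacement.\<close>

lemma heat_datum_near:
  fixes w :: "(real^'n::finite) \<Rightarrow>\<^sub>C complex"
  assumes w: "apply_bcontfun w = (\<lambda>x. of_real (datum k x))"
  obtains C where "C \<ge> 0" "\<And>t x. t \<ge> 0 \<Longrightarrow> norm (heat t w x - w x) \<le> C * sqrt t * \<bar>x $ k\<bar>"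
proof -
  define M where "M = heat_moment TYPE('n)"
  have M: "M \<ge> 0" unfolding M_def by (rule heat_moment_nonneg)
  obtain C where C: "C \<ge> 0" "\<And>x y s. \<bar>(datum k (x + s *\<^sub>R axis k 1 + y) - datum k (x + s *\<^sub>R axis k 1))
      - (datum k (x + y) - datum k x)\<bar> \<le> C * \<bar>s\<bar> * norm y"
    using prod_bumps_mixed_difference[of "\<lambda>i. if i = k then \<lambda>r. r * bump r else bump" k, OF datum_factors]
    unfolding datum_def[symmetric] by blast
  show ?thesis
  proof
    show "C * M \<ge> 0" using C M by simp
    fix t :: real and x :: "real^'n" assume t: "t \<ge> 0"
    define y where "y = x - (x $ k) *\<^sub>R axis k 1"
    define c where "c = w x - w y"
    define g where "g = (\<lambda>v. w (v - (x $ k) *\<^sub>R axis k 1) + c)"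
    have xy: "x = y + (x $ k) *\<^sub>R axis k 1" by (simp add: y_def)
    have ry: "reflect k y = y" by (simp add: vec_eq_iff y_def axis_def)
    have odd: "w (reflect k v) = - w v" for v by (simp add: w datum_reflect)
    have "w y = - w y" using odd[of y] ry by simp
    then have wy: "w y = 0" by simp
    have "heat t w y = - heat t w y" using heat_odd[of w k t y] odd t ry by simp
    then have hy: "heat t w y = 0" by simp
    have gm: "g \<in> borel_measurable borel"
      unfolding g_def by measurable
    have gb: "norm (g v) \<le> 3 * norm w" for v
      unfolding g_def c_def
      using norm_triangle_ineq[of "w (v - (x $ k) *\<^sub>R axis k 1)" "w x - w y"] norm_triangle_ineq4[of "w x" "w y"]
        norm_bounded[of w x] norm_bounded[of w y] norm_bounded[of w "v - (x $ k) *\<^sub>R axis k 1"] by linarith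
    have wb: "norm (w v) \<le> 3 * norm w" for v
      using norm_bounded[of w v] norm_ge_zero[of w] by linarith
    have hg: "heat t g x = heat t w y + c"
    proof -
      have "heat t g x = (LINT z|lborel. of_real (heat_kernel 1 z) * w (y - sqrt t *\<^sub>R z) + of_real (heat_kernel 1 z) * c)"
        by (subst heat_eq_integral_kernel1[OF t gm], rule Bochner_Integration.integral_cong)
           (simp_all add: g_def y_def algebra_simps)
      also have "\<dots> = heat t w y + c"
        using integrable_heat_integrand[of w "norm w" y "sqrt t"] t
        by (subst Bochner_Integration.integral_add)
           (auto simp: norm_bounded heat_eq_integral_kernel1 integrable_heat_kernel integral_heat_kernel)
      finally show ?thesis .
    qed
    have "norm (heat t w x - heat t g x) \<le> 0 + (C * \<bar>x $ k\<bar> * sqrt t) * M"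
      unfolding M_def
    proof (rule norm_heat_diff_le[OF _ gm wb gb t t])
      show "C * \<bar>x $ k\<bar> * sqrt t \<ge> 0" using C t by simp
      fix z :: "real^'n"
      define v where "v = - sqrt t *\<^sub>R z"
      have nv: "norm v = sqrt t * norm z" using t by (simp add: v_def)
      have 1: "x - sqrt t *\<^sub>R z = y + (x $ k) *\<^sub>R axis k 1 + v" by (simp add: y_def v_def)
      have 2: "(x - sqrt t *\<^sub>R z) - (x $ k) *\<^sub>R axis k 1 = y + v" by (simp add: y_def v_def)
      have "w (x - sqrt t *\<^sub>R z) - g (x - sqrt t *\<^sub>R z)
          = (w (y + (x $ k) *\<^sub>R axis k 1 + v) - w (y + (x $ k) *\<^sub>R axis k 1)) - (w (y + v) - w y)"
        unfolding g_def 2 c_def unfolding 1 xy[symmetric] by simp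
      also have "\<dots> = of_real ((datum k (y + (x $ k) *\<^sub>R axis k 1 + v) - datum k (y + (x $ k) *\<^sub>R axis k 1)) - (datum k (y + v) - datum k y))"
        by (simp add: w)
      also have "norm \<dots> \<le> C * \<bar>x $ k\<bar> * norm v" unfolding norm_of_real by (rule C)
      finally show "norm (w (x - sqrt t *\<^sub>R z) - g (x - sqrt t *\<^sub>R z)) \<le> 0 + C * \<bar>x $ k\<bar> * sqrt t * norm z"
        by (simp add: nv mult.assoc)
    qed measurable
    then show "norm (heat t w x - w x) \<le> C * M * sqrt t * \<bar>x $ k\<bar>"
      by (simp add: hg hy c_def wy mult_ac)
  qed
qed

lemma datum_bcontfun:
  fixes k :: "'n::finite"
  obtains w where "apply_bcontfun w = (\<lambda>x. complex_of_real (datum k x))" "w \<in> C0_odd k"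
proof -
  have Cc: "(\<lambda>x. complex_of_real (datum k x)) \<in> Cc_infty"
    unfolding datum_def by (rule prod_bumps_Cc_infty[OF datum_factors])
  have "partial_derivs [] (\<lambda>x. complex_of_real (datum k x)) differentiable_on UNIV"
    using Cc unfolding Cc_infty_def smooth_def by blast
  then have d: "(\<lambda>x. complex_of_real (datum k x)) differentiable_on UNIV"
    by (simp add: partial_derivs_def)
  note cont = differentiable_imp_continuous_on[OF d]
  obtain B where B: "\<And>x. \<bar>datum k x\<bar> \<le> B"
    using prod_bumps_bounded[of "\<lambda>i. if i = k then \<lambda>r. r * bump r else bump", OF datum_factors]
    unfolding datum_def[symmetric] by blast
  have "(\<lambda>x. complex_of_real (datum k x)) \<in> bcontfun"
    by (rule bcontfun_normI[OF cont, of B]) (simp add: B)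
  then obtain w where w: "apply_bcontfun w = (\<lambda>x. complex_of_real (datum k x))"
    by (metis Bcontfun_inverse)
  have "bounded (closure {x. complex_of_real (datum k x) \<noteq> 0})"
    using Cc unfolding Cc_infty_def by (intro compact_imp_bounded) blast
  then have "bounded {x. complex_of_real (datum k x) \<noteq> 0}" by (rule bounded_subset) (rule closure_subset)
  then obtain R where R: "\<And>x. datum k x \<noteq> 0 \<Longrightarrow> norm x \<le> R" unfolding bounded_iff by auto
  have "w \<in> C0"
    unfolding C0_iff
  proof (intro allI impI exI)
    fix e :: real and x :: "real^'n" assume "e > 0" "R + 1 \<le> norm x"
    then show "norm (w x) < e" using R[of x] by (cases "datum k x = 0") (auto simp: w)
  qed
  then have "w \<in> C0_odd k" by (simp add: C0_odd_def w datum_reflect)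
  with w show ?thesis by (rule that)
qed

section \<open>Loss of regularity\<close>

lemma mild_datum_near:
  fixes w :: "(real^'n::finite) \<Rightarrow>\<^sub>C complex"
  assumes \<alpha>: "\<alpha> > 0" and w: "apply_bcontfun w = (\<lambda>x. of_real (datum k x))" "w \<in> C0_odd k"
    and u: "mild lam \<alpha> w (ereal T) u" "\<And>t. 0 \<le> t \<Longrightarrow> t < T \<Longrightarrow> u t \<in> C0_odd k"
      "\<And>t. 0 \<le> t \<Longrightarrow> t < T \<Longrightarrow> norm (u t) \<le> R"
  obtains C where "C \<ge> 0" "\<And>t x. 0 \<le> t \<Longrightarrow> t < T \<Longrightarrow> norm (u t x - w x) \<le> C * sqrt t * \<bar>x $ k\<bar>"
proof -
  have wC: "w \<in> C0" using w(2) C0_odd_subset by blast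
  obtain C where C: "C \<ge> 0" "\<And>t x. t \<ge> 0 \<Longrightarrow> norm (heat t w x - w x) \<le> C * sqrt t * \<bar>x $ k\<bar>"
    using heat_datum_near[OF w(1)] by blast
  define B where "B = norm lam * R powr (\<alpha> + 1)"
  define D where "D = 2 * (1 + heat_moment TYPE('n)) * B"
  have D: "D \<ge> 0" unfolding D_def B_def using heat_moment_nonneg[where 'n='n] by (intro mult_nonneg_nonneg) auto
  show ?thesis
  proof
    show "C + D \<ge> 0" using C D by simp
    fix t x assume t: "0 \<le> t" "t < T"
    let ?F = "\<lambda>\<sigma>. source lam \<alpha> (u \<sigma>)"
    have eT: "ereal t < ereal T" using t by simp
    have F: "continuous_on {0..t} ?F"
      by (rule source_continuous_C0(1)[OF \<alpha> wC mildD(1)[OF \<alpha> wC u(1)] mildD(2)[OF \<alpha> wC u(1)] eT])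
    have Fodd: "?F \<sigma> \<in> C0_odd k" "norm (?F \<sigma>) \<le> B" if "\<sigma> \<in> {0..t}" for \<sigma>
      using that t by (auto intro!: source_C0_odd norm_source_le \<alpha> u(2,3) simp: B_def)
    have "u t x = heat t w x + conv_heat ?F t x"
    proof -
      have "u t = heatop t w + conv_heat ?F t" by (rule mildD(3)[OF \<alpha> wC u(1) t(1) eT])
      then show ?thesis using t wC by (simp add: apply_heatop)
    qed
    then have "norm (u t x - w x) \<le> norm (heat t w x - w x) + norm (conv_heat ?F t x)"
      using norm_triangle_ineq[of "heat t w x - w x" "conv_heat ?F t x"] by (simp add: algebra_simps)
    also have "norm (conv_heat ?F t x) \<le> D * sqrt t * \<bar>x $ k\<bar>"
      unfolding D_def by (rule conv_heat_odd_le[OF F Fodd t(1)])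
    finally show "norm (u t x - w x) \<le> (C + D) * sqrt t * \<bar>x $ k\<bar>"
      using C(2)[OF t(1), of x] by (simp add: algebra_simps)
  qed
qed

text \<open>Both arguments are at most \<open>2 * \<bar>x $ k\<bar>\<close>, so the local Lipschitz
  constant contributes \<open>\<bar>x $ k\<bar> powr \<alpha>\<close> and the error in the argument
  the remaining power.\<close>

lemma pnl_datum_near:
  fixes k :: "'n::finite"
  assumes \<alpha>: "\<alpha> > 0" and \<eta>: "0 \<le> \<eta>" "\<eta> \<le> 1" and v: "norm (v - of_real (datum k x)) \<le> \<eta> * \<bar>x $ k\<bar>"
  shows "norm (pnl \<alpha> v - pnl \<alpha> (of_real (datum k x))) \<le> (\<alpha> + 2) * 2 powr \<alpha> * \<eta> * \<bar>x $ k\<bar> powr (\<alpha> + 1)"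
proof -
  have d: "norm (complex_of_real (datum k x)) \<le> 2 * \<bar>x $ k\<bar>"
    using abs_datum_le[of k x] by simp
  have "\<eta> * \<bar>x $ k\<bar> \<le> 1 * \<bar>x $ k\<bar>" using \<eta> by (intro mult_right_mono) auto
  then have n: "norm v \<le> 2 * \<bar>x $ k\<bar>"
    using v abs_datum_le[of k x] norm_triangle_sub[of v "of_real (datum k x)"] by simp
  have "norm (pnl \<alpha> v - pnl \<alpha> (of_real (datum k x))) \<le> (\<alpha> + 2) * (2 * \<bar>x $ k\<bar>) powr \<alpha> * norm (v - of_real (datum k x))"
    by (rule pnl_lipschitz[OF \<alpha> n d])
  also have "\<dots> \<le> (\<alpha> + 2) * (2 * \<bar>x $ k\<bar>) powr \<alpha> * (\<eta> * \<bar>x $ k\<bar>)"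
    using \<alpha> v by (intro mult_left_mono) auto
  also have "\<dots> = (\<alpha> + 2) * 2 powr \<alpha> * \<eta> * (\<bar>x $ k\<bar> powr \<alpha> * \<bar>x $ k\<bar>)"
    by (simp add: powr_mult)
  also have "\<bar>x $ k\<bar> powr \<alpha> * \<bar>x $ k\<bar> = \<bar>x $ k\<bar> powr (\<alpha> + 1)"
    using \<alpha> by (cases "x $ k = 0") (auto simp: powr_add)
  finally show ?thesis .
qed

text \<open>Boundedness, with a constant depending on \<epsilon>, is what lets the pairing pass
  through the Banach-space-valued Duhamel integral.\<close>

lemma bounded_linear_probe:
  fixes k :: "'n::finite"
  assumes \<epsilon>: "\<epsilon> > 0"
  shows "bounded_linear (\<lambda>h :: (real^'n) \<Rightarrow>\<^sub>C complex. LINT x|lborel. h x * of_real (probe k \<epsilon> 0 x))"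
proof -
  have p: "integrable lborel (probe k \<epsilon> 0)" by (rule integrable_probe[OF \<epsilon> order_refl])
  have i: "integrable lborel (\<lambda>x. h x * of_real (probe k \<epsilon> 0 x))" for h :: "(real^'n) \<Rightarrow>\<^sub>C complex"
    using integrable_bounded_times[OF p, of h "norm h"] norm_bounded[of h] by (simp add: mult.commute)
  show ?thesis
  proof (rule bounded_linear_intro[where K="LINT x|lborel. \<bar>probe k \<epsilon> 0 x\<bar>"])
    fix h h' :: "(real^'n) \<Rightarrow>\<^sub>C complex" and r :: real
    show "(LINT x|lborel. (h + h') x * of_real (probe k \<epsilon> 0 x))
        = (LINT x|lborel. h x * of_real (probe k \<epsilon> 0 x)) + (LINT x|lborel. h' x * of_real (probe k \<epsilon> 0 x))"
      using i[of h] i[of h'] by (simp add: distrib_right)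
    show "(LINT x|lborel. (r *\<^sub>R h) x * of_real (probe k \<epsilon> 0 x)) = r *\<^sub>R (LINT x|lborel. h x * of_real (probe k \<epsilon> 0 x))"
      by simp
    have "norm (LINT x|lborel. h x * of_real (probe k \<epsilon> 0 x)) \<le> (LINT x|lborel. norm h * \<bar>probe k \<epsilon> 0 x\<bar>)"
      by (rule Bochner_Integration.integral_norm_bound_integral[OF i])
         (use p norm_bounded in \<open>auto simp: norm_mult intro!: mult_right_mono\<close>)
    then show "norm (LINT x|lborel. h x * of_real (probe k \<epsilon> 0 x)) \<le> norm h * (LINT x|lborel. \<bar>probe k \<epsilon> 0 x\<bar>)"
      by simp
  qed
qed

lemma has_integral_shifted_powr:
  fixes e :: real
  assumes "\<epsilon> > 0" "t \<ge> 0" "e > 0"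
  shows "((\<lambda>\<sigma>. (\<epsilon> + (t - \<sigma>)) powr (- e - 1)) has_integral (\<epsilon> powr (- e) - (\<epsilon> + t) powr (- e)) / e) {0..t}"
proof -
  have "((\<lambda>\<sigma>. (\<epsilon> + (t - \<sigma>)) powr (- e - 1)) has_integral
      ((\<epsilon> + (t - t)) powr (- e) / e - (\<epsilon> + (t - 0)) powr (- e) / e)) {0..t}"
  proof (rule fundamental_theorem_of_calculus[OF assms(2)])
    fix x assume "x \<in> {0..t}"
    then have "\<epsilon> + (t - x) > 0" using assms by auto
    then have "((\<lambda>\<sigma>. (\<epsilon> + (t - \<sigma>)) powr (- e) / e) has_real_derivative (\<epsilon> + (t - x)) powr (- e - 1)) (at x within {0..t})"
      using assms by (auto intro!: derivative_eq_intros)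
    then show "((\<lambda>\<sigma>. (\<epsilon> + (t - \<sigma>)) powr (- e) / e) has_vector_derivative (\<epsilon> + (t - x)) powr (- e - 1)) (at x within {0..t})"
      by (simp add: has_real_derivative_iff_has_vector_derivative)
  qed
  then show ?thesis by (simp add: diff_divide_distrib)
qed

lemma unbounded_powr_neg:
  fixes e X \<delta> :: real
  assumes "e > 0" "\<delta> > 0"
  obtains \<epsilon> where "0 < \<epsilon>" "\<epsilon> \<le> \<delta>" "\<epsilon> powr (- e) > X"
proof -
  define Y where "Y = max (X + 1) (max 1 (\<delta> powr (- e)))"
  have Y: "Y > 0" "Y > X" "\<delta> powr (- e) \<le> Y" by (auto simp: Y_def)
  show ?thesis
  proof
    show "Y powr (- 1 / e) > 0" using Y by simp
    have "Y powr (- 1 / e) \<le> (\<delta> powr (- e)) powr (- 1 / e)"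
      using Y assms by (intro powr_mono2') auto
    also have "\<dots> = \<delta>" using assms by (simp add: powr_powr)
    finally show "Y powr (- 1 / e) \<le> \<delta>" .
    show "(Y powr (- 1 / e)) powr (- e) > X" using Y assms by (simp add: powr_powr)
  qed
qed

text \<open>In Duhamel's formula paired with the probe, \<open>u t\<close> and the heat flow of the
  initial value stay bounded as \<epsilon> tends to 0, while the remaining term, divided by
  \<open>lam\<close>, has real part tending to minus infinity. The time \<open>t0\<close> is fixed
  before \<open>p\<close> and \<open>s\<close>.\<close>

lemma mild_datum_not_sobolev:
  fixes w :: "(real^'n::finite) \<Rightarrow>\<^sub>C complex" and k :: 'n
  assumes \<alpha>: "0 < \<alpha>" "\<alpha> < 2" and lam: "lam \<noteq> 0"
    and w: "apply_bcontfun w = (\<lambda>x. of_real (datum k x))" "w \<in> C0_odd k"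
    and u: "mild lam \<alpha> w (ereal T) u" "T > 0" "\<And>t. 0 \<le> t \<Longrightarrow> t < T \<Longrightarrow> u t \<in> C0_odd k"
      "\<And>t. 0 \<le> t \<Longrightarrow> t < T \<Longrightarrow> norm (u t) \<le> R"
  obtains t0 where "0 < t0" "t0 < T"
    "\<And>t p s. 0 < t \<Longrightarrow> t < t0 \<Longrightarrow> 1 < p \<Longrightarrow> s > 5 + 1 / p \<Longrightarrow> dist_of_fun (u t) \<notin> sobolev s p"
proof -
  have wC: "w \<in> C0" using w(2) C0_odd_subset by blast
  obtain C where C: "C \<ge> 0" "\<And>t x. 0 \<le> t \<Longrightarrow> t < T \<Longrightarrow> norm (u t x - w x) \<le> C * sqrt t * \<bar>x $ k\<bar>"
    using mild_datum_near[OF \<alpha>(1) w u(1,3,4)] by blast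
  obtain c a0 where c: "c > 0" "a0 > 0" "\<And>\<epsilon> \<tau>. \<epsilon> > 0 \<Longrightarrow> \<tau> \<ge> 0 \<Longrightarrow> \<epsilon> + \<tau> \<le> a0 \<Longrightarrow>
      (LINT x|lborel. \<bar>datum k x\<bar> powr \<alpha> * datum k x * probe k \<epsilon> \<tau> x) \<le> - c * (\<epsilon> + \<tau>) powr (\<alpha> / 2 - 2)"
    using integral_datum_probe_le[OF \<alpha>] by blast
  define D where "D = quint1_moment (\<alpha> + 1) 1"
  \<comment> \<open>The blow-up exponent: the rate \<alpha> / 2 - 2 is \<open>- e - 1\<close>, and
    its time integral is of order \<open>\<epsilon> powr (- e)\<close>.\<close>
  define e where "e = 1 - \<alpha> / 2"
  define A where "A = (\<alpha> + 2) * 2 powr \<alpha> * D"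
  have D: "D \<ge> 0" unfolding D_def by (rule quint1_moment_nonneg)
  have e: "e > 0" using \<alpha> by (simp add: e_def)
  have A: "A \<ge> 0" using \<alpha> D by (simp add: A_def)
  \<comment> \<open>The admissible relative error: \<open>A * \<delta>\<close> then consumes at most
    half of the leading coefficient \<open>c\<close>.\<close>
  define \<delta> where "\<delta> = min 1 (c / (2 * (A + 1)))"
  have \<delta>: "\<delta> > 0" "\<delta> \<le> 1" using c A by (auto simp: \<delta>_def)
  have "A * \<delta> \<le> A * (c / (2 * (A + 1)))" using A by (intro mult_left_mono) (auto simp: \<delta>_def)
  also have "\<dots> \<le> c / 2" using A c by (simp add: field_simps)
  finally have A\<delta>: "A * \<delta> \<le> c / 2" .
  \<comment> \<open>The three bounds keep \<open>t0\<close> strictly below \<open>T\<close>, leave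
    room for \<epsilon> up to \<open>a0 / 2\<close> with \<epsilon> + (t - \<sigma>) still at most
    \<open>a0\<close>, and make \<open>C * sqrt t \<le> \<delta>\<close>.\<close>
  define t0 where "t0 = min (T / 2) (min (a0 / 2) ((\<delta> / (C + 1))\<^sup>2))"
  have t0: "t0 > 0" "t0 < T" "t0 \<le> a0 / 2" using u(2) c \<delta> C by (auto simp: t0_def)
  have \<eta>: "C * sqrt t \<le> \<delta>" if "0 \<le> t" "t < t0" for t
  proof -
    have "sqrt t \<le> sqrt ((\<delta> / (C + 1))\<^sup>2)"
      using that by (intro real_sqrt_le_mono) (simp add: t0_def)
    also have "\<dots> = \<delta> / (C + 1)" using \<delta> C by simp
    finally have "C * sqrt t \<le> C * (\<delta> / (C + 1))" using C by (intro mult_left_mono)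
    also have "\<dots> \<le> \<delta>" using C \<delta> by (simp add: field_simps)
    finally show ?thesis .
  qed
  define J where "J = (\<lambda>\<epsilon> t \<sigma>. LINT x|lborel. pnl \<alpha> (u \<sigma> x) * of_real (probe k \<epsilon> (t - \<sigma>) x))"
  have ReJ: "Re (J \<epsilon> t \<sigma>) \<le> - (c / 2) * (\<epsilon> + (t - \<sigma>)) powr (- e - 1)"
    if "0 < \<epsilon>" "\<epsilon> \<le> a0 / 2" "0 \<le> \<sigma>" "\<sigma> \<le> t" "t < t0" for \<epsilon> t \<sigma>
  proof -
    have \<sigma>: "0 \<le> \<sigma>" "\<sigma> < t0" "\<sigma> < T" and \<tau>: "t - \<sigma> \<ge> 0" "\<epsilon> + (t - \<sigma>) \<le> a0"
      using that t0 by linarith+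
    define a where "a = \<epsilon> + (t - \<sigma>)"
    define E where "E = (\<alpha> + 2) * 2 powr \<alpha> * \<delta>"
    define J0 where "J0 = (LINT x|lborel. \<bar>datum k x\<bar> powr \<alpha> * datum k x * probe k \<epsilon> (t - \<sigma>) x)"
    define B where "B = max (norm (u \<sigma>) powr (\<alpha> + 1)) (norm w powr (\<alpha> + 1))"
    have pow: "norm (pnl \<alpha> (h x)) \<le> norm h powr (\<alpha> + 1)" for h :: "(real^'n) \<Rightarrow>\<^sub>C complex" and x
      using \<alpha> by (auto simp: norm_pnl intro!: powr_mono2 norm_bounded)
    have pm: "(\<lambda>x. pnl \<alpha> (h x)) \<in> borel_measurable borel" for h :: "(real^'n) \<Rightarrow>\<^sub>C complex"
      by (intro borel_measurable_continuous_onI continuous_on_pnl \<alpha> continuous_on_apply_bcontfun)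
    have "norm (J \<epsilon> t \<sigma> - (LINT x|lborel. pnl \<alpha> (w x) * of_real (probe k \<epsilon> (t - \<sigma>) x)))
        \<le> E * ((\<epsilon> + (t - \<sigma>)) powr ((\<alpha> + 1 + 1) / 2 - 3) * quint1_moment (\<alpha> + 1) 1)"
      unfolding J_def
    proof (rule integral_probe_diff_le[OF pm pm])
      show "norm (pnl \<alpha> (u \<sigma> x)) \<le> B" "norm (pnl \<alpha> (w x)) \<le> B" for x
        using pow[of "u \<sigma>" x] pow[of w x] by (auto simp: B_def)
      show "norm (pnl \<alpha> (u \<sigma> x) - pnl \<alpha> (w x)) \<le> E * \<bar>x $ k\<bar> powr (\<alpha> + 1)" for x
      proof -
        have "norm (u \<sigma> x - of_real (datum k x)) \<le> C * sqrt \<sigma> * \<bar>x $ k\<bar>"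
          using C(2)[OF \<sigma>(1,3), of x] by (simp add: w)
        also have "\<dots> \<le> \<delta> * \<bar>x $ k\<bar>" using \<eta>[OF \<sigma>(1,2)] by (intro mult_right_mono) auto
        finally show ?thesis
          using pnl_datum_near[OF \<alpha>(1), of \<delta> "u \<sigma> x" k x] \<delta> by (simp add: w E_def)
      qed
    qed (use that \<tau> \<alpha> in auto)
    also have "(\<alpha> + 1 + 1) / 2 - 3 = - e - 1" by (simp add: e_def field_simps)
    also have "E * ((\<epsilon> + (t - \<sigma>)) powr (- e - 1) * quint1_moment (\<alpha> + 1) 1) = (A * \<delta>) * a powr (- e - 1)"
      by (simp add: A_def E_def D_def a_def mult_ac)
    also have "\<dots> \<le> c / 2 * a powr (- e - 1)" using A\<delta> by (intro mult_right_mono) auto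
    also have "(LINT x|lborel. pnl \<alpha> (w x) * of_real (probe k \<epsilon> (t - \<sigma>) x)) = of_real J0"
      unfolding J0_def by (simp add: w pnl_def flip: integral_complex_of_real)
    finally have 1: "norm (J \<epsilon> t \<sigma> - of_real J0) \<le> c / 2 * a powr (- e - 1)" .
    have "J0 \<le> - c * a powr (\<alpha> / 2 - 2)"
      unfolding J0_def a_def by (rule c(3)) (use that \<tau> in auto)
    moreover have "\<alpha> / 2 - 2 = - e - 1" by (simp add: e_def)
    ultimately have 2: "J0 \<le> - c * a powr (- e - 1)" by simp
    have "Re (J \<epsilon> t \<sigma>) - J0 \<le> norm (J \<epsilon> t \<sigma> - of_real J0)"
      using complex_Re_le_cmod[of "J \<epsilon> t \<sigma> - of_real J0"] by simp
    then show ?thesis using 1 2 by (simp add: a_def algebra_simps)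
  qed
  show ?thesis
  proof
    show "0 < t0" "t0 < T" by (rule t0)+
    fix t p s :: real assume t: "0 < t" "t < t0" and p: "1 < p" and s: "s > 5 + 1 / p"
    show "dist_of_fun (u t) \<notin> sobolev s p"
    proof
      assume "dist_of_fun (u t) \<in> sobolev s p"
      from sobolev_probe_bounded[OF this p s, of k] obtain C' where
        C': "\<And>\<epsilon>. \<epsilon> > 0 \<Longrightarrow> norm (LINT x|lborel. u t x * of_real (probe k \<epsilon> 0 x)) \<le> C'" by blast
      \<comment> \<open>The value of \<open>\<epsilon> powr (- e)\<close> beyond which the lower
        bound for the Duhamel term exceeds the upper bound; found by solving the final
        inequality.\<close>
      define X where "X = (C' + norm w * (t powr (- (5 / 2)) * quint1_moment 0 1)) / norm lam * (2 * e / c) + t powr (- e)"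
      obtain \<epsilon> where \<epsilon>: "0 < \<epsilon>" "\<epsilon> \<le> a0 / 2" "\<epsilon> powr (- e) > X"
        using unbounded_powr_neg[OF e, of "a0 / 2" X] c by auto
      define l where "l = (\<lambda>h :: (real^'n) \<Rightarrow>\<^sub>C complex. LINT x|lborel. h x * of_real (probe k \<epsilon> 0 x))"
      have l: "bounded_linear l" unfolding l_def by (rule bounded_linear_probe[OF \<epsilon>(1)])
      have tT: "ereal t < ereal T" using t t0 by simp
      let ?F = "\<lambda>\<sigma>. source lam \<alpha> (u \<sigma>)"
      note F = source_continuous_C0[OF \<alpha>(1) wC mildD(1)[OF \<alpha>(1) wC u(1)] mildD(2)[OF \<alpha>(1) wC u(1)] tT]
      have lheat: "l (heatop \<tau> h) = (LINT x|lborel. h x * of_real (probe k \<epsilon> \<tau> x))" if "h \<in> C0" "\<tau> \<ge> 0" for h \<tau>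
        unfolding l_def apply_heatop[OF that]
        by (rule integral_heat_probe[OF _ norm_bounded \<epsilon>(1) that(2)]) measurable
      have lJ: "l (heatop (t - \<sigma>) (?F \<sigma>)) = lam * J \<epsilon> t \<sigma>" if "\<sigma> \<in> {0..t}" for \<sigma>
      proof -
        have "l (heatop (t - \<sigma>) (?F \<sigma>)) = (LINT x|lborel. ?F \<sigma> x * of_real (probe k \<epsilon> (t - \<sigma>) x))"
          using that by (intro lheat F(2)) auto
        also have "\<dots> = (LINT x|lborel. lam * (pnl \<alpha> (u \<sigma> x) * of_real (probe k \<epsilon> (t - \<sigma>) x)))"
          by (simp only: apply_source[OF \<alpha>(1)] mult.assoc)
        finally show ?thesis by (simp only: J_def integral_mult_right_zero)
      qed
      have int: "(\<lambda>\<sigma>. heatop (t - \<sigma>) (?F \<sigma>)) integrable_on {0..t}"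
        by (intro integrable_continuous_real continuous_on_heatop_diff F)
      have i: "(\<lambda>\<sigma>. l (heatop (t - \<sigma>) (?F \<sigma>))) integrable_on {0..t}"
        using integrable_linear[OF int l] by (simp add: o_def)
      have lc: "l (conv_heat ?F t) = integral {0..t} (\<lambda>\<sigma>. l (heatop (t - \<sigma>) (?F \<sigma>)))"
        using integral_linear[OF int l] by (simp add: conv_heat_def o_def)
      have "(\<lambda>\<sigma>. lam * J \<epsilon> t \<sigma>) integrable_on {0..t}"
        by (rule integrable_eq[OF i]) (simp add: lJ)
      from integrable_linear[OF this bounded_linear_mult_right[of "1 / lam"]] have iJ: "J \<epsilon> t integrable_on {0..t}"
        using lam by (simp add: o_def)
      have lcJ: "l (conv_heat ?F t) = lam * integral {0..t} (J \<epsilon> t)"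
      proof -
        have "l (conv_heat ?F t) = integral {0..t} (\<lambda>\<sigma>. lam * J \<epsilon> t \<sigma>)"
          unfolding lc by (rule Henstock_Kurzweil_Integration.integral_cong) (simp add: lJ)
        then show ?thesis by simp
      qed
      have t': "0 \<le> t" using t by simp
      note hp = has_integral_mult_right[OF has_integral_shifted_powr[OF \<epsilon>(1) t' e], of "- (c / 2)"]
      have "Re (integral {0..t} (J \<epsilon> t)) = integral {0..t} (\<lambda>\<sigma>. Re (J \<epsilon> t \<sigma>))"
        using integral_linear[OF iJ bounded_linear_Re] by (simp add: o_def)
      also have "\<dots> \<le> - (c / 2) * ((\<epsilon> powr (- e) - (\<epsilon> + t) powr (- e)) / e)"
      proof (rule has_integral_le[OF integrable_integral hp])
        show "(\<lambda>\<sigma>. Re (J \<epsilon> t \<sigma>)) integrable_on {0..t}"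
          using integrable_linear[OF iJ bounded_linear_Re] by (simp add: o_def)
        show "Re (J \<epsilon> t \<sigma>) \<le> - (c / 2) * (\<epsilon> + (t - \<sigma>)) powr (- e - 1)" if "\<sigma> \<in> {0..t}" for \<sigma>
          using that by (intro ReJ \<epsilon> t) auto
      qed
      also have "\<dots> \<le> - (c / 2) * ((\<epsilon> powr (- e) - t powr (- e)) / e)"
      proof -
        have "(\<epsilon> + t) powr (- e) \<le> t powr (- e)" using t \<epsilon> e by (intro powr_mono2') auto
        then show ?thesis using c e by (intro mult_left_mono_neg divide_right_mono) auto
      qed
      finally have "(c / 2) * ((\<epsilon> powr (- e) - t powr (- e)) / e) \<le> - Re (integral {0..t} (J \<epsilon> t))" by simp
      also have "\<dots> \<le> norm (integral {0..t} (J \<epsilon> t))"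
        using abs_Re_le_cmod[of "integral {0..t} (J \<epsilon> t)"] by linarith
      finally have low: "(c / 2) * ((\<epsilon> powr (- e) - t powr (- e)) / e) \<le> norm (integral {0..t} (J \<epsilon> t))" .
      have "norm lam * norm (integral {0..t} (J \<epsilon> t)) = norm (l (conv_heat ?F t))"
        by (simp add: lcJ norm_mult)
      also have "conv_heat ?F t = u t - heatop t w"
        using mildD(3)[OF \<alpha>(1) wC u(1) t' tT] by simp
      also have "norm (l (u t - heatop t w)) \<le> norm (l (u t)) + norm (l (heatop t w))"
        unfolding linear_diff[OF bounded_linear.linear[OF l]] by (rule norm_triangle_ineq4)
      also have "\<dots> \<le> C' + norm w * (t powr (- (5 / 2)) * quint1_moment 0 1)"
      proof (rule add_mono)
        show "norm (l (u t)) \<le> C'" unfolding l_def by (rule C'[OF \<epsilon>(1)])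
        have p: "integrable lborel (probe k \<epsilon> t)" by (rule integrable_probe[OF \<epsilon>(1) t'])
        have "norm (l (heatop t w)) \<le> (LINT x|lborel. norm w * \<bar>probe k \<epsilon> t x\<bar>)"
          unfolding lheat[OF wC t']
        proof (rule Bochner_Integration.integral_norm_bound_integral)
          show "integrable lborel (\<lambda>x. w x * complex_of_real (probe k \<epsilon> t x))"
            using integrable_bounded_times[OF p, of w "norm w"] norm_bounded[of w] by (simp add: mult.commute)
        qed (use p norm_bounded[of w] in \<open>auto simp: norm_mult intro!: mult_right_mono\<close>)
        also have "\<dots> = norm w * (LINT x|lborel. \<bar>probe k \<epsilon> t x\<bar>)" by simp
        also have "\<dots> \<le> norm w * ((\<epsilon> + t) powr (- (5 / 2)) * quint1_moment 0 1)"
          using integral_probe_powr_le[OF \<epsilon>(1) t' order_refl, of k] by (intro mult_left_mono) auto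
        \<comment> \<open>The time \<open>t\<close> is positive and fixed, so the heat flow of the
          initial value contributes uniformly in \<epsilon>.\<close>
        also have "\<dots> \<le> norm w * (t powr (- (5 / 2)) * quint1_moment 0 1)"
          using \<epsilon> t by (intro mult_left_mono mult_right_mono powr_mono2' quint1_moment_nonneg) auto
        finally show "norm (l (heatop t w)) \<le> norm w * (t powr (- (5 / 2)) * quint1_moment 0 1)" .
      qed
      finally have up: "norm lam * norm (integral {0..t} (J \<epsilon> t)) \<le> C' + norm w * (t powr (- (5 / 2)) * quint1_moment 0 1)" .
      have "norm (integral {0..t} (J \<epsilon> t)) \<le> (C' + norm w * (t powr (- (5 / 2)) * quint1_moment 0 1)) / norm lam"
        using up lam by (simp add: field_simps)
      with low have "(c / 2) * ((\<epsilon> powr (- e) - t powr (- e)) / e) \<le> (C' + norm w * (t powr (- (5 / 2)) * quint1_moment 0 1)) / norm lam"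
        by linarith
      then have "(c / 2) * ((\<epsilon> powr (- e) - t powr (- e)) / e) * (2 * e / c) \<le> (C' + norm w * (t powr (- (5 / 2)) * quint1_moment 0 1)) / norm lam * (2 * e / c)"
        using e c by (intro mult_right_mono) auto
      also have "(c / 2) * ((\<epsilon> powr (- e) - t powr (- e)) / e) * (2 * e / c) = \<epsilon> powr (- e) - t powr (- e)"
        using e c by (simp add: field_simps)
      finally show False using \<epsilon>(3) unfolding X_def by linarith
    qed
  qed
qed

theorem theorem1p7:
  fixes \<alpha> :: real and lam :: complex
  assumes "0 < \<alpha>" and "\<alpha> < 2" and "lam \<noteq> 0"
  shows "\<exists>u0 \<in> (Cc_infty :: (real^'n::finite \<Rightarrow> complex) set). \<exists>Tmax u.
           maximal_solution \<alpha> lam u0 Tmax u \<and>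
           (\<forall>p s :: real. 1 < p \<longrightarrow> s > 5 + 1 / p \<longrightarrow>
              (\<exists>t0 > 0. ereal t0 < Tmax \<and>
                 (\<forall>t. 0 < t \<and> t < t0 \<longrightarrow>
                    dist_of_fun (apply_bcontfun (u t)) \<notin> sobolev s p)))"
proof -
  \<comment> \<open>Any coordinate can serve as the normal direction.\<close>
  obtain k :: 'n where True by blast
  obtain w where w: "apply_bcontfun w = (\<lambda>x. complex_of_real (datum k x))" "w \<in> C0_odd k"
    using datum_bcontfun[of k] by blast
  have wC: "w \<in> C0" using w(2) C0_odd_subset by blast
  obtain T v where v: "T > 0" "mild lam \<alpha> w (ereal T) v"
    "\<And>t. 0 \<le> t \<Longrightarrow> t < T \<Longrightarrow> v t \<in> C0_odd k" "\<And>t. 0 \<le> t \<Longrightarrow> t < T \<Longrightarrow> norm (v t) \<le> norm w + 1"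
    using mild_local_existence[OF assms(1) wC w(2), of lam] by blast
  obtain Tmax u where u: "Tmax > 0" "mild lam \<alpha> w Tmax u"
    "\<And>T' v. mild lam \<alpha> w T' v \<Longrightarrow> T' \<le> Tmax \<and> (\<forall>t. 0 \<le> t \<and> ereal t < T' \<longrightarrow> v t = u t)"
    using mild_maximal[OF assms(1) wC v(2)] v(1) by auto
  obtain t0 where t0: "0 < t0" "t0 < T"
    "\<And>t p s. 0 < t \<Longrightarrow> t < t0 \<Longrightarrow> 1 < p \<Longrightarrow> s > 5 + 1 / p \<Longrightarrow> dist_of_fun (v t) \<notin> sobolev s p"
    using mild_datum_not_sobolev[OF assms w v(2,1,3,4)] by blast
  \<comment> \<open>Oddness and the norm bound are known for the local solution \<open>v\<close>;
    uniqueness carries the conclusion over to the maximal one.\<close>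
  have vu: "v t = u t" if "0 < t" "t < t0" for t
    using u(3)[OF v(2)] that t0 by simp
  have "ereal t0 < Tmax"
    using u(3)[OF v(2)] t0(2) by (metis less_ereal.simps(1) less_le_trans)
  show ?thesis
  proof (intro bexI exI conjI allI impI)
    show "(\<lambda>x. complex_of_real (datum k x)) \<in> Cc_infty"
      unfolding datum_def by (rule prod_bumps_Cc_infty[OF datum_factors])
    show "maximal_solution \<alpha> lam (\<lambda>x. complex_of_real (datum k x)) Tmax u"
      unfolding maximal_solution_def w(1)[symmetric] solution_iff_mild[OF assms(1) wC]
      using u by blast
    show "t0 > 0" "ereal t0 < Tmax" by fact+
    show "dist_of_fun (apply_bcontfun (u t)) \<notin> sobolev s p"
      if "1 < p" "5 + 1 / p < s" "0 < t \<and> t < t0" for p s t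
      using t0(3)[of t p s] vu[of t] that by simp
  qed
qed

end
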